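(* Let $F$ be a differential field of characteristic zero with algebraically closed field of constants $C$, and let $F_\infty$ be a complete Picard--Vessiot closure of $F$. Then the extension $F_\infty \supseteq F$ satisfies: (1) The constants of $F_\infty$ are those of $F$. (2) Every linear homogeneous differential equation over $F_\infty$ has a full set of solutions in $F_\infty$. (3) If $F_\infty \supseteq E \supseteq F$ is an intermediate differential subfield such that every linear homogeneous differential equation over $E$ has a full set of solutions in $E$, then $E=F_\infty$. Moreover, any differential field extension $K \supseteq F$ which has properties (1), (2), (3) (with $K$ in place of $F_\infty$) is isomorphic to $F_\infty$ by a differential isomorphism that is the identity on $F$.
   Context: Differential fields are ordinary (one derivation), of characteristic zero. A linear homogeneous differential equation over a differential field $M$ with field of constants $C$ is an equation $Y^{(n)}+a_{n-1}Y^{(n-1)}+\dots+a_1Y^{(1)}+a_0Y=0$ with all $a_i\in M$. It has a full set of solutions in a differential extension $N\supseteq M$ with the same constants $C$ if its solution space in $N$ has dimension $n$ over $C$. A Picard--Vessiot closure of a differential field $M$ with algebraically closed constants $C$ is a differential field extension $M_1\supseteq M$ such that: the constants of $M_1$ are those of $M$; every linear homogeneous differential equation over $M$ has a full set of solutions in $M_1$; and $M_1$ is generated as a differential field over $M$ by solutions in $M_1$ of such equations. (Picard--Vessiot closures exist and are unique up to isomorphism over $M$.) A complete Picard--Vessiot closure of $F$ is the union $F_\infty=\bigcup_{i\ge 0}F_i$ of a tower $F=F_0\subseteq F_1\subseteq F_2\subseteq\cdots$ of differential fields in which $F_{i+1}$ is a Picard--Vessiot closure of $F_i$ for every $i\geq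 0$. *)

theory Defs
  imports "HOL-Algebra.Algebra" "HOL.Hull"
begin

text \<open>Ordinary differential fields of characteristic zero. The derivation \<open>d\<close> is a total
  function whose values outside the carrier are irrelevant.\<close>

locale differential_field = field R for R (structure) +
  fixes d :: "'a \<Rightarrow> 'a"
  assumes char_zero: "0 < (n::nat) \<Longrightarrow> [n] \<cdot> \<one> \<noteq> \<zero>"
    and deriv_closed: "x \<in> carrier R \<Longrightarrow> d x \<in> carrier R"
    and deriv_add: "\<lbrakk>x \<in> carrier R; y \<in> carrier R\<rbrakk> \<Longrightarrow> d (x \<oplus> y) = d x \<oplus> d y"
    and deriv_mult: "\<lbrakk>x \<in> carrier R; y \<in> carrier R\<rbrakk> \<Longrightarrow> d (x \<otimes> y) = (d x \<otimes> y) \<oplus> (x \<otimes> d y)"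

definition differential_subfield :: "('a, 'm) ring_scheme \<Rightarrow> ('a \<Rightarrow> 'a) \<Rightarrow> 'a set \<Rightarrow> bool"
  where "differential_subfield R d M \<longleftrightarrow> subfield M R \<and> (\<forall>x\<in>M. d x \<in> M)"

definition constants :: "('a, 'm) ring_scheme \<Rightarrow> ('a \<Rightarrow> 'a) \<Rightarrow> 'a set \<Rightarrow> 'a set"
  where "constants R d M = {x \<in> M. d x = \<zero>\<^bsub>R\<^esub>}"

text \<open>The pair \<open>(n, a)\<close> encodes the monic equation
  \<open>Y\<^sup>(\<^sup>n\<^sup>) + a (n-1) Y\<^sup>(\<^sup>n\<^sup>-\<^sup>1\<^sup>) + \<dots> + a 0 Y = 0\<close>; the values \<open>a i\<close> for \<open>i \<ge> n\<close> are not used.\<close>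

definition lin_diff_op ::
  "('a, 'm) ring_scheme \<Rightarrow> ('a \<Rightarrow> 'a) \<Rightarrow> nat \<Rightarrow> (nat \<Rightarrow> 'a) \<Rightarrow> 'a \<Rightarrow> 'a"
  where "lin_diff_op R d n a y =
    (d ^^ n) y \<oplus>\<^bsub>R\<^esub> (\<Oplus>\<^bsub>R\<^esub>i\<in>{..<n}. a i \<otimes>\<^bsub>R\<^esub> (d ^^ i) y)"

definition solutions ::
  "('a, 'm) ring_scheme \<Rightarrow> ('a \<Rightarrow> 'a) \<Rightarrow> 'a set \<Rightarrow> nat \<Rightarrow> (nat \<Rightarrow> 'a) \<Rightarrow> 'a set"
  where "solutions R d N n a = {y \<in> N. lin_diff_op R d n a y = \<zero>\<^bsub>R\<^esub>}"

text \<open>Every linear homogeneous differential equation over \<open>M\<close> has a full set of solutions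
  in \<open>N\<close>. The notion is meant for \<open>N\<close> with the same constants as \<open>M\<close>; where \<open>N \<noteq> M\<close> this is
  required separately.\<close>

definition full_solution_sets ::
  "('a, 'm) ring_scheme \<Rightarrow> ('a \<Rightarrow> 'a) \<Rightarrow> 'a set \<Rightarrow> 'a set \<Rightarrow> bool"
  where "full_solution_sets R d M N \<longleftrightarrow>
    (\<forall>n a. (\<forall>i<n. a i \<in> M) \<longrightarrow>
      ring.dimension R n (constants R d M) (solutions R d N n a))"

definition differential_closure ::
  "('a, 'm) ring_scheme \<Rightarrow> ('a \<Rightarrow> 'a) \<Rightarrow> 'a set \<Rightarrow> 'a set \<Rightarrow> 'a set"
  where "differential_closure R d M S = differential_subfield R d hull (M \<union> S)"

definition picard_vessiot_closure ::
  "('a, 'm) ring_scheme \<Rightarrow> ('a \<Rightarrow> 'a) \<Rightarrow> 'a set \<Rightarrow> 'a set \<Rightarrow> bool"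
  where "picard_vessiot_closure R d M N \<longleftrightarrow>
    differential_subfield R d M \<and> differential_subfield R d N \<and> M \<subseteq> N \<and>
    constants R d N = constants R d M \<and>
    full_solution_sets R d M N \<and>
    N = differential_closure R d M (\<Union>{solutions R d N n a |n a. \<forall>i<n. a i \<in> M})"

text \<open>The whole differential field \<open>(R, d)\<close> is a complete Picard--Vessiot closure of its
  differential subfield \<open>F\<close>.\<close>

definition complete_picard_vessiot_closure ::
  "('a, 'm) ring_scheme \<Rightarrow> ('a \<Rightarrow> 'a) \<Rightarrow> 'a set \<Rightarrow> bool"
  where "complete_picard_vessiot_closure R d F \<longleftrightarrow>
    (\<exists>T :: nat \<Rightarrow> 'a set. T 0 = F \<and>
      (\<forall>i. picard_vessiot_closure R d (T i) (T (Suc i))) \<and>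
      carrier R = (\<Union>i. T i))"

text \<open>A differential field extension of \<open>(R, d)\<close> whose elements live in another type is given
  by a homomorphism \<open>j\<close>, which is injective because \<open>R\<close> is a field.\<close>

definition differential_hom ::
  "('a, 'm) ring_scheme \<Rightarrow> ('a \<Rightarrow> 'a) \<Rightarrow> ('b, 'n) ring_scheme \<Rightarrow> ('b \<Rightarrow> 'b) \<Rightarrow> ('a \<Rightarrow> 'b) \<Rightarrow> bool"
  where "differential_hom R d S e j \<longleftrightarrow>
    j \<in> ring_hom R S \<and> (\<forall>x \<in> carrier R. j (d x) = e (j x))"

definition differential_iso ::
  "('a, 'm) ring_scheme \<Rightarrow> ('a \<Rightarrow> 'a) \<Rightarrow> ('b, 'n) ring_scheme \<Rightarrow> ('b \<Rightarrow> 'b) \<Rightarrow> ('a \<Rightarrow> 'b) \<Rightarrow> bool"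
  where "differential_iso R d S e h \<longleftrightarrow>
    h \<in> ring_iso R S \<and> (\<forall>x \<in> carrier R. h (d x) = e (h x))"

end

theory Submission
  imports Defs
begin

text \<open>The constants \<open>C\<close> of \<open>F\<close> are those of every stage of the tower, hence of \<open>L\<close>. Everything else rests
  on the bound \<open>n\<close> for the dimension over \<open>C\<close> of the solution space of an equation of order \<open>n\<close>. By this
  bound, a stage that contains a full set of solutions contains all solutions in \<open>L\<close>
  (\<open>full_solutions_complete\<close>). An equation over \<open>L\<close> has its finitely many coefficients in some stage, so it
  is solved in the next one; and a differential subfield that contains \<open>F\<close> and full sets of solutions for
  its own equations swallows one stage after the other.

  For the uniqueness, embeddings of differential subfields of \<open>L\<close> into \<open>K\<close> are extended as far as possible
  by Zorn's lemma. The domain of a maximal one is \<open>L\<close>, provided that the solutions of an equation over the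
  domain \<open>E\<close> can always be adjoined (\<open>adjoin_solutions\<close>). The image of \<open>L\<close> then contains full sets of
  solutions for its own equations and is \<open>K\<close> by the minimality of \<open>K\<close>.

  To adjoin solutions, let \<open>Y\<close> and \<open>Z\<close> be the Wronskian matrices of bases of the solution spaces in \<open>L\<close> and
  in \<open>K\<close>. A homomorphism of rings from \<open>E[Y, Y\<inverse>]\<close> to an algebraic closure \<open>\<Omega>\<close> of \<open>K\<close> exists by the extension
  theorem for finitely generated algebras (\<open>extension_from_subfield\<close>); it maps \<open>Y\<close> to \<open>Z c\<close> with \<open>c\<close>
  invertible over \<open>\<Omega>\<close>. The same theorem, now as the Nullstellensatz over the algebraically closed field \<open>C\<close>,
  gives a homomorphism \<open>\<tau>\<close> from \<open>C[c, c\<inverse>]\<close> to \<open>C\<close>. The map \<open>Y \<mapsto> Z \<tau>(c)\<close> respects all relations of \<open>Y\<close> over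
  \<open>E\<close>, and hence is a differential homomorphism on \<open>E[Y]\<close>. The reason is that the relations of \<open>Y\<close> over \<open>E\<close>
  are closed under the derivation: rewritten as relations of \<open>c\<close> with coefficients in \<open>K\<close>, they may be
  differentiated coefficientwise, and by reduction of order (\<open>jet_relation_head\<close>) they then follow from
  relations with coefficients in \<open>C\<close>, which \<open>\<tau>\<close> preserves (\<open>tval_well_defined\<close>).

  The homomorphism is injective because the construction can be repeated in the opposite direction: the
  composite is an endomorphism of \<open>E[Y]\<close> that maps the finite-dimensional spaces of polynomials of bounded
  degree in \<open>Y\<close> onto themselves (\<open>endomorphism_injective\<close>).\<close>

section \<open>Linear algebra and graphs of partial homomorphisms\<close>

lemma (in field) nonzero_inverse [simp, intro]:
  assumes "x \<in> carrier R" "x \<noteq> \<zero>"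
  shows "inv x \<in> carrier R" "inv x \<noteq> \<zero>" "x \<otimes> inv x = \<one>" "inv x \<otimes> x = \<one>"
proof -
  have u: "x \<in> Units R"
    using assms field_Units by blast
  show "inv x \<in> carrier R" "x \<otimes> inv x = \<one>" "inv x \<otimes> x = \<one>"
    using u by (simp_all add: Units_inv_closed Units_r_inv Units_l_inv)
  thus "inv x \<noteq> \<zero>"
    using assms one_not_zero by auto
qed

text \<open>Gaussian elimination on the last equation: a nonzero coefficient there eliminates its unknown.\<close>

lemma (in field) underdetermined_system:
  fixes m :: "nat \<Rightarrow> 'i \<Rightarrow> 'a"
  assumes "finite J" "card J > n" "\<And>i j. \<lbrakk>i < n; j \<in> J\<rbrakk> \<Longrightarrow> m i j \<in> carrier R"
  shows "\<exists>x. (\<forall>j\<in>J. x j \<in> carrier R) \<and> (\<exists>j\<in>J. x j \<noteq> \<zero>) \<and>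
    (\<forall>i<n. (\<Oplus>j\<in>J. m i j \<otimes> x j) = \<zero>)"
  using assms
proof (induction n arbitrary: J m)
  case 0
  then obtain j where "j \<in> J" by fastforce
  thus ?case by (intro exI[of _ "\<lambda>_. \<one>"]) auto
next
  case (Suc n)
  show ?case
  proof (cases "\<exists>p\<in>J. m n p \<noteq> \<zero>")
    case False
    obtain x where x: "\<forall>j\<in>J. x j \<in> carrier R" "\<exists>j\<in>J. x j \<noteq> \<zero>"
      "\<forall>i<n. (\<Oplus>j\<in>J. m i j \<otimes> x j) = \<zero>"
      using Suc.IH[of J m] Suc.prems by auto
    have "(\<Oplus>j\<in>J. m n j \<otimes> x j) = (\<Oplus>j\<in>J. \<zero>)"
      by (rule add.finprod_cong') (use False x(1) in auto)
    hence "(\<Oplus>j\<in>J. m n j \<otimes> x j) = \<zero>" by simp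
    with x show ?thesis by (intro exI[of _ x]) (auto simp: less_Suc_eq)
  next
    case True
    then obtain p where p: "p \<in> J" "m n p \<noteq> \<zero>" by auto
    define J' where "J' = J - {p}"
    have J': "finite J'" "p \<notin> J'" "J = insert p J'" "card J' > n"
      using Suc.prems p by (auto simp: J'_def)
    define q where "q = inv (m n p)"
    have mp: "m n p \<in> carrier R" using Suc.prems p by auto
    have q: "q \<in> carrier R" "m n p \<otimes> q = \<one>"
      using p mp by (auto simp: q_def)
    define m' where "m' i j = m i j \<ominus> (m i p \<otimes> q) \<otimes> m n j" for i j
    have mc: "m i j \<in> carrier R" if "i < Suc n" "j \<in> J" for i j
      using Suc.prems that by auto
    obtain x where x: "\<forall>j\<in>J'. x j \<in> carrier R" "\<exists>j\<in>J'. x j \<noteq> \<zero>"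
      "\<forall>i<n. (\<Oplus>j\<in>J'. m' i j \<otimes> x j) = \<zero>"
    proof -
      have "m' i j \<in> carrier R" if "i < n" "j \<in> J'" for i j
        using that mc[of i j] mc[of i p] mc[of n j] p q J' by (simp add: m'_def)
      thus ?thesis using Suc.IH[of J' m'] J' that by blast
    qed
    define s where "s i = (\<Oplus>j\<in>J'. m i j \<otimes> x j)" for i
    have sc: "s i \<in> carrier R" if "i < Suc n" for i
      unfolding s_def using mc[OF that] x J' by (intro finsum_closed) auto
    define y where "y j = (if j = p then \<ominus> (q \<otimes> s n) else x j)" for j
    have yc: "\<forall>j\<in>J. y j \<in> carrier R"
      using x q sc[of n] J' by (auto simp: y_def)
    have sum_y: "(\<Oplus>j\<in>J. m i j \<otimes> y j) = m i p \<otimes> (\<ominus> (q \<otimes> s n)) \<oplus> s i" if "i < Suc n" for i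
    proof -
      have "(\<Oplus>j\<in>J. m i j \<otimes> y j) = m i p \<otimes> y p \<oplus> (\<Oplus>j\<in>J'. m i j \<otimes> y j)"
        unfolding J'(3) using mc[OF that] yc J' by (intro finsum_insert) auto
      also have "(\<Oplus>j\<in>J'. m i j \<otimes> y j) = s i"
        unfolding s_def using mc[OF that] x J' by (intro add.finprod_cong') (auto simp: y_def)
      finally show ?thesis by (simp add: y_def)
    qed
    have sn: "s n \<in> carrier R" using sc by simp
    have "(\<Oplus>j\<in>J. m i j \<otimes> y j) = \<zero>" if "i < n" for i
    proof -
      have i: "i < Suc n" "i \<noteq> n" using that by auto
      have mip: "m i p \<in> carrier R" using mc i p by auto
      have "s i = (\<Oplus>j\<in>J'. m' i j \<otimes> x j \<oplus> (m i p \<otimes> q) \<otimes> (m n j \<otimes> x j))"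
        unfolding s_def
      proof (rule add.finprod_cong')
        fix j assume "j \<in> J'"
        hence c: "m i j \<in> carrier R" "m n j \<in> carrier R" "x j \<in> carrier R"
          using mc i x J' by auto
        show "m i j \<otimes> x j = m' i j \<otimes> x j \<oplus> (m i p \<otimes> q) \<otimes> (m n j \<otimes> x j)"
          unfolding m'_def using c mip q by algebra
      qed (use x mc i q mip J' in \<open>auto simp: m'_def\<close>)
      also have "\<dots> = (\<Oplus>j\<in>J'. m' i j \<otimes> x j) \<oplus> (\<Oplus>j\<in>J'. (m i p \<otimes> q) \<otimes> (m n j \<otimes> x j))"
        using x mc i q mip J' by (intro finsum_addf) (auto simp: m'_def)
      also have "(\<Oplus>j\<in>J'. (m i p \<otimes> q) \<otimes> (m n j \<otimes> x j)) = (m i p \<otimes> q) \<otimes> s n"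
        unfolding s_def using x mc i q mip J' by (intro finsum_rdistr[symmetric]) auto
      finally have "s i = (m i p \<otimes> q) \<otimes> s n" using x that mip q sn by simp
      thus ?thesis using sum_y[OF i(1)] mip q sn by (simp add: m_assoc r_minus l_neg)
    qed
    moreover have "(\<Oplus>j\<in>J. m n j \<otimes> y j) = \<zero>"
      using sum_y[of n] mp q sn by (simp add: r_minus m_assoc[symmetric] l_neg)
    moreover have "\<exists>j\<in>J. y j \<noteq> \<zero>"
      using x(2) J' by (auto simp: y_def)
    ultimately show ?thesis using yc by (intro exI[of _ y]) (auto simp: less_Suc_eq)
  qed
qed

lemma (in ring) independent_in_Span_length:
  assumes K: "subfield K R" and "independent K us" "set vs \<subseteq> carrier R" "set us \<subseteq> Span K vs"
  shows "length us \<le> length vs"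
proof -
  have "\<exists>ws. independent K ws \<and> length ws \<le> length vs \<and> Span K ws = Span K vs"
    using assms(3)
  proof (induction vs)
    case Nil
    show ?case by (intro exI[of _ "[]"]) auto
  next
    case (Cons v vs)
    then obtain ws where ws: "independent K ws" "length ws \<le> length vs" "Span K ws = Span K vs" by auto
    have v: "v \<in> carrier R" "set vs \<subseteq> carrier R" "set ws \<subseteq> carrier R"
      using Cons.prems independent_in_carrier[OF ws(1)] by auto
    show ?case
    proof (cases "v \<in> Span K ws")
      case True
      have "set (v # vs) \<subseteq> Span K vs" using True ws(3) Span_base_incl[OF K v(2)] by simp
      hence "Span K (v # vs) \<subseteq> Span K vs" by (rule mono_Span_subset[OF K _ v(2)])
      moreover have "Span K vs \<subseteq> Span K (v # vs)" by (rule mono_Span[OF K v(2,1)])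
      ultimately show ?thesis using ws by (intro exI[of _ ws]) (simp del: Span.simps)
    next
      case False
      have "Span K (v # ws) = Span K (v # vs)" using ws(3) by simp
      thus ?thesis using ws False v li_Cons by (intro exI[of _ "v # ws"]) (simp del: Span.simps)
    qed
  qed
  then obtain ws where "independent K ws" "length ws \<le> length vs" "Span K ws = Span K vs" by blast
  thus ?thesis using independent_length_le[OF K assms(2), of ws] assms(4) by simp
qed

lemma (in abelian_monoid) finsum_swap:
  assumes "finite A" "finite B" "\<And>i j. \<lbrakk>i \<in> A; j \<in> B\<rbrakk> \<Longrightarrow> f i j \<in> carrier G"
  shows "(\<Oplus>i\<in>A. \<Oplus>j\<in>B. f i j) = (\<Oplus>j\<in>B. \<Oplus>i\<in>A. f i j)"
  using assms(2,3)
proof (induction B)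
  case empty
  have "(\<Oplus>i\<in>A. \<Oplus>j\<in>{}. f i j) = (\<Oplus>i\<in>A. \<zero>)"
    by (rule add.finprod_cong') auto
  thus ?case by simp
next
  case (insert j B)
  have c: "f i j \<in> carrier G" "(\<Oplus>j\<in>B. f i j) \<in> carrier G" if "i \<in> A" for i
    using insert.prems that by (auto intro!: finsum_closed)
  have "(\<Oplus>i\<in>A. \<Oplus>j\<in>insert j B. f i j) = (\<Oplus>i\<in>A. f i j \<oplus> (\<Oplus>j\<in>B. f i j))"
  proof (rule add.finprod_cong')
    fix i assume "i \<in> A"
    thus "(\<Oplus>j\<in>insert j B. f i j) = f i j \<oplus> (\<Oplus>j\<in>B. f i j)"
      using insert by (intro finsum_insert) auto
  qed (use c in auto)
  also have "\<dots> = (\<Oplus>i\<in>A. f i j) \<oplus> (\<Oplus>i\<in>A. \<Oplus>j\<in>B. f i j)"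
    using c by (intro finsum_addf) auto
  also have "\<dots> = (\<Oplus>j\<in>insert j B. \<Oplus>i\<in>A. f i j)"
    using insert by (subst finsum_insert) (auto intro!: finsum_closed)
  finally show ?case .
qed

text \<open>A homomorphism into \<open>S\<close> that is defined on a subring of \<open>R\<close> is represented by its graph, a
  subring of \<open>R \<times> S\<close> that is single-valued. Extension is then inclusion, and composition, inversion
  and the union of a chain are the corresponding operations on sets of pairs.\<close>

locale partial_hom = R: field R + S: field S
  for R :: "('a, 'm) ring_scheme" and S :: "('b, 'n) ring_scheme" +
  fixes \<Gamma> :: "('a \<times> 'b) set"
  assumes subset: "\<Gamma> \<subseteq> carrier R \<times> carrier S"
    and one: "(\<one>\<^bsub>R\<^esub>, \<one>\<^bsub>S\<^esub>) \<in> \<Gamma>"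
    and add: "\<lbrakk>(x, w) \<in> \<Gamma>; (y, v) \<in> \<Gamma>\<rbrakk> \<Longrightarrow> (x \<oplus>\<^bsub>R\<^esub> y, w \<oplus>\<^bsub>S\<^esub> v) \<in> \<Gamma>"
    and mult: "\<lbrakk>(x, w) \<in> \<Gamma>; (y, v) \<in> \<Gamma>\<rbrakk> \<Longrightarrow> (x \<otimes>\<^bsub>R\<^esub> y, w \<otimes>\<^bsub>S\<^esub> v) \<in> \<Gamma>"
    and uminus: "(x, w) \<in> \<Gamma> \<Longrightarrow> (\<ominus>\<^bsub>R\<^esub> x, \<ominus>\<^bsub>S\<^esub> w) \<in> \<Gamma>"
    and zero_unique: "(\<zero>\<^bsub>R\<^esub>, w) \<in> \<Gamma> \<Longrightarrow> w = \<zero>\<^bsub>S\<^esub>"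
begin

lemma closed: "(x, w) \<in> \<Gamma> \<Longrightarrow> x \<in> carrier R" "(x, w) \<in> \<Gamma> \<Longrightarrow> w \<in> carrier S"
  using subset by auto

lemma zero: "(\<zero>\<^bsub>R\<^esub>, \<zero>\<^bsub>S\<^esub>) \<in> \<Gamma>"
  using add[OF one uminus[OF one]] by (simp add: R.r_neg S.r_neg)

lemma minus: "\<lbrakk>(x, w) \<in> \<Gamma>; (y, v) \<in> \<Gamma>\<rbrakk> \<Longrightarrow> (x \<ominus>\<^bsub>R\<^esub> y, w \<ominus>\<^bsub>S\<^esub> v) \<in> \<Gamma>"
  using add[OF _ uminus] by (simp add: a_minus_def)

lemma unique: "\<lbrakk>(x, w) \<in> \<Gamma>; (x, v) \<in> \<Gamma>\<rbrakk> \<Longrightarrow> w = v"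
proof -
  assume a: "(x, w) \<in> \<Gamma>" "(x, v) \<in> \<Gamma>"
  have "(\<zero>\<^bsub>R\<^esub>, w \<ominus>\<^bsub>S\<^esub> v) \<in> \<Gamma>"
    using minus[OF a] closed[OF a(1)] by (simp add: a_minus_def[of R] R.r_neg)
  hence "w \<ominus>\<^bsub>S\<^esub> v = \<zero>\<^bsub>S\<^esub>" by (rule zero_unique)
  thus "w = v" using closed[OF a(1)] closed[OF a(2)] S.r_right_minus_eq by blast
qed

lemma finsum:
  assumes "\<And>i. i \<in> I \<Longrightarrow> (f i, g i) \<in> \<Gamma>"
  shows "(finsum R f I, finsum S g I) \<in> \<Gamma>"
proof (cases "finite I")
  case False
  thus ?thesis by (simp add: zero)
next
  case True
  thus ?thesis using assms
  proof (induction I)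
    case (insert i I)
    have "f \<in> I \<rightarrow> carrier R" "f i \<in> carrier R" "g \<in> I \<rightarrow> carrier S" "g i \<in> carrier S"
      using insert.prems closed by blast+
    thus ?case using insert by (simp add: add)
  qed (simp add: zero)
qed

lemma Domain_subring: "subring (Domain \<Gamma>) R"
  by (rule R.subringI) (use subset one add mult uminus in blast)+

lemma nonzero: "\<lbrakk>(x, w) \<in> \<Gamma>; w \<noteq> \<zero>\<^bsub>S\<^esub>\<rbrakk> \<Longrightarrow> x \<noteq> \<zero>\<^bsub>R\<^esub>"
  using zero_unique by blast

end

lemma (in field) Id_on_partial_hom:
  assumes "subring A R"
  shows "partial_hom R R (Id_on A)"
proof unfold_locales
  note A = subringE[OF assms]
  show "Id_on A \<subseteq> carrier R \<times> carrier R" using A(1) by auto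
  show "(\<one>, \<one>) \<in> Id_on A" using A(3) by (rule Id_onI)
qed (auto simp: subringE(5-7)[OF assms])

lemma partial_hom_comp:
  assumes "partial_hom R S \<Gamma>" "partial_hom S T \<Delta>"
  shows "partial_hom R T (\<Gamma> O \<Delta>)"
proof -
  interpret A: partial_hom R S \<Gamma> by fact
  interpret B: partial_hom S T \<Delta> by fact
  show ?thesis
  proof unfold_locales
    show "\<Gamma> O \<Delta> \<subseteq> carrier R \<times> carrier T" using A.closed B.closed by auto
    show "w = \<zero>\<^bsub>T\<^esub>" if "(\<zero>\<^bsub>R\<^esub>, w) \<in> \<Gamma> O \<Delta>" for w
      using that by (auto dest!: A.zero_unique intro: B.zero_unique)
    show "(\<one>\<^bsub>R\<^esub>, \<one>\<^bsub>T\<^esub>) \<in> \<Gamma> O \<Delta>" using A.one B.one by (rule relcompI)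
    show "(\<ominus>\<^bsub>R\<^esub> x, \<ominus>\<^bsub>T\<^esub> w) \<in> \<Gamma> O \<Delta>" if "(x, w) \<in> \<Gamma> O \<Delta>" for x w
      using that by (auto intro: A.uminus B.uminus)
    show "(x \<oplus>\<^bsub>R\<^esub> y, w \<oplus>\<^bsub>T\<^esub> v) \<in> \<Gamma> O \<Delta>" "(x \<otimes>\<^bsub>R\<^esub> y, w \<otimes>\<^bsub>T\<^esub> v) \<in> \<Gamma> O \<Delta>"
      if "(x, w) \<in> \<Gamma> O \<Delta>" "(y, v) \<in> \<Gamma> O \<Delta>" for x w y v
      using that by (auto intro: A.add B.add A.mult B.mult)
  qed
qed

lemma partial_hom_converse:
  assumes "partial_hom R S \<Gamma>" "\<And>x. (x, \<zero>\<^bsub>S\<^esub>) \<in> \<Gamma> \<Longrightarrow> x = \<zero>\<^bsub>R\<^esub>"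
  shows "partial_hom S R (\<Gamma>\<inverse>)"
proof -
  interpret partial_hom R S \<Gamma> by fact
  show ?thesis
    by unfold_locales (use closed one add mult uminus assms(2) in auto)
qed

lemma partial_hom_larger_codomain:
  assumes "partial_hom R (S\<lparr>carrier := C\<rparr>) \<Gamma>" "field S" "C \<subseteq> carrier S"
  shows "partial_hom R S \<Gamma>"
proof -
  interpret A: partial_hom R "S\<lparr>carrier := C\<rparr>" \<Gamma> by fact
  interpret S: field S by fact
  have eq: "\<ominus>\<^bsub>S\<lparr>carrier := C\<rparr>\<^esub> w = \<ominus>\<^bsub>S\<^esub> w" if "w \<in> C" for w
  proof -
    have w: "w \<in> carrier (S\<lparr>carrier := C\<rparr>)" using that by simp
    have "(\<ominus>\<^bsub>S\<lparr>carrier := C\<rparr>\<^esub> w) \<oplus>\<^bsub>S\<^esub> w = \<zero>\<^bsub>S\<^esub>"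
      using A.S.l_neg[OF w] by simp
    moreover have "\<ominus>\<^bsub>S\<lparr>carrier := C\<rparr>\<^esub> w \<in> carrier S" "w \<in> carrier S"
      using A.S.a_inv_closed[OF w] that assms(3) by auto
    ultimately show ?thesis using S.minus_equality by metis
  qed
  show ?thesis
  proof unfold_locales
    show "\<Gamma> \<subseteq> carrier R \<times> carrier S" using A.subset assms(3) by auto
    show "(\<ominus>\<^bsub>R\<^esub> x, \<ominus>\<^bsub>S\<^esub> w) \<in> \<Gamma>" if "(x, w) \<in> \<Gamma>" for x w
      using A.uminus[OF that] eq[of w] A.closed(2)[OF that] by simp
  qed (use A.one A.add A.mult A.zero_unique in auto)
qed

lemma (in partial_hom) list_values:
  "set xs \<subseteq> Domain \<Gamma> \<Longrightarrow> \<exists>ws. list_all2 (\<lambda>x w. (x, w) \<in> \<Gamma>) xs ws"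
proof (induction xs)
  case (Cons x xs)
  then obtain w ws where "(x, w) \<in> \<Gamma>" "list_all2 (\<lambda>x w. (x, w) \<in> \<Gamma>) xs ws" by auto
  thus ?case by (intro exI[of _ "w # ws"]) simp
qed auto

lemma (in partial_hom) compose_ring_hom:
  assumes "field T" "\<iota> \<in> ring_hom S T"
  shows "partial_hom R T {(x, \<iota> w) |x w. (x, w) \<in> \<Gamma>}"
proof -
  interpret T: field T by fact
  interpret h: ring_hom_cring S T \<iota> by unfold_locales (rule assms(2))
  show ?thesis
  proof unfold_locales
    show "{(x, \<iota> w) |x w. (x, w) \<in> \<Gamma>} \<subseteq> carrier R \<times> carrier T" using closed by auto
    show "(\<one>\<^bsub>R\<^esub>, \<one>\<^bsub>T\<^esub>) \<in> {(x, \<iota> w) |x w. (x, w) \<in> \<Gamma>}" 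
      using one by (auto intro!: exI[of _ "\<one>\<^bsub>S\<^esub>"])
    show "(\<ominus>\<^bsub>R\<^esub> x, \<ominus>\<^bsub>T\<^esub> w) \<in> {(x, \<iota> w) |x w. (x, w) \<in> \<Gamma>}"
      if mem: "(x, w) \<in> {(x, \<iota> w) |x w. (x, w) \<in> \<Gamma>}" for x w
    proof -
      obtain w' where *: "(x, w') \<in> \<Gamma>" "w = \<iota> w'" using mem by blast
      show ?thesis
        using uminus[OF *(1)] closed(2)[OF *(1)] *(2) by (auto intro!: exI[of _ "\<ominus>\<^bsub>S\<^esub> w'"])
    qed
    show "w = \<zero>\<^bsub>T\<^esub>" if "(\<zero>\<^bsub>R\<^esub>, w) \<in> {(x, \<iota> w) |x w. (x, w) \<in> \<Gamma>}" for w
      using that zero_unique h.hom_zero by blast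
    fix x w y v assume "(x, w) \<in> {(x, \<iota> w) |x w. (x, w) \<in> \<Gamma>}" "(y, v) \<in> {(x, \<iota> w) |x w. (x, w) \<in> \<Gamma>}"
    then obtain w' v' where *: "(x, w') \<in> \<Gamma>" "w = \<iota> w'" "(y, v') \<in> \<Gamma>" "v = \<iota> v'" by auto
    show "(x \<oplus>\<^bsub>R\<^esub> y, w \<oplus>\<^bsub>T\<^esub> v) \<in> {(x, \<iota> w) |x w. (x, w) \<in> \<Gamma>}"
      using add[OF *(1,3)] closed(2)[OF *(1)] closed(2)[OF *(3)] *(2,4)
      by (auto intro!: exI[of _ "w' \<oplus>\<^bsub>S\<^esub> v'"])
    show "(x \<otimes>\<^bsub>R\<^esub> y, w \<otimes>\<^bsub>T\<^esub> v) \<in> {(x, \<iota> w) |x w. (x, w) \<in> \<Gamma>}"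
      using mult[OF *(1,3)] closed(2)[OF *(1)] closed(2)[OF *(3)] *(2,4)
      by (auto intro!: exI[of _ "w' \<otimes>\<^bsub>S\<^esub> v'"])
  qed
qed

text \<open>The extension of \<open>\<Gamma>\<close> to the fractions whose denominator \<open>\<Gamma>\<close> does not map to zero.\<close>

definition localization ::
  "('a, 'm) ring_scheme \<Rightarrow> ('b, 'n) ring_scheme \<Rightarrow> ('a \<times> 'b) set \<Rightarrow> ('a \<times> 'b) set"
  where "localization R S \<Gamma> = {(x \<otimes>\<^bsub>R\<^esub> inv\<^bsub>R\<^esub> y, w \<otimes>\<^bsub>S\<^esub> inv\<^bsub>S\<^esub> v) |x w y v.
    (x, w) \<in> \<Gamma> \<and> (y, v) \<in> \<Gamma> \<and> v \<noteq> \<zero>\<^bsub>S\<^esub>}"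

lemma (in field) quotient_add:
  assumes "x \<in> carrier R" "y \<in> carrier R" "x' \<in> carrier R" "y' \<in> carrier R" "y \<noteq> \<zero>" "y' \<noteq> \<zero>"
  shows "x \<otimes> inv y \<oplus> x' \<otimes> inv y' = (x \<otimes> y' \<oplus> x' \<otimes> y) \<otimes> inv (y \<otimes> y')"
    and "(x \<otimes> inv y) \<otimes> (x' \<otimes> inv y') = (x \<otimes> x') \<otimes> inv (y \<otimes> y')"
proof -
  define a b where "a = inv y" and "b = inv y'"
  have ab: "a \<in> carrier R" "y \<otimes> a = \<one>" "b \<in> carrier R" "y' \<otimes> b = \<one>"
    using assms by (auto simp: a_def b_def)
  have i: "inv (y \<otimes> y') = a \<otimes> b"
  proof (rule comm_inv_char)
    have "y \<otimes> y' \<otimes> (a \<otimes> b) = (y \<otimes> a) \<otimes> (y' \<otimes> b)"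
      using assms ab by (simp add: m_ac)
    thus "y \<otimes> y' \<otimes> (a \<otimes> b) = \<one>" using ab by simp
  qed (use assms ab in auto)
  have 1: "(x \<otimes> y' \<oplus> x' \<otimes> y) \<otimes> (a \<otimes> b) = x \<otimes> a \<otimes> (y' \<otimes> b) \<oplus> x' \<otimes> b \<otimes> (y \<otimes> a)"
    using assms(1-4) ab(1,3) by (simp add: l_distr r_distr m_ac)
  show "x \<otimes> inv y \<oplus> x' \<otimes> inv y' = (x \<otimes> y' \<oplus> x' \<otimes> y) \<otimes> inv (y \<otimes> y')"
    unfolding i 1 ab(2,4) using assms ab by (simp add: a_def b_def)
  show "(x \<otimes> inv y) \<otimes> (x' \<otimes> inv y') = (x \<otimes> x') \<otimes> inv (y \<otimes> y')"
    unfolding i using assms ab by (simp add: a_def[symmetric] b_def[symmetric] m_ac)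
qed

lemma (in partial_hom) localization_mem:
  "\<lbrakk>(x, w) \<in> \<Gamma>; (y, v) \<in> \<Gamma>; v \<noteq> \<zero>\<^bsub>S\<^esub>\<rbrakk>
    \<Longrightarrow> (x \<otimes>\<^bsub>R\<^esub> inv\<^bsub>R\<^esub> y, w \<otimes>\<^bsub>S\<^esub> inv\<^bsub>S\<^esub> v) \<in> localization R S \<Gamma>"
  unfolding localization_def by blast

lemma (in partial_hom) localization_incl: "\<Gamma> \<subseteq> localization R S \<Gamma>"
proof
  fix z assume "z \<in> \<Gamma>"
  moreover obtain x w where "z = (x, w)" by fastforce
  ultimately show "z \<in> localization R S \<Gamma>"
    using localization_mem[OF _ one, of x w] closed[of x w] by simp
qed

lemma (in partial_hom) localization_partial_hom:
  "partial_hom R S (localization R S \<Gamma>)"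
proof unfold_locales
  let ?L = "localization R S \<Gamma>"
  show "?L \<subseteq> carrier R \<times> carrier S"
  proof (clarsimp simp: localization_def)
    fix x w y v assume a: "(x, w) \<in> \<Gamma>" "(y, v) \<in> \<Gamma>" "v \<noteq> \<zero>\<^bsub>S\<^esub>"
    thus "x \<otimes>\<^bsub>R\<^esub> inv\<^bsub>R\<^esub> y \<in> carrier R \<and> w \<otimes>\<^bsub>S\<^esub> inv\<^bsub>S\<^esub> v \<in> carrier S"
      using closed nonzero by (metis R.nonzero_inverse(1) R.m_closed S.nonzero_inverse(1) S.m_closed)
  qed
  show "(\<one>\<^bsub>R\<^esub>, \<one>\<^bsub>S\<^esub>) \<in> ?L" using localization_incl one by blast
  fix p q p' q' assume "(p, q) \<in> ?L"
  then obtain x w y v where 1: "p = x \<otimes>\<^bsub>R\<^esub> inv\<^bsub>R\<^esub> y" "q = w \<otimes>\<^bsub>S\<^esub> inv\<^bsub>S\<^esub> v"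
    "(x, w) \<in> \<Gamma>" "(y, v) \<in> \<Gamma>" "v \<noteq> \<zero>\<^bsub>S\<^esub>"
    unfolding localization_def by blast
  note c1 = closed[OF 1(3)] closed[OF 1(4)] nonzero[OF 1(4,5)]
  have "(\<ominus>\<^bsub>R\<^esub> x \<otimes>\<^bsub>R\<^esub> inv\<^bsub>R\<^esub> y, \<ominus>\<^bsub>S\<^esub> w \<otimes>\<^bsub>S\<^esub> inv\<^bsub>S\<^esub> v) \<in> ?L"
    using localization_mem[OF uminus[OF 1(3)] 1(4,5)] .
  thus "(\<ominus>\<^bsub>R\<^esub> p, \<ominus>\<^bsub>S\<^esub> q) \<in> ?L"
    unfolding 1 using c1 1(5) by (simp add: R.l_minus S.l_minus)
  assume "(p', q') \<in> ?L"
  then obtain x' w' y' v' where 2: "p' = x' \<otimes>\<^bsub>R\<^esub> inv\<^bsub>R\<^esub> y'" "q' = w' \<otimes>\<^bsub>S\<^esub> inv\<^bsub>S\<^esub> v'"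
    "(x', w') \<in> \<Gamma>" "(y', v') \<in> \<Gamma>" "v' \<noteq> \<zero>\<^bsub>S\<^esub>"
    unfolding localization_def by blast
  note c2 = closed[OF 2(3)] closed[OF 2(4)] nonzero[OF 2(4,5)]
  have n: "v \<otimes>\<^bsub>S\<^esub> v' \<noteq> \<zero>\<^bsub>S\<^esub>" using 1 2 c1 c2 S.integral by blast
  show "(p \<otimes>\<^bsub>R\<^esub> p', q \<otimes>\<^bsub>S\<^esub> q') \<in> ?L"
    unfolding 1(1,2) 2(1,2)
      R.quotient_add(2)[OF c1(1,3) c2(1,3) c1(5) c2(5)]
      S.quotient_add(2)[OF c1(2,4) c2(2,4) 1(5) 2(5)]
    by (rule localization_mem[OF mult[OF 1(3) 2(3)] mult[OF 1(4) 2(4)] n])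
  show "(p \<oplus>\<^bsub>R\<^esub> p', q \<oplus>\<^bsub>S\<^esub> q') \<in> ?L"
    unfolding 1(1,2) 2(1,2)
      R.quotient_add(1)[OF c1(1,3) c2(1,3) c1(5) c2(5)]
      S.quotient_add(1)[OF c1(2,4) c2(2,4) 1(5) 2(5)]
    by (rule localization_mem[OF add[OF mult[OF 1(3) 2(4)] mult[OF 2(3) 1(4)]]
          mult[OF 1(4) 2(4)] n])
next
  fix q assume "(\<zero>\<^bsub>R\<^esub>, q) \<in> localization R S \<Gamma>"
  then obtain x w y v where 1: "\<zero>\<^bsub>R\<^esub> = x \<otimes>\<^bsub>R\<^esub> inv\<^bsub>R\<^esub> y" "q = w \<otimes>\<^bsub>S\<^esub> inv\<^bsub>S\<^esub> v"
    "(x, w) \<in> \<Gamma>" "(y, v) \<in> \<Gamma>" "v \<noteq> \<zero>\<^bsub>S\<^esub>"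
    unfolding localization_def by blast
  note c1 = closed[OF 1(3)] closed[OF 1(4)] nonzero[OF 1(4,5)]
  have "x = \<zero>\<^bsub>R\<^esub>" using 1(1) c1 R.nonzero_inverse R.integral by metis
  hence "w = \<zero>\<^bsub>S\<^esub>" using 1(3) zero_unique by blast
  thus "q = \<zero>\<^bsub>S\<^esub>" using 1 c1 by simp
qed

text \<open>An injective homomorphism keeps every nonzero denominator, so its localization lives on the whole
  field of fractions of its domain.\<close>

lemma (in partial_hom) localization_Domain_subfield:
  assumes "\<And>x. (x, \<zero>\<^bsub>S\<^esub>) \<in> \<Gamma> \<Longrightarrow> x = \<zero>\<^bsub>R\<^esub>"
  shows "subfield (Domain (localization R S \<Gamma>)) R"
proof (rule R.subfieldI')
  interpret L: partial_hom R S "localization R S \<Gamma>" by (rule localization_partial_hom)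
  show "subring (Domain (localization R S \<Gamma>)) R" by (rule L.Domain_subring)
  fix k assume "k \<in> Domain (localization R S \<Gamma>) - {\<zero>\<^bsub>R\<^esub>}"
  then obtain x w y v where 1: "k = x \<otimes>\<^bsub>R\<^esub> inv\<^bsub>R\<^esub> y" "k \<noteq> \<zero>\<^bsub>R\<^esub>"
    "(x, w) \<in> \<Gamma>" "(y, v) \<in> \<Gamma>" "v \<noteq> \<zero>\<^bsub>S\<^esub>"
    unfolding localization_def by blast
  note c1 = closed[OF 1(3)] closed[OF 1(4)] nonzero[OF 1(4,5)]
  have x0: "x \<noteq> \<zero>\<^bsub>R\<^esub>" using 1 c1 by auto
  hence w: "w \<noteq> \<zero>\<^bsub>S\<^esub>" using assms 1(3) by blast
  have "x \<otimes>\<^bsub>R\<^esub> inv\<^bsub>R\<^esub> y \<otimes>\<^bsub>R\<^esub> (y \<otimes>\<^bsub>R\<^esub> inv\<^bsub>R\<^esub> x) = (x \<otimes>\<^bsub>R\<^esub> inv\<^bsub>R\<^esub> x) \<otimes>\<^bsub>R\<^esub> (y \<otimes>\<^bsub>R\<^esub> inv\<^bsub>R\<^esub> y)"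
  proof -
    have "a \<otimes>\<^bsub>R\<^esub> b \<otimes>\<^bsub>R\<^esub> (c \<otimes>\<^bsub>R\<^esub> d) = (a \<otimes>\<^bsub>R\<^esub> d) \<otimes>\<^bsub>R\<^esub> (c \<otimes>\<^bsub>R\<^esub> b)"
      if "a \<in> carrier R" "b \<in> carrier R" "c \<in> carrier R" "d \<in> carrier R" for a b c d
      using that by (simp add: R.m_ac)
    note this[of x "inv\<^bsub>R\<^esub> y" y "inv\<^bsub>R\<^esub> x"]
    thus ?thesis using c1 x0 by simp
  qed
  also have "\<dots> = \<one>\<^bsub>R\<^esub>" using c1 x0 by simp
  finally have "inv\<^bsub>R\<^esub> k = y \<otimes>\<^bsub>R\<^esub> inv\<^bsub>R\<^esub> x"
    unfolding 1(1) by (intro R.comm_inv_char) (use c1 x0 in auto)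
  thus "inv\<^bsub>R\<^esub> k \<in> Domain (localization R S \<Gamma>)"
    using localization_mem[OF 1(4) 1(3) w] by auto
qed

section \<open>Extending homomorphisms into algebraically closed fields\<close>

text \<open>Polynomials are coefficient lists, leading coefficient first, and need not be normalized: such a
  list can be carried along a graph entry by entry, even when entries become zero.\<close>

definition root_closed :: "('b, 'n) ring_scheme \<Rightarrow> bool"
  where "root_closed S \<longleftrightarrow> (\<forall>p. set p \<subseteq> carrier S \<longrightarrow> 2 \<le> length p \<longrightarrow> hd p \<noteq> \<zero>\<^bsub>S\<^esub> \<longrightarrow>
    (\<exists>\<xi>\<in>carrier S. ring.eval S p \<xi> = \<zero>\<^bsub>S\<^esub>))"

lemma root_closedD:
  assumes "root_closed S" "set p \<subseteq> carrier S" "2 \<le> length p" "hd p \<noteq> \<zero>\<^bsub>S\<^esub>"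
  shows "\<exists>\<xi>\<in>carrier S. ring.eval S p \<xi> = \<zero>\<^bsub>S\<^esub>"
  using assms unfolding root_closed_def by blast

lemma algebraically_closed_root_closed:
  assumes "algebraically_closed S"
  shows "root_closed S"
  unfolding root_closed_def
proof (intro allI impI)
  interpret algebraically_closed S by fact
  fix p assume p: "set p \<subseteq> carrier S" "2 \<le> length p" "hd p \<noteq> \<zero>\<^bsub>S\<^esub>"
  hence pc: "p \<in> carrier (poly_ring S)"
    by (auto simp: univ_poly_def polynomial_def)
  hence "size (roots p) \<noteq> 0"
    using roots_over_carrier[OF pc] p by (simp add: splitted_def)
  then obtain \<xi> where "\<xi> \<in># roots p" by fastforce
  thus "\<exists>\<xi>\<in>carrier S. eval p \<xi> = \<zero>\<^bsub>S\<^esub>"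
    using roots_mem_iff_is_root[OF pc] by (auto simp: is_root_def)
qed

context field
begin

lemma eval_zeros:
  assumes "set p \<subseteq> {\<zero>}" "x \<in> carrier R"
  shows "eval p x = \<zero>"
  using assms by (induction p) auto

lemma eval_append_single:
  assumes "set p \<subseteq> carrier R" "a \<in> carrier R" "x \<in> carrier R"
  shows "eval (p @ [a]) x = eval p x \<otimes> x \<oplus> a"
  using eval_append_aux assms by blast

text \<open>A nonconstant polynomial takes the value \<open>\<one>\<close> because \<open>p - \<one>\<close> has a root.\<close>

lemma eval_nonzero_somewhere:
  assumes "root_closed R" "set p \<subseteq> carrier R" "p \<noteq> []" "hd p \<noteq> \<zero>"
  shows "\<exists>\<xi>\<in>carrier R. eval p \<xi> \<noteq> \<zero>"
proof -
  obtain q c where q: "p = q @ [c]" using assms(3) by (cases p rule: rev_cases) auto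
  have c: "set q \<subseteq> carrier R" "c \<in> carrier R" using assms q by auto
  show ?thesis
  proof (cases "q = []")
    case True
    thus ?thesis using assms q by (intro bexI[of _ \<zero>]) auto
  next
    case False
    have "\<exists>\<xi>\<in>carrier R. eval (q @ [c \<ominus> \<one>]) \<xi> = \<zero>"
    proof -
      have "set (q @ [c \<ominus> \<one>]) \<subseteq> carrier R" using c by auto
      moreover have "2 \<le> length (q @ [c \<ominus> \<one>])" using False by (cases q) auto
      moreover have "hd (q @ [c \<ominus> \<one>]) \<noteq> \<zero>" using False assms q by auto
      ultimately show ?thesis using assms(1) unfolding root_closed_def by blast
    qed
    then obtain \<xi> where x: "\<xi> \<in> carrier R" "eval (q @ [c \<ominus> \<one>]) \<xi> = \<zero>" by blast
    have e: "eval q \<xi> \<in> carrier R" using c x eval_in_carrier by blast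
    have "eval q \<xi> \<otimes> \<xi> \<oplus> (c \<ominus> \<one>) = \<zero>"
      using x c eval_append_single[of q "c \<ominus> \<one>" \<xi>] by simp
    moreover have "eval p \<xi> = (eval q \<xi> \<otimes> \<xi> \<oplus> (c \<ominus> \<one>)) \<oplus> \<one>"
      using c x e unfolding q eval_append_single[OF c x(1)] by algebra
    ultimately have "eval p \<xi> = \<one>" by simp
    thus ?thesis using x(1) one_not_zero by (metis)
  qed
qed

lemma eval_map_mult:
  assumes "set p \<subseteq> carrier R" "a \<in> carrier R" "x \<in> carrier R"
  shows "eval (map ((\<otimes>) a) p) x = a \<otimes> eval p x"
  using assms
  by (induction p) (auto simp: r_distr m_assoc eval_in_carrier)

lemma eval_append_zeros:
  assumes "set p \<subseteq> carrier R" "x \<in> carrier R"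
  shows "eval (p @ replicate k \<zero>) x = eval p x \<otimes> x [^] k"
proof (induction k)
  case (Suc k)
  have "p @ replicate (Suc k) \<zero> = (p @ replicate k \<zero>) @ [\<zero>]"
    by (simp add: replicate_append_same)
  moreover have "set (p @ replicate k \<zero>) \<subseteq> carrier R" using assms by auto
  ultimately have "eval (p @ replicate (Suc k) \<zero>) x = eval (p @ replicate k \<zero>) x \<otimes> x \<oplus> \<zero>"
    using eval_append_single[of "p @ replicate k \<zero>" \<zero> x] assms by (metis zero_closed)
  also have "\<dots> = eval p x \<otimes> x [^] k \<otimes> x" using Suc assms by (simp add: eval_in_carrier)
  finally show ?case using assms by (simp add: m_assoc eval_in_carrier)
qed (use assms eval_in_carrier in auto)

lemma eval_map2_minus:
  assumes "length p = length q" "set p \<subseteq> carrier R" "set q \<subseteq> carrier R" "x \<in> carrier R"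
  shows "eval (map2 (\<lambda>a b. a \<ominus> b) p q) x = eval p x \<ominus> eval q x"
  using assms
proof (induction p q rule: list_induct2)
  case (Cons a p b q)
  have "(a \<ominus> b) \<otimes> y \<oplus> (u \<ominus> v) = (a \<otimes> y \<oplus> u) \<ominus> (b \<otimes> y \<oplus> v)"
    if "a \<in> carrier R" "b \<in> carrier R" "u \<in> carrier R" "v \<in> carrier R" "y \<in> carrier R" for u v y
    using that by algebra
  thus ?case using Cons by (simp add: eval_in_carrier)
qed (auto simp: a_minus_def)

text \<open>\<open>lc(p) q - lc(q) X\<^sup>k p\<close>, with the cancelled leading term dropped from the list. Division with remainder
  would need the inverse of \<open>lc(p)\<close>, which the coefficient ring need not contain.\<close>

definition pseudo_reduce :: "'a list \<Rightarrow> 'a list \<Rightarrow> 'a list"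
  where "pseudo_reduce p q = map2 (\<lambda>a b. a \<ominus> b) (map ((\<otimes>) (hd p)) (tl q))
    (map ((\<otimes>) (hd q)) (tl p @ replicate (length q - length p) \<zero>))"

lemma pseudo_reduce:
  assumes "set p \<subseteq> A" "set q \<subseteq> A" "subring A R" "p \<noteq> []" "length p \<le> length q"
  shows "set (pseudo_reduce p q) \<subseteq> A" "Suc (length (pseudo_reduce p q)) = length q"
    and "x \<in> carrier R \<Longrightarrow> eval (pseudo_reduce p q) x =
      hd p \<otimes> eval q x \<ominus> hd q \<otimes> (eval p x \<otimes> x [^] (length q - length p))"
proof -
  obtain a p' b q' where pq: "p = a # p'" "q = b # q'"
    using assms by (cases p; cases q) auto
  have A: "A \<subseteq> carrier R" using subringE(1)[OF assms(3)] .
  note cl = subringE(2,5,6,7)[OF assms(3)]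
  let ?k = "length q - length p"
  have l: "length (tl q) = length (tl p @ replicate ?k \<zero>)" using assms pq by auto
  show "Suc (length (pseudo_reduce p q)) = length q"
    using assms pq by (simp add: pseudo_reduce_def)
  have s: "set (map ((\<otimes>) (hd p)) (tl q)) \<subseteq> A"
    "set (map ((\<otimes>) (hd q)) (tl p @ replicate ?k \<zero>)) \<subseteq> A"
    "set (tl p @ replicate ?k \<zero>) \<subseteq> A" "set (tl q) \<subseteq> A"
    using assms cl pq by auto
  have m: "a \<ominus> b \<in> A" if "a \<in> A" "b \<in> A" for a b
    unfolding a_minus_def using that cl by blast
  have "set (map2 (\<lambda>a b. a \<ominus> b) xs ys) \<subseteq> A" if "set xs \<subseteq> A" "set ys \<subseteq> A" for xs ys
    using that m by (auto elim!: in_set_zipE)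
  thus "set (pseudo_reduce p q) \<subseteq> A"
    unfolding pseudo_reduce_def using s(1,2) by blast
  assume x: "x \<in> carrier R"
  have c: "a \<in> carrier R" "b \<in> carrier R" "set p' \<subseteq> carrier R" "set q' \<subseteq> carrier R"
    "set (p' @ replicate ?k \<zero>) \<subseteq> carrier R"
    using assms pq A by auto
  have "eval (pseudo_reduce p q) x = a \<otimes> eval q' x \<ominus> b \<otimes> (eval p' x \<otimes> x [^] ?k)"
  proof -
    have "eval (pseudo_reduce p q) x = eval (map ((\<otimes>) (hd p)) (tl q)) x
        \<ominus> eval (map ((\<otimes>) (hd q)) (tl p @ replicate ?k \<zero>)) x"
      unfolding pseudo_reduce_def
      by (rule eval_map2_minus[OF _ subset_trans[OF s(1) A] subset_trans[OF s(2) A] x])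
        (simp only: length_map l)
    thus ?thesis
      unfolding pq list.sel eval_map_mult[OF c(4,1) x] eval_append_zeros[OF c(3) x, symmetric]
      using eval_map_mult[OF c(5,2) x] pq by simp
  qed
  also have "\<dots> = a \<otimes> (b \<otimes> x [^] length q' \<oplus> eval q' x)
      \<ominus> b \<otimes> ((a \<otimes> x [^] length p' \<oplus> eval p' x) \<otimes> x [^] ?k)"
  proof -
    have pw: "x [^] length q' = x [^] length p' \<otimes> x [^] ?k"
      using x assms pq by (simp add: nat_pow_mult)
    have gen: "a \<otimes> Q \<ominus> b \<otimes> (P \<otimes> K) = a \<otimes> (b \<otimes> (W \<otimes> K) \<oplus> Q) \<ominus> b \<otimes> ((a \<otimes> W \<oplus> P) \<otimes> K)"
      if "P \<in> carrier R" "Q \<in> carrier R" "K \<in> carrier R" "W \<in> carrier R" for P Q K W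
      using that c(1,2) by algebra
    have "a \<otimes> eval q' x \<ominus> b \<otimes> (eval p' x \<otimes> x [^] ?k) =
      a \<otimes> (b \<otimes> (x [^] length p' \<otimes> x [^] ?k) \<oplus> eval q' x)
      \<ominus> b \<otimes> ((a \<otimes> x [^] length p' \<oplus> eval p' x) \<otimes> x [^] ?k)"
      by (rule gen) (use c x eval_in_carrier in auto)
    thus ?thesis unfolding pw .
  qed
  finally show "eval (pseudo_reduce p q) x =
      hd p \<otimes> eval q x \<ominus> hd q \<otimes> (eval p x \<otimes> x [^] ?k)"
    by (simp add: pq)
qed

lemma simple_extension_eval:
  assumes "A \<subseteq> carrier R" "b \<in> carrier R"
  shows "v \<in> simple_extension A b \<longleftrightarrow> (\<exists>q. set q \<subseteq> A \<and> v = eval q b)"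
proof
  assume "v \<in> simple_extension A b"
  thus "\<exists>q. set q \<subseteq> A \<and> v = eval q b"
    using simple_extension_as_eval_img[OF assms]
    by (auto simp: univ_poly_def polynomial_def intro: exI[of _ "[]"])
next
  assume "\<exists>q. set q \<subseteq> A \<and> v = eval q b"
  then obtain q where "set q \<subseteq> A" "v = eval q b" by auto
  thus "v \<in> simple_extension A b"
  proof (induction q arbitrary: v rule: rev_induct)
    case (snoc a q)
    hence "eval q b \<in> simple_extension A b" "a \<in> A" "set q \<subseteq> carrier R"
      using assms by auto
    thus ?case using snoc.prems assms eval_append_single[of q a b] simple_extension.lin
      by (metis subsetD)
  qed simp
qed

text \<open>Being the domain of an injective localization, this is a subfield of the ambient field at once.\<close>

definition fractions :: "'a set \<Rightarrow> 'a set"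
  where "fractions A = Domain (localization R R (Id_on A))"

lemma fractions_subfield:
  assumes "subring A R"
  shows "subfield (fractions A) R" "A \<subseteq> fractions A"
proof -
  interpret I: partial_hom R R "Id_on A" by (rule Id_on_partial_hom[OF assms])
  show "subfield (fractions A) R" unfolding fractions_def
    by (rule I.localization_Domain_subfield) auto
  show "A \<subseteq> fractions A" unfolding fractions_def using I.localization_incl by blast
qed

lemma common_denominator:
  assumes "subring A R" "set s \<subseteq> fractions A"
  shows "\<exists>a\<in>A. a \<noteq> \<zero> \<and> set (map ((\<otimes>) a) s) \<subseteq> A"
  using assms(2)
proof (induction s)
  case Nil
  thus ?case using subringE(3)[OF assms(1)] by (intro bexI[of _ \<one>]) auto
next
  case (Cons t s)
  note A = subringE[OF assms(1)]
  then obtain a where a: "a \<in> A" "a \<noteq> \<zero>" "set (map ((\<otimes>) a) s) \<subseteq> A" using Cons by auto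
  obtain x y where xy: "t = x \<otimes> inv y" "x \<in> A" "y \<in> A" "y \<noteq> \<zero>"
    using Cons.prems unfolding fractions_def localization_def by auto
  have c: "a \<in> carrier R" "x \<in> carrier R" "y \<in> carrier R" "inv y \<in> carrier R" "inv y \<otimes> y = \<one>"
    using a xy A(1) by auto
  have s: "set s \<subseteq> carrier R"
    using Cons.prems subfieldE(3)[OF fractions_subfield(1)[OF assms(1)]] by auto
  have "(a \<otimes> y) \<otimes> t = a \<otimes> x \<otimes> (inv y \<otimes> y)" unfolding xy(1) using c(1-4) by algebra
  hence "(a \<otimes> y) \<otimes> t \<in> A" using c xy a A(6) by simp
  moreover have "(a \<otimes> y) \<otimes> z \<in> A" if "z \<in> set s" for z
  proof -
    have z: "z \<in> carrier R" using that s by auto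
    have "(a \<otimes> y) \<otimes> z = y \<otimes> (a \<otimes> z)" using c z by algebra
    thus ?thesis using a that xy A(6) by auto
  qed
  moreover have "a \<otimes> y \<noteq> \<zero>" using a xy c integral by blast
  moreover have "a \<otimes> y \<in> A" using a xy A(6) by auto
  ultimately show ?case by (intro bexI[of _ "a \<otimes> y"]) auto
qed

text \<open>Over the field of fractions of \<open>A\<close> the ring generated by an algebraic element is a field, so the
  inverse of \<open>v\<close> is a polynomial in \<open>b\<close>. Clearing the denominators of its coefficients gives \<open>t\<close>.\<close>

lemma algebraic_multiple_in_base:
  assumes "subring A R" "b \<in> carrier R" "set p \<subseteq> A" "\<not> set p \<subseteq> {\<zero>}" "eval p b = \<zero>"
    and "v \<in> simple_extension A b" "v \<noteq> \<zero>"
  shows "\<exists>t\<in>simple_extension A b. v \<otimes> t \<in> A \<and> v \<otimes> t \<noteq> \<zero>"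
proof -
  note A = subringE[OF assms(1)]
  let ?Q = "fractions A"
  note Q = fractions_subfield[OF assms(1)]
  have Qc: "?Q \<subseteq> carrier R" using subfieldE(3)[OF Q(1)] .
  obtain p' where p': "set p' \<subseteq> A" "p' \<noteq> []" "hd p' \<noteq> \<zero>" "eval p' b = \<zero>"
    using assms(3-5)
  proof (induction p arbitrary: thesis)
    case (Cons a p)
    show ?case
    proof (cases "a = \<zero>")
      case True
      hence "eval p b = \<zero>" using Cons.prems assms(2) A(1) by (auto simp: eval_in_carrier)
      thus ?thesis using Cons True by auto
    next
      case False
      show ?thesis by (rule Cons.prems(1)[of "a # p"]) (use Cons.prems(2-) False in simp_all)
    qed
  qed auto
  have "p' \<in> carrier (?Q[X])"
    using p' Q(2) by (auto simp: univ_poly_def polynomial_def)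
  hence "(algebraic over ?Q) b"
    using p' by (intro algebraicI) auto
  hence sf: "subfield (simple_extension ?Q b) R"
    using simple_extension_is_subfield[OF Q(1) assms(2)] by simp
  have v: "v \<in> simple_extension ?Q b" "v \<in> carrier R"
    using assms mono_simple_extension[OF Q(2)] simple_extension_in_carrier[OF A(1) assms(2)] by auto
  hence "inv v \<in> simple_extension ?Q b"
    using subfield_m_inv(1)[OF sf] assms(7) by auto
  then obtain s where s: "set s \<subseteq> ?Q" "inv v = eval s b"
    using simple_extension_eval[OF Qc assms(2)] by blast
  obtain a where a: "a \<in> A" "a \<noteq> \<zero>" "set (map ((\<otimes>) a) s) \<subseteq> A"
    using common_denominator[OF assms(1) s(1)] by auto
  have ac: "a \<in> carrier R" using a A(1) by auto
  have e: "eval (map ((\<otimes>) a) s) b = a \<otimes> inv v"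
    using eval_map_mult[of s a b] s Qc ac assms(2) by auto
  have "a \<otimes> inv v \<in> simple_extension A b"
    unfolding e[symmetric] simple_extension_eval[OF A(1) assms(2)] using a(3) by blast
  moreover have "v \<otimes> (a \<otimes> inv v) = a"
    using v ac assms(7) by (simp add: m_lcomm)
  ultimately show ?thesis using a by (intro bexI[of _ "a \<otimes> inv v"]) auto
qed

end

text \<open>The values forced by \<open>b \<mapsto> \<xi>\<close>, built by Horner's scheme. Nothing makes this set single-valued unless
  \<open>\<xi>\<close> satisfies the images of all relations of \<open>b\<close>.\<close>

inductive_set adjoin ::
  "('a, 'm) ring_scheme \<Rightarrow> ('b, 'n) ring_scheme \<Rightarrow> ('a \<times> 'b) set \<Rightarrow> 'a \<Rightarrow> 'b \<Rightarrow> ('a \<times> 'b) set"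
  for R S \<Gamma> b \<xi> where
    zero: "(\<zero>\<^bsub>R\<^esub>, \<zero>\<^bsub>S\<^esub>) \<in> adjoin R S \<Gamma> b \<xi>"
  | lin: "\<lbrakk>(x, w) \<in> adjoin R S \<Gamma> b \<xi>; (a, \<alpha>) \<in> \<Gamma>\<rbrakk>
      \<Longrightarrow> (x \<otimes>\<^bsub>R\<^esub> b \<oplus>\<^bsub>R\<^esub> a, w \<otimes>\<^bsub>S\<^esub> \<xi> \<oplus>\<^bsub>S\<^esub> \<alpha>) \<in> adjoin R S \<Gamma> b \<xi>"

context partial_hom
begin

lemma list_closed:
  assumes "set q \<subseteq> \<Gamma>"
  shows "set (map fst q) \<subseteq> carrier R" "set (map snd q) \<subseteq> carrier S"
    "set (map fst q) \<subseteq> Domain \<Gamma>"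
proof -
  show "set (map fst q) \<subseteq> carrier R" "set (map snd q) \<subseteq> carrier S"
    using assms subset by fastforce+
  show "set (map fst q) \<subseteq> Domain \<Gamma>" using assms by force
qed

lemma list_lift:
  assumes "set q \<subseteq> Domain \<Gamma>"
  shows "\<exists>q'. set q' \<subseteq> \<Gamma> \<and> map fst q' = q"
  using assms
proof (induction q)
  case (Cons a q)
  then obtain q' \<alpha> where "set q' \<subseteq> \<Gamma>" "map fst q' = q" "(a, \<alpha>) \<in> \<Gamma>" by auto
  thus ?case by (intro exI[of _ "(a, \<alpha>) # q'"]) auto
qed auto

context
  fixes b \<xi>
  assumes b: "b \<in> carrier R" and xi: "\<xi> \<in> carrier S"
begin

lemma adjoin_iff_eval:
  "z \<in> adjoin R S \<Gamma> b \<xi> \<longleftrightarrow>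
    (\<exists>q. set q \<subseteq> \<Gamma> \<and> z = (R.eval (map fst q) b, S.eval (map snd q) \<xi>))"
proof
  assume "z \<in> adjoin R S \<Gamma> b \<xi>"
  hence "(fst z, snd z) \<in> adjoin R S \<Gamma> b \<xi>" by simp
  hence "\<exists>q. set q \<subseteq> \<Gamma> \<and> (fst z, snd z) = (R.eval (map fst q) b, S.eval (map snd q) \<xi>)"
  proof (induction rule: adjoin.induct)
    case zero
    show ?case by (intro exI[of _ "[]"]) auto
  next
    case (lin x w a \<alpha>)
    then obtain q where q: "set q \<subseteq> \<Gamma>" "(x, w) = (R.eval (map fst q) b, S.eval (map snd q) \<xi>)"
      by auto
    have "R.eval (map fst q @ [a]) b = x \<otimes>\<^bsub>R\<^esub> b \<oplus>\<^bsub>R\<^esub> a"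
      "S.eval (map snd q @ [\<alpha>]) \<xi> = w \<otimes>\<^bsub>S\<^esub> \<xi> \<oplus>\<^bsub>S\<^esub> \<alpha>"
      using q R.eval_append_single[OF list_closed(1)[OF q(1)]]
        S.eval_append_single[OF list_closed(2)[OF q(1)]] closed[OF lin(2)] b xi by auto
    thus ?case using q lin by (intro exI[of _ "q @ [(a, \<alpha>)]"]) auto
  qed
  thus "\<exists>q. set q \<subseteq> \<Gamma> \<and> z = (R.eval (map fst q) b, S.eval (map snd q) \<xi>)" by simp
next
  assume "\<exists>q. set q \<subseteq> \<Gamma> \<and> z = (R.eval (map fst q) b, S.eval (map snd q) \<xi>)"
  then obtain q where "set q \<subseteq> \<Gamma>" "z = (R.eval (map fst q) b, S.eval (map snd q) \<xi>)" by auto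
  thus "z \<in> adjoin R S \<Gamma> b \<xi>"
  proof (induction q arbitrary: z rule: rev_induct)
    case Nil
    thus ?case by (simp add: adjoin.zero)
  next
    case (snoc aa q)
    obtain a \<alpha> where aa: "aa = (a, \<alpha>)" by fastforce
    have q: "set q \<subseteq> \<Gamma>" "(a, \<alpha>) \<in> \<Gamma>" using snoc.prems aa by auto
    have "z = (R.eval (map fst q) b \<otimes>\<^bsub>R\<^esub> b \<oplus>\<^bsub>R\<^esub> a, S.eval (map snd q) \<xi> \<otimes>\<^bsub>S\<^esub> \<xi> \<oplus>\<^bsub>S\<^esub> \<alpha>)"
      using snoc.prems(2) R.eval_append_single[OF list_closed(1)[OF q(1)]]
        S.eval_append_single[OF list_closed(2)[OF q(1)]] closed[OF q(2)] b xi aa by simp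
    thus ?case using snoc.IH[OF q(1) refl] q(2) by (simp add: adjoin.lin)
  qed
qed

lemma adjoin_closed:
  assumes "(x, w) \<in> adjoin R S \<Gamma> b \<xi>"
  shows "x \<in> carrier R" "w \<in> carrier S"
  using assms b xi closed by (induction rule: adjoin.induct) auto

lemma adjoin_incl: "\<Gamma> \<subseteq> adjoin R S \<Gamma> b \<xi>"
proof
  fix z assume "z \<in> \<Gamma>"
  moreover obtain a \<alpha> where "z = (a, \<alpha>)" by fastforce
  ultimately show "z \<in> adjoin R S \<Gamma> b \<xi>"
    using adjoin.lin[OF adjoin.zero, where a = a and \<alpha> = \<alpha> and \<Gamma> = \<Gamma> and b = b and \<xi> = \<xi>
        and R = R and S = S] b xi closed[of a \<alpha>] by simp
qed

lemma adjoin_Domain: "Domain (adjoin R S \<Gamma> b \<xi>) = R.simple_extension (Domain \<Gamma>) b"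
proof (intro equalityI subsetI)
  fix x assume "x \<in> Domain (adjoin R S \<Gamma> b \<xi>)"
  then obtain w where "(x, w) \<in> adjoin R S \<Gamma> b \<xi>" by auto
  thus "x \<in> R.simple_extension (Domain \<Gamma>) b"
    by (induction rule: adjoin.induct) (auto intro: R.simple_extension.lin)
next
  fix x assume "x \<in> R.simple_extension (Domain \<Gamma>) b"
  thus "x \<in> Domain (adjoin R S \<Gamma> b \<xi>)"
    by (induction rule: R.simple_extension.induct) (auto intro: adjoin.lin adjoin.zero)
qed

lemma adjoin_add:
  assumes "(x, w) \<in> adjoin R S \<Gamma> b \<xi>" "(y, v) \<in> adjoin R S \<Gamma> b \<xi>"
  shows "(x \<oplus>\<^bsub>R\<^esub> y, w \<oplus>\<^bsub>S\<^esub> v) \<in> adjoin R S \<Gamma> b \<xi>"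
  using assms
proof (induction arbitrary: y v rule: adjoin.induct)
  case zero
  thus ?case using adjoin_closed[OF zero] by simp
next
  case (lin x w a \<alpha>)
  note c = adjoin_closed[OF lin(1)] closed[OF lin(2)] and IH = lin.IH and mem = lin(2)
  from lin.prems show ?case
  proof (cases rule: adjoin.cases)
    case zero
    have "(x \<otimes>\<^bsub>R\<^esub> b \<oplus>\<^bsub>R\<^esub> a, w \<otimes>\<^bsub>S\<^esub> \<xi> \<oplus>\<^bsub>S\<^esub> \<alpha>) \<in> adjoin R S \<Gamma> b \<xi>"
      using lin(1,2) by (rule adjoin.lin)
    thus ?thesis using zero c b xi by simp
  next
    case (lin x' w' a' \<alpha>')
    note c' = adjoin_closed[OF lin(3)] closed[OF lin(4)]
    have "((x \<oplus>\<^bsub>R\<^esub> x') \<otimes>\<^bsub>R\<^esub> b \<oplus>\<^bsub>R\<^esub> (a \<oplus>\<^bsub>R\<^esub> a'), (w \<oplus>\<^bsub>S\<^esub> w') \<otimes>\<^bsub>S\<^esub> \<xi> \<oplus>\<^bsub>S\<^esub> (\<alpha> \<oplus>\<^bsub>S\<^esub> \<alpha>'))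
        \<in> adjoin R S \<Gamma> b \<xi>"
      using IH lin(3,4) mem by (intro adjoin.lin add) auto
    moreover have "(x \<oplus>\<^bsub>R\<^esub> x') \<otimes>\<^bsub>R\<^esub> b \<oplus>\<^bsub>R\<^esub> (a \<oplus>\<^bsub>R\<^esub> a') = x \<otimes>\<^bsub>R\<^esub> b \<oplus>\<^bsub>R\<^esub> a \<oplus>\<^bsub>R\<^esub> y"
      unfolding lin(1) using c(1,3) c'(1,3) b by algebra
    moreover have "(w \<oplus>\<^bsub>S\<^esub> w') \<otimes>\<^bsub>S\<^esub> \<xi> \<oplus>\<^bsub>S\<^esub> (\<alpha> \<oplus>\<^bsub>S\<^esub> \<alpha>') = w \<otimes>\<^bsub>S\<^esub> \<xi> \<oplus>\<^bsub>S\<^esub> \<alpha> \<oplus>\<^bsub>S\<^esub> v"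
      unfolding lin(2) using c(2,4) c'(2,4) xi by algebra
    ultimately show ?thesis by simp
  qed
qed

lemma adjoin_scale:
  assumes "(y, v) \<in> adjoin R S \<Gamma> b \<xi>" "(a, \<alpha>) \<in> \<Gamma>"
  shows "(a \<otimes>\<^bsub>R\<^esub> y, \<alpha> \<otimes>\<^bsub>S\<^esub> v) \<in> adjoin R S \<Gamma> b \<xi>"
  using assms(1)
proof (induction rule: adjoin.induct)
  case zero
  thus ?case using adjoin.zero closed[OF assms(2)] by simp
next
  case (lin x w a' \<alpha>')
  note c = adjoin_closed[OF lin(1)] closed[OF lin(2)] closed[OF assms(2)]
  have "((a \<otimes>\<^bsub>R\<^esub> x) \<otimes>\<^bsub>R\<^esub> b \<oplus>\<^bsub>R\<^esub> a \<otimes>\<^bsub>R\<^esub> a', (\<alpha> \<otimes>\<^bsub>S\<^esub> w) \<otimes>\<^bsub>S\<^esub> \<xi> \<oplus>\<^bsub>S\<^esub> \<alpha> \<otimes>\<^bsub>S\<^esub> \<alpha>') \<in> adjoin R S \<Gamma> b \<xi>"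
    using lin mult[OF assms(2)] by (intro adjoin.lin) auto
  thus ?case using c b xi by (simp add: R.r_distr S.r_distr R.m_assoc S.m_assoc)
qed

lemma adjoin_mult:
  assumes "(x, w) \<in> adjoin R S \<Gamma> b \<xi>" "(y, v) \<in> adjoin R S \<Gamma> b \<xi>"
  shows "(x \<otimes>\<^bsub>R\<^esub> y, w \<otimes>\<^bsub>S\<^esub> v) \<in> adjoin R S \<Gamma> b \<xi>"
  using assms(1)
proof (induction rule: adjoin.induct)
  case zero
  thus ?case using adjoin.zero adjoin_closed[OF assms(2)] by simp
next
  case (lin x w a \<alpha>)
  note c = adjoin_closed[OF lin(1)] closed[OF lin(2)] adjoin_closed[OF assms(2)]
  have "(x \<otimes>\<^bsub>R\<^esub> y \<otimes>\<^bsub>R\<^esub> b \<oplus>\<^bsub>R\<^esub> \<zero>\<^bsub>R\<^esub>, w \<otimes>\<^bsub>S\<^esub> v \<otimes>\<^bsub>S\<^esub> \<xi> \<oplus>\<^bsub>S\<^esub> \<zero>\<^bsub>S\<^esub>) \<in> adjoin R S \<Gamma> b \<xi>"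
    using lin zero by (intro adjoin.lin) auto
  from adjoin_add[OF this adjoin_scale[OF assms(2) lin(2)]]
  have "(x \<otimes>\<^bsub>R\<^esub> y \<otimes>\<^bsub>R\<^esub> b \<oplus>\<^bsub>R\<^esub> a \<otimes>\<^bsub>R\<^esub> y, w \<otimes>\<^bsub>S\<^esub> v \<otimes>\<^bsub>S\<^esub> \<xi> \<oplus>\<^bsub>S\<^esub> \<alpha> \<otimes>\<^bsub>S\<^esub> v) \<in> adjoin R S \<Gamma> b \<xi>"
    using c b xi by simp
  moreover have "x \<otimes>\<^bsub>R\<^esub> y \<otimes>\<^bsub>R\<^esub> b \<oplus>\<^bsub>R\<^esub> a \<otimes>\<^bsub>R\<^esub> y = (x \<otimes>\<^bsub>R\<^esub> b \<oplus>\<^bsub>R\<^esub> a) \<otimes>\<^bsub>R\<^esub> y"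
    using c(1,3,5) b by algebra
  moreover have "w \<otimes>\<^bsub>S\<^esub> v \<otimes>\<^bsub>S\<^esub> \<xi> \<oplus>\<^bsub>S\<^esub> \<alpha> \<otimes>\<^bsub>S\<^esub> v = (w \<otimes>\<^bsub>S\<^esub> \<xi> \<oplus>\<^bsub>S\<^esub> \<alpha>) \<otimes>\<^bsub>S\<^esub> v"
    using c(2,4,6) xi by algebra
  ultimately show ?case by simp
qed

lemma adjoin_partial_hom:
  assumes "\<And>q. \<lbrakk>set q \<subseteq> \<Gamma>; R.eval (map fst q) b = \<zero>\<^bsub>R\<^esub>\<rbrakk> \<Longrightarrow> S.eval (map snd q) \<xi> = \<zero>\<^bsub>S\<^esub>"
  shows "partial_hom R S (adjoin R S \<Gamma> b \<xi>)"
proof unfold_locales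
  show "adjoin R S \<Gamma> b \<xi> \<subseteq> carrier R \<times> carrier S" using adjoin_closed by auto
  show "(\<one>\<^bsub>R\<^esub>, \<one>\<^bsub>S\<^esub>) \<in> adjoin R S \<Gamma> b \<xi>" using adjoin_incl one by auto
  show "(\<ominus>\<^bsub>R\<^esub> x, \<ominus>\<^bsub>S\<^esub> w) \<in> adjoin R S \<Gamma> b \<xi>" if "(x, w) \<in> adjoin R S \<Gamma> b \<xi>" for x w
    using adjoin_scale[OF that uminus[OF one]] adjoin_closed[OF that]
    by (simp add: R.l_minus S.l_minus)
  show "w = \<zero>\<^bsub>S\<^esub>" if "(\<zero>\<^bsub>R\<^esub>, w) \<in> adjoin R S \<Gamma> b \<xi>" for w
    using that assms unfolding adjoin_iff_eval by auto
qed (rule adjoin_add adjoin_mult; assumption)+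

end

lemma pseudo_reduce_graph:
  assumes "set p \<subseteq> \<Gamma>" "set r \<subseteq> \<Gamma>" "p \<noteq> []" "length p \<le> length r"
  shows "set (zip (R.pseudo_reduce (map fst p) (map fst r)) (S.pseudo_reduce (map snd p) (map snd r))) \<subseteq> \<Gamma>"
proof -
  obtain c \<gamma> p1 where p: "p = (c, \<gamma>) # p1" using assms(3) by (cases p) auto
  obtain e \<epsilon> r1 where r: "r = (e, \<epsilon>) # r1" using assms(4) p by (cases r) auto
  have mem: "(c, \<gamma>) \<in> \<Gamma>" "(e, \<epsilon>) \<in> \<Gamma>" using assms p r by auto
  have gen: "set (zip
      (map2 (\<lambda>a b. a \<ominus>\<^bsub>R\<^esub> b) (map ((\<otimes>\<^bsub>R\<^esub>) c) (map fst xs)) (map ((\<otimes>\<^bsub>R\<^esub>) e) (map fst ys)))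
      (map2 (\<lambda>a b. a \<ominus>\<^bsub>S\<^esub> b) (map ((\<otimes>\<^bsub>S\<^esub>) \<gamma>) (map snd xs)) (map ((\<otimes>\<^bsub>S\<^esub>) \<epsilon>) (map snd ys)))) \<subseteq> \<Gamma>"
    if "length xs = length ys" "set xs \<subseteq> \<Gamma>" "set ys \<subseteq> \<Gamma>" for xs ys
    using that
  proof (induction xs ys rule: list_induct2)
    case (Cons x xs y ys)
    have "(c \<otimes>\<^bsub>R\<^esub> fst x \<ominus>\<^bsub>R\<^esub> e \<otimes>\<^bsub>R\<^esub> fst y, \<gamma> \<otimes>\<^bsub>S\<^esub> snd x \<ominus>\<^bsub>S\<^esub> \<epsilon> \<otimes>\<^bsub>S\<^esub> snd y) \<in> \<Gamma>"
      using Cons.prems by (intro minus mult mem) auto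
    thus ?case using Cons by simp
  qed simp
  define k where "k = length r - length p"
  have "set (p1 @ replicate k (\<zero>\<^bsub>R\<^esub>, \<zero>\<^bsub>S\<^esub>)) \<subseteq> \<Gamma>" using assms(1) p zero by auto
  moreover have "length r1 = length (p1 @ replicate k (\<zero>\<^bsub>R\<^esub>, \<zero>\<^bsub>S\<^esub>))"
    using assms(4) p r by (simp add: k_def)
  moreover have "set r1 \<subseteq> \<Gamma>" using assms(2) r by auto
  ultimately have "set (zip
      (map2 (\<lambda>a b. a \<ominus>\<^bsub>R\<^esub> b) (map ((\<otimes>\<^bsub>R\<^esub>) c) (map fst r1))
        (map ((\<otimes>\<^bsub>R\<^esub>) e) (map fst (p1 @ replicate k (\<zero>\<^bsub>R\<^esub>, \<zero>\<^bsub>S\<^esub>)))))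
      (map2 (\<lambda>a b. a \<ominus>\<^bsub>S\<^esub> b) (map ((\<otimes>\<^bsub>S\<^esub>) \<gamma>) (map snd r1))
        (map ((\<otimes>\<^bsub>S\<^esub>) \<epsilon>) (map snd (p1 @ replicate k (\<zero>\<^bsub>R\<^esub>, \<zero>\<^bsub>S\<^esub>)))))) \<subseteq> \<Gamma>"
    using gen by blast
  thus ?thesis
    unfolding R.pseudo_reduce_def S.pseudo_reduce_def by (simp add: p r k_def)
qed

end

text \<open>A transcendental \<open>b\<close> has no relations, so every value is admissible. Write \<open>v\<close> as a polynomial in \<open>b\<close>
  and let \<open>u\<close> be its leading coefficient: if \<open>u\<close> is not killed, the image of that polynomial is nonzero
  and \<open>\<xi>\<close> only has to avoid its roots.\<close>

lemma extension_step_transcendental: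
  assumes R: "field R" and A: "subring A R" and b: "b \<in> carrier R"
    and tr: "\<And>p. \<lbrakk>set p \<subseteq> A; ring.eval R p b = \<zero>\<^bsub>R\<^esub>\<rbrakk> \<Longrightarrow> set p \<subseteq> {\<zero>\<^bsub>R\<^esub>}"
    and v: "v \<in> ring.simple_extension R A b" "v \<noteq> \<zero>\<^bsub>R\<^esub>"
    and rc: "root_closed S"
  shows "\<exists>u\<in>A. u \<noteq> \<zero>\<^bsub>R\<^esub> \<and> (\<forall>\<Gamma>. partial_hom R S \<Gamma> \<and> Domain \<Gamma> = A \<and> (u, \<zero>\<^bsub>S\<^esub>) \<notin> \<Gamma> \<longrightarrow>
    (\<exists>\<Gamma>'. partial_hom R S \<Gamma>' \<and> \<Gamma> \<subseteq> \<Gamma>' \<and> Domain \<Gamma>' = ring.simple_extension R A b \<and>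
      (v, \<zero>\<^bsub>S\<^esub>) \<notin> \<Gamma>'))"
proof -
  interpret R: field R by fact
  have Ac: "A \<subseteq> carrier R" using subringE(1)[OF A] .
  obtain q0 where q0: "set q0 \<subseteq> A" "v = R.eval q0 b"
    using v(1) R.simple_extension_eval[OF Ac b] by blast
  obtain q where q: "set q \<subseteq> A" "v = R.eval q b" "q \<noteq> []" "hd q \<noteq> \<zero>\<^bsub>R\<^esub>"
    using q0 v(2)
  proof (induction q0 arbitrary: thesis)
    case (Cons a p)
    show ?case
    proof (cases "a = \<zero>\<^bsub>R\<^esub>")
      case True
      hence "v = R.eval p b" using Cons.prems b Ac by (auto simp: R.eval_in_carrier)
      thus ?thesis using Cons True by auto
    next
      case False
      show ?thesis by (rule Cons.prems(1)[of "a # p"]) (use Cons.prems(2-) False in simp_all)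
    qed
  qed auto
  show ?thesis
  proof (intro bexI[of _ "hd q"] conjI allI impI)
    show "hd q \<noteq> \<zero>\<^bsub>R\<^esub>" by fact
    show "hd q \<in> A" using q by (cases q) auto
    fix \<Gamma> assume \<Gamma>: "partial_hom R S \<Gamma> \<and> Domain \<Gamma> = A \<and> (hd q, \<zero>\<^bsub>S\<^esub>) \<notin> \<Gamma>"
    then interpret partial_hom R S \<Gamma> by blast
    obtain q' where q': "set q' \<subseteq> \<Gamma>" "map fst q' = q" using list_lift[of q] q \<Gamma> by auto
    note sc = list_closed[OF q'(1)]
    have ne: "q' \<noteq> []" using q' q by auto
    have "hd q' \<in> \<Gamma>" using q' ne by (cases q') auto
    moreover have "fst (hd q') = hd q" using q' ne by (cases q') auto
    ultimately have "hd (map snd q') \<noteq> \<zero>\<^bsub>S\<^esub>"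
      using \<Gamma> ne by (cases q') auto
    then obtain \<xi> where x: "\<xi> \<in> carrier S" "S.eval (map snd q') \<xi> \<noteq> \<zero>\<^bsub>S\<^esub>"
      using S.eval_nonzero_somewhere[OF rc sc(2)] ne by auto
    have ph: "partial_hom R S (adjoin R S \<Gamma> b \<xi>)"
    proof (rule adjoin_partial_hom[OF b x(1)])
      fix r assume r: "set r \<subseteq> \<Gamma>" "R.eval (map fst r) b = \<zero>\<^bsub>R\<^esub>"
      have "set (map fst r) \<subseteq> {\<zero>\<^bsub>R\<^esub>}"
        using tr[OF _ r(2)] list_closed(3)[OF r(1)] \<Gamma> by blast
      hence "set (map snd r) \<subseteq> {\<zero>\<^bsub>S\<^esub>}"
        using r(1) zero_unique by fastforce
      thus "S.eval (map snd r) \<xi> = \<zero>\<^bsub>S\<^esub>" using S.eval_zeros x by blast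
    qed
    then interpret A: partial_hom R S "adjoin R S \<Gamma> b \<xi>" .
    have "(v, S.eval (map snd q') \<xi>) \<in> adjoin R S \<Gamma> b \<xi>"
      unfolding adjoin_iff_eval[OF b x(1)] using q' q by blast
    hence "(v, \<zero>\<^bsub>S\<^esub>) \<notin> adjoin R S \<Gamma> b \<xi>" using x(2) A.unique by blast
    thus "\<exists>\<Gamma>'. partial_hom R S \<Gamma>' \<and> \<Gamma> \<subseteq> \<Gamma>' \<and> Domain \<Gamma>' = R.simple_extension A b \<and> (v, \<zero>\<^bsub>S\<^esub>) \<notin> \<Gamma>'"
      using ph adjoin_incl[OF b x(1)] adjoin_Domain[OF b x(1)] \<Gamma> by blast
  qed
qed

text \<open>Let \<open>p\<close> be a polynomial of least degree over \<open>A\<close> with \<open>p(b) = 0\<close>, and let \<open>\<xi>\<close> be a root of its image.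
  Every relation of \<open>b\<close> is reduced to the zero polynomial by repeated pseudo-reduction modulo \<open>p\<close>; each
  reduction multiplies by the leading coefficient of \<open>p\<close>, so the relation holds for \<open>\<xi>\<close> if this
  coefficient is not killed. The element \<open>u\<close> is that coefficient times a nonzero multiple \<open>v t\<close> of \<open>v\<close>
  in \<open>A\<close>; if \<open>u\<close> survives then so do \<open>v t\<close> and \<open>v\<close>.\<close>

lemma extension_step_algebraic:
  assumes R: "field R" and A: "subring A R" and b: "b \<in> carrier R"
    and p0: "set p0 \<subseteq> A" "ring.eval R p0 b = \<zero>\<^bsub>R\<^esub>" "\<not> set p0 \<subseteq> {\<zero>\<^bsub>R\<^esub>}"
    and v: "v \<in> ring.simple_extension R A b" "v \<noteq> \<zero>\<^bsub>R\<^esub>"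
    and rc: "root_closed S"
  shows "\<exists>u\<in>A. u \<noteq> \<zero>\<^bsub>R\<^esub> \<and> (\<forall>\<Gamma>. partial_hom R S \<Gamma> \<and> Domain \<Gamma> = A \<and> (u, \<zero>\<^bsub>S\<^esub>) \<notin> \<Gamma> \<longrightarrow>
    (\<exists>\<Gamma>'. partial_hom R S \<Gamma>' \<and> \<Gamma> \<subseteq> \<Gamma>' \<and> Domain \<Gamma>' = ring.simple_extension R A b \<and>
      (v, \<zero>\<^bsub>S\<^esub>) \<notin> \<Gamma>'))"
proof -
  interpret R: field R by fact
  note Ae = subringE[OF A]
  note Ac = Ae(1)
  define P where "P q \<longleftrightarrow> set q \<subseteq> A \<and> \<not> set q \<subseteq> {\<zero>\<^bsub>R\<^esub>} \<and> R.eval q b = \<zero>\<^bsub>R\<^esub>" for q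
  obtain p where p: "P p" "\<And>q. P q \<Longrightarrow> length p \<le> length q"
    using p0 ex_has_least_nat[of P p0 length] unfolding P_def by blast
  have pA: "set p \<subseteq> A" "R.eval p b = \<zero>\<^bsub>R\<^esub>" "p \<noteq> []" using p(1) unfolding P_def by auto
  have low: "set q \<subseteq> {\<zero>\<^bsub>R\<^esub>}" if "set q \<subseteq> A" "R.eval q b = \<zero>\<^bsub>R\<^esub>" "length q < length p" for q
    using p(2)[of q] that unfolding P_def by fastforce
  obtain c p1 where cp: "p = c # p1" using pA(3) by (cases p) auto
  have cc: "c \<in> A" "set p1 \<subseteq> A" "c \<in> carrier R" "set p1 \<subseteq> carrier R" using pA(1) cp Ac by auto
  have hd0: "hd p \<noteq> \<zero>\<^bsub>R\<^esub>"
  proof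
    assume "hd p = \<zero>\<^bsub>R\<^esub>"
    hence c0: "c = \<zero>\<^bsub>R\<^esub>" using cp by simp
    hence "R.eval p1 b = \<zero>\<^bsub>R\<^esub>" using pA(2) cp cc b by (simp add: R.eval_in_carrier)
    hence "set p1 \<subseteq> {\<zero>\<^bsub>R\<^esub>}" using low cc(2) cp by simp
    thus False using p(1) cp c0 unfolding P_def by simp
  qed
  have len: "2 \<le> length p"
  proof (rule ccontr)
    assume "\<not> 2 \<le> length p"
    hence "p1 = []" using cp by (cases p1) auto
    thus False using pA(2) hd0 cp cc b by simp
  qed
  obtain t where t: "t \<in> R.simple_extension A b" "v \<otimes>\<^bsub>R\<^esub> t \<in> A" "v \<otimes>\<^bsub>R\<^esub> t \<noteq> \<zero>\<^bsub>R\<^esub>"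
    using R.algebraic_multiple_in_base[OF A b p0(1,3,2) v] by blast
  define u where "u = hd p \<otimes>\<^bsub>R\<^esub> (v \<otimes>\<^bsub>R\<^esub> t)"
  have hp: "hd p \<in> A" "hd p \<in> carrier R" using cc cp by auto
  show ?thesis
  proof (intro bexI[of _ u] conjI allI impI)
    show "u \<noteq> \<zero>\<^bsub>R\<^esub>" unfolding u_def using hp hd0 t Ac R.integral by blast
    show "u \<in> A" unfolding u_def using hp t Ae(6) by blast
    fix \<Gamma> assume \<Gamma>: "partial_hom R S \<Gamma> \<and> Domain \<Gamma> = A \<and> (u, \<zero>\<^bsub>S\<^esub>) \<notin> \<Gamma>"
    then interpret partial_hom R S \<Gamma> by blast
    obtain p' where p': "set p' \<subseteq> \<Gamma>" "map fst p' = p" using list_lift[of p] pA \<Gamma> by auto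
    note sc = list_closed[OF p'(1)]
    have ne: "p' \<noteq> []" using p' pA by auto
    define \<alpha> where "\<alpha> = hd (map snd p')"
    have hd': "(hd p, \<alpha>) \<in> \<Gamma>" using p' ne unfolding \<alpha>_def by (cases p') auto
    obtain \<beta> where \<beta>: "(v \<otimes>\<^bsub>R\<^esub> t, \<beta>) \<in> \<Gamma>" using t(2) \<Gamma> by blast
    have u\<Gamma>: "(u, \<alpha> \<otimes>\<^bsub>S\<^esub> \<beta>) \<in> \<Gamma>" unfolding u_def by (rule mult[OF hd' \<beta>])
    have nz: "\<alpha> \<noteq> \<zero>\<^bsub>S\<^esub>" "\<beta> \<noteq> \<zero>\<^bsub>S\<^esub>" using u\<Gamma> \<Gamma> closed[OF hd'] closed[OF \<beta>] by auto
    have len': "length p' = length p" using p' by auto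
    obtain \<xi> where x: "\<xi> \<in> carrier S" "S.eval (map snd p') \<xi> = \<zero>\<^bsub>S\<^esub>"
      using root_closedD[OF rc sc(2)] nz(1) len len' \<alpha>_def by auto
    have wd: "S.eval (map snd r) \<xi> = \<zero>\<^bsub>S\<^esub>" if "set r \<subseteq> \<Gamma>" "R.eval (map fst r) b = \<zero>\<^bsub>R\<^esub>" for r
      using that
    proof (induction "length r" arbitrary: r rule: less_induct)
      case less
      note rc' = list_closed[OF less(2)]
      show ?case
      proof (cases "length r < length p")
        case True
        hence "set (map fst r) \<subseteq> {\<zero>\<^bsub>R\<^esub>}" using low[of "map fst r"] rc'(3) \<Gamma> less(3) by auto
        hence "set (map snd r) \<subseteq> {\<zero>\<^bsub>S\<^esub>}" using less(2) zero_unique by fastforce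
        thus ?thesis using S.eval_zeros x by blast
      next
        case False
        hence lr: "length p \<le> length r" by simp
        define s where "s = zip (R.pseudo_reduce p (map fst r)) (S.pseudo_reduce (map snd p') (map snd r))"
        have l1: "Suc (length (R.pseudo_reduce p (map fst r))) = length r"
          using R.pseudo_reduce(2)[OF pA(1) _ A pA(3), of "map fst r"] rc'(3) \<Gamma> lr by simp
        have l2: "Suc (length (S.pseudo_reduce (map snd p') (map snd r))) = length r"
          using S.pseudo_reduce(2)[OF sc(2) rc'(2) S.carrier_is_subring] ne lr len' by simp
        have fs: "map fst s = R.pseudo_reduce p (map fst r)"
          "map snd s = S.pseudo_reduce (map snd p') (map snd r)"
          using l1 l2 by (simp_all add: s_def)
        have s\<Gamma>: "set s \<subseteq> \<Gamma>"
          using pseudo_reduce_graph[OF p'(1) less(2) ne] lr len' by (simp add: s_def p'(2))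
        have "R.eval (map fst s) b = \<zero>\<^bsub>R\<^esub>"
        proof -
          have "hd (map fst r) \<in> carrier R" using rc'(1) lr len by (cases r) auto
          thus ?thesis
            unfolding fs using R.pseudo_reduce(3)[OF pA(1) _ A pA(3) _ b, of "map fst r"]
              rc'(3) \<Gamma> lr less(3) pA(2) hp b by (simp add: R.minus_eq)
        qed
        hence "S.eval (map snd s) \<xi> = \<zero>\<^bsub>S\<^esub>" using less(1)[of s] s\<Gamma> fs l1 by (metis length_map lessI)
        moreover have "S.eval (map snd s) \<xi> = \<alpha> \<otimes>\<^bsub>S\<^esub> S.eval (map snd r) \<xi>"
        proof -
          have "hd (map snd r) \<in> carrier S" using rc'(2) lr len by (cases r) auto
          thus ?thesis
            unfolding fs using S.pseudo_reduce(3)[OF sc(2) rc'(2) S.carrier_is_subring _ _ x(1)]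
              ne lr len' x S.eval_in_carrier[OF rc'(2) x(1)] closed[OF hd']
            by (simp add: \<alpha>_def[symmetric] S.minus_eq)
        qed
        ultimately show ?thesis
          using nz(1) closed[OF hd'] S.eval_in_carrier[OF rc'(2) x(1)] S.integral by metis
      qed
    qed
    have ph: "partial_hom R S (adjoin R S \<Gamma> b \<xi>)"
      using adjoin_partial_hom[OF b x(1) wd] .
    then interpret A: partial_hom R S "adjoin R S \<Gamma> b \<xi>" .
    have dom: "Domain (adjoin R S \<Gamma> b \<xi>) = R.simple_extension A b"
      using adjoin_Domain[OF b x(1)] \<Gamma> by blast
    have "(v, \<zero>\<^bsub>S\<^esub>) \<notin> adjoin R S \<Gamma> b \<xi>"
    proof
      assume v0: "(v, \<zero>\<^bsub>S\<^esub>) \<in> adjoin R S \<Gamma> b \<xi>"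
      obtain \<tau> where \<tau>: "(t, \<tau>) \<in> adjoin R S \<Gamma> b \<xi>" using t(1) dom by blast
      have "(v \<otimes>\<^bsub>R\<^esub> t, \<zero>\<^bsub>S\<^esub>) \<in> adjoin R S \<Gamma> b \<xi>"
        using A.mult[OF v0 \<tau>] A.closed[OF \<tau>] by simp
      moreover have "(v \<otimes>\<^bsub>R\<^esub> t, \<beta>) \<in> adjoin R S \<Gamma> b \<xi>"
        using \<beta> adjoin_incl[OF b x(1)] by blast
      ultimately show False using nz(2) A.unique by blast
    qed
    thus "\<exists>\<Gamma>'. partial_hom R S \<Gamma>' \<and> \<Gamma> \<subseteq> \<Gamma>' \<and> Domain \<Gamma>' = R.simple_extension A b \<and> (v, \<zero>\<^bsub>S\<^esub>) \<notin> \<Gamma>'"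
      using ph adjoin_incl[OF b x(1)] dom by blast
  qed
qed

text \<open>The nonvanishing clause is the invariant of the induction: the obstruction that one generator
  leaves in the ring below it is the element that the remaining generators have to keep alive.\<close>

lemma extension_nonvanishing:
  assumes R: "field R" and A: "subring A R" and bs: "set bs \<subseteq> carrier R"
    and v: "v \<in> ring.finite_extension R A bs" "v \<noteq> \<zero>\<^bsub>R\<^esub>"
    and rc: "root_closed S"
  shows "\<exists>u\<in>A. u \<noteq> \<zero>\<^bsub>R\<^esub> \<and> (\<forall>\<Gamma>. partial_hom R S \<Gamma> \<and> Domain \<Gamma> = A \<and> (u, \<zero>\<^bsub>S\<^esub>) \<notin> \<Gamma> \<longrightarrow>
    (\<exists>\<Gamma>'. partial_hom R S \<Gamma>' \<and> \<Gamma> \<subseteq> \<Gamma>' \<and> Domain \<Gamma>' = ring.finite_extension R A bs \<and>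
      (v, \<zero>\<^bsub>S\<^esub>) \<notin> \<Gamma>'))"
  using bs v
proof (induction bs arbitrary: v)
  interpret R: field R by fact
  {
    case Nil
    thus ?case by (intro bexI[of _ v]) auto
  next
    case (Cons b bs)
    let ?B = "R.finite_extension A bs"
    have B: "subring ?B R" using R.finite_extension_is_subring[OF A] Cons.prems by simp
    have b: "b \<in> carrier R" and bs: "set bs \<subseteq> carrier R" using Cons.prems by auto
    have v: "v \<in> R.simple_extension ?B b" using Cons.prems by simp
    obtain w where w: "w \<in> ?B" "w \<noteq> \<zero>\<^bsub>R\<^esub>" "\<And>\<Gamma>. partial_hom R S \<Gamma> \<Longrightarrow> Domain \<Gamma> = ?B \<Longrightarrow>
        (w, \<zero>\<^bsub>S\<^esub>) \<notin> \<Gamma> \<Longrightarrow> \<exists>\<Gamma>'. partial_hom R S \<Gamma>' \<and> \<Gamma> \<subseteq> \<Gamma>' \<and>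
        Domain \<Gamma>' = R.simple_extension ?B b \<and> (v, \<zero>\<^bsub>S\<^esub>) \<notin> \<Gamma>'"
    proof (cases "\<exists>p. set p \<subseteq> ?B \<and> R.eval p b = \<zero>\<^bsub>R\<^esub> \<and> \<not> set p \<subseteq> {\<zero>\<^bsub>R\<^esub>}")
      case True
      then obtain p where "set p \<subseteq> ?B" "R.eval p b = \<zero>\<^bsub>R\<^esub>" "\<not> set p \<subseteq> {\<zero>\<^bsub>R\<^esub>}" by blast
      note step = extension_step_algebraic[OF R B b this v Cons.prems(3) rc]
      then obtain w where "w \<in> ?B" "w \<noteq> \<zero>\<^bsub>R\<^esub>" "\<forall>\<Gamma>. partial_hom R S \<Gamma> \<and> Domain \<Gamma> = ?B \<and> (w, \<zero>\<^bsub>S\<^esub>) \<notin> \<Gamma> \<longrightarrow>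
        (\<exists>\<Gamma>'. partial_hom R S \<Gamma>' \<and> \<Gamma> \<subseteq> \<Gamma>' \<and> Domain \<Gamma>' = R.simple_extension ?B b \<and> (v, \<zero>\<^bsub>S\<^esub>) \<notin> \<Gamma>')"
        by auto
      thus ?thesis by (intro that[of w]) simp_all
    next
      case False
      hence "set p \<subseteq> {\<zero>\<^bsub>R\<^esub>}" if "set p \<subseteq> ?B" "R.eval p b = \<zero>\<^bsub>R\<^esub>" for p using that by blast
      note step = extension_step_transcendental[OF R B b this v Cons.prems(3) rc]
      then obtain w where "w \<in> ?B" "w \<noteq> \<zero>\<^bsub>R\<^esub>" "\<forall>\<Gamma>. partial_hom R S \<Gamma> \<and> Domain \<Gamma> = ?B \<and> (w, \<zero>\<^bsub>S\<^esub>) \<notin> \<Gamma> \<longrightarrow>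
        (\<exists>\<Gamma>'. partial_hom R S \<Gamma>' \<and> \<Gamma> \<subseteq> \<Gamma>' \<and> Domain \<Gamma>' = R.simple_extension ?B b \<and> (v, \<zero>\<^bsub>S\<^esub>) \<notin> \<Gamma>')"
        by auto
      thus ?thesis by (intro that[of w]) simp_all
    qed
    obtain u where u: "u \<in> A" "u \<noteq> \<zero>\<^bsub>R\<^esub>" "\<And>\<Gamma>. partial_hom R S \<Gamma> \<Longrightarrow> Domain \<Gamma> = A \<Longrightarrow>
        (u, \<zero>\<^bsub>S\<^esub>) \<notin> \<Gamma> \<Longrightarrow> \<exists>\<Gamma>'. partial_hom R S \<Gamma>' \<and> \<Gamma> \<subseteq> \<Gamma>' \<and> Domain \<Gamma>' = ?B \<and> (w, \<zero>\<^bsub>S\<^esub>) \<notin> \<Gamma>'"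
      using Cons.IH[OF bs w(1,2)] by blast
    show ?case
    proof (intro bexI[OF _ u(1)] conjI allI impI u(2))
      fix \<Gamma> assume "partial_hom R S \<Gamma> \<and> Domain \<Gamma> = A \<and> (u, \<zero>\<^bsub>S\<^esub>) \<notin> \<Gamma>"
      hence \<Gamma>: "partial_hom R S \<Gamma>" "Domain \<Gamma> = A" "(u, \<zero>\<^bsub>S\<^esub>) \<notin> \<Gamma>" by auto
      obtain \<Gamma>1 where 1: "partial_hom R S \<Gamma>1" "\<Gamma> \<subseteq> \<Gamma>1" "Domain \<Gamma>1 = ?B" "(w, \<zero>\<^bsub>S\<^esub>) \<notin> \<Gamma>1"
        using u(3)[OF \<Gamma>] by (elim exE conjE)
      obtain \<Gamma>2 where "partial_hom R S \<Gamma>2" "\<Gamma>1 \<subseteq> \<Gamma>2"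
        "Domain \<Gamma>2 = R.simple_extension ?B b" "(v, \<zero>\<^bsub>S\<^esub>) \<notin> \<Gamma>2"
        using w(3)[OF 1(1,3,4)] by (elim exE conjE)
      thus "\<exists>\<Gamma>'. partial_hom R S \<Gamma>' \<and> \<Gamma> \<subseteq> \<Gamma>' \<and> Domain \<Gamma>' = R.finite_extension A (b # bs) \<and>
          (v, \<zero>\<^bsub>S\<^esub>) \<notin> \<Gamma>'" using 1(2) by (intro exI[of _ \<Gamma>2]) auto
    qed
  }
qed

text \<open>Over a field the obstruction is a unit and is never killed. Applied to a finitely generated algebra
  over an algebraically closed field this is the Nullstellensatz.\<close>

lemma extension_from_subfield:
  assumes "partial_hom R S \<Gamma>" "subfield (Domain \<Gamma>) R" "set bs \<subseteq> carrier R" "root_closed S"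
  shows "\<exists>\<Gamma>'. partial_hom R S \<Gamma>' \<and> \<Gamma> \<subseteq> \<Gamma>' \<and> set bs \<subseteq> Domain \<Gamma>'"
proof -
  interpret partial_hom R S \<Gamma> by fact
  let ?E = "Domain \<Gamma>"
  let ?B = "R.finite_extension ?E bs"
  have A: "subring ?E R" by (rule Domain_subring)
  have B: "subring ?B R" using R.finite_extension_is_subring[OF A assms(3)] .
  have R: "field R" by unfold_locales
  obtain u where u: "u \<in> ?E" "u \<noteq> \<zero>\<^bsub>R\<^esub>" "(u, \<zero>\<^bsub>S\<^esub>) \<notin> \<Gamma> \<Longrightarrow>
      \<exists>\<Gamma>'. partial_hom R S \<Gamma>' \<and> \<Gamma> \<subseteq> \<Gamma>' \<and> Domain \<Gamma>' = ?B"
    using extension_nonvanishing[OF R A assms(3) subringE(3)[OF B] R.one_not_zero assms(4)]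
      assms(1) by blast
  have "(u, \<zero>\<^bsub>S\<^esub>) \<notin> \<Gamma>"
  proof
    assume u0: "(u, \<zero>\<^bsub>S\<^esub>) \<in> \<Gamma>"
    have "inv\<^bsub>R\<^esub> u \<in> ?E" using R.subfield_m_inv(1)[OF assms(2)] u by auto
    then obtain w where w: "(inv\<^bsub>R\<^esub> u, w) \<in> \<Gamma>" by blast
    have "(\<one>\<^bsub>R\<^esub>, \<zero>\<^bsub>S\<^esub>) \<in> \<Gamma>"
      using mult[OF u0 w] closed[OF u0] closed[OF w] u(2) by simp
    thus False using unique[OF one] S.one_not_zero by blast
  qed
  then obtain \<Gamma>' where G: "partial_hom R S \<Gamma>'" "\<Gamma> \<subseteq> \<Gamma>'" "Domain \<Gamma>' = ?B" using u(3) by blast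
  moreover have "set bs \<subseteq> ?B" using R.finite_extension_mem[OF A assms(3)] by auto
  ultimately show ?thesis by blast
qed

section \<open>Differential fields and Wronskian relations\<close>

context ring
begin

primrec list_sum :: "('x \<Rightarrow> 'a) \<Rightarrow> 'x list \<Rightarrow> 'a"
  where "list_sum f [] = \<zero>"
  | "list_sum f (x # xs) = f x \<oplus> list_sum f xs"

lemma list_sum_closed [intro]:
  "(\<And>x. x \<in> set xs \<Longrightarrow> f x \<in> carrier R) \<Longrightarrow> list_sum f xs \<in> carrier R"
  by (induction xs) auto

lemma list_sum_append:
  "\<lbrakk>\<And>x. x \<in> set (xs @ ys) \<Longrightarrow> f x \<in> carrier R\<rbrakk>
    \<Longrightarrow> list_sum f (xs @ ys) = list_sum f xs \<oplus> list_sum f ys"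
proof (induction xs)
  case (Cons x xs)
  have "f x \<in> carrier R" "list_sum f xs \<in> carrier R" "list_sum f ys \<in> carrier R"
    using Cons.prems by auto
  thus ?case using Cons by (simp add: a_assoc)
next
  case Nil
  hence "list_sum f ys \<in> carrier R" by auto
  thus ?case by simp
qed

end

context differential_field
begin

lemma deriv_zero [simp]: "d \<zero> = \<zero>"
  using deriv_add[of \<zero> \<zero>] deriv_closed[of \<zero>] by (simp add: add.l_cancel_one)

lemma deriv_one [simp]: "d \<one> = \<zero>"
  using deriv_mult[of \<one> \<one>] deriv_closed[of \<one>] by (simp add: add.l_cancel_one)

lemma deriv_uminus: "x \<in> carrier R \<Longrightarrow> d (\<ominus> x) = \<ominus> d x"
  using deriv_add[of "\<ominus> x" x] deriv_closed[of x] deriv_closed[of "\<ominus> x"]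
  by (simp add: l_neg minus_equality)

lemma deriv_minus: "\<lbrakk>x \<in> carrier R; y \<in> carrier R\<rbrakk> \<Longrightarrow> d (x \<ominus> y) = d x \<ominus> d y"
  by (simp add: a_minus_def deriv_add deriv_uminus)

lemma deriv_finsum:
  assumes "\<And>i. i \<in> I \<Longrightarrow> f i \<in> carrier R"
  shows "d (finsum R f I) = (\<Oplus>i\<in>I. d (f i))"
proof (cases "finite I")
  case True
  thus ?thesis using assms
  proof (induction I)
    case (insert i I)
    have "f \<in> I \<rightarrow> carrier R" "f i \<in> carrier R" "(\<lambda>i. d (f i)) \<in> I \<rightarrow> carrier R" "d (f i) \<in> carrier R"
      using insert.prems deriv_closed by blast+
    thus ?case using insert by (simp add: deriv_add finsum_closed)
  qed simp
qed simp

lemma deriv_inv: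
  assumes "x \<in> carrier R" "x \<noteq> \<zero>"
  shows "d (inv x) = \<ominus> (d x \<otimes> inv x \<otimes> inv x)"
proof -
  define y where "y = inv x"
  have y: "y \<in> carrier R" "x \<otimes> y = \<one>" using assms by (auto simp: y_def)
  note c = assms(1) y(1) deriv_closed[OF assms(1)] deriv_closed[OF y(1)]
  have "d x \<otimes> y \<oplus> x \<otimes> d y = \<zero>" using deriv_mult[OF assms(1) y(1)] y(2) by simp
  moreover have "(x \<otimes> y) \<otimes> d y = y \<otimes> (d x \<otimes> y \<oplus> x \<otimes> d y) \<ominus> d x \<otimes> y \<otimes> y"
    using c by algebra
  ultimately have "d y = \<ominus> (d x \<otimes> y \<otimes> y)"
    using y c by (simp add: minus_eq)
  thus ?thesis by (simp add: y_def)
qed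

lemma funpow_closed [simp, intro]: "x \<in> carrier R \<Longrightarrow> (d ^^ i) x \<in> carrier R"
  by (induction i) (auto simp: deriv_closed)

lemma funpow_zero [simp]: "(d ^^ i) \<zero> = \<zero>"
  by (induction i) auto

lemma funpow_add:
  "\<lbrakk>x \<in> carrier R; y \<in> carrier R\<rbrakk> \<Longrightarrow> (d ^^ i) (x \<oplus> y) = (d ^^ i) x \<oplus> (d ^^ i) y"
  by (induction i) (auto simp: deriv_add)

abbreviation constant_field where "constant_field \<equiv> constants R d (carrier R)"

lemma constant_field_closed: "c \<in> constant_field \<Longrightarrow> c \<in> carrier R" "c \<in> constant_field \<Longrightarrow> d c = \<zero>"
  by (auto simp: constants_def)

lemma funpow_scale:
  "\<lbrakk>c \<in> constant_field; x \<in> carrier R\<rbrakk> \<Longrightarrow> (d ^^ i) (c \<otimes> x) = c \<otimes> (d ^^ i) x"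
proof (induction i)
  case (Suc i)
  thus ?case using constant_field_closed[of c] by (simp add: deriv_mult deriv_closed)
qed simp

lemma constants_subfield:
  assumes "differential_subfield R d M"
  shows "subfield (constants R d M) R"
proof (rule subfieldI')
  have M: "subfield M R" using assms unfolding differential_subfield_def by auto
  note Ms = subfieldE[OF M] and Mr = subringE[OF subfieldE(1)[OF M]]
  show "subring (constants R d M) R"
  proof (rule subringI)
    show "constants R d M \<subseteq> carrier R" using Ms(3) by (auto simp: constants_def)
    show "\<one> \<in> constants R d M" using Mr(3) by (auto simp: constants_def)
    fix x assume x: "x \<in> constants R d M"
    hence xc: "x \<in> carrier R" "x \<in> M" "d x = \<zero>" using Ms(3) by (auto simp: constants_def)
    show "\<ominus> x \<in> constants R d M" using xc Mr(5) by (auto simp: constants_def deriv_uminus)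
    fix y assume y: "y \<in> constants R d M"
    hence yc: "y \<in> carrier R" "y \<in> M" "d y = \<zero>" using Ms(3) by (auto simp: constants_def)
    show "x \<otimes> y \<in> constants R d M" "x \<oplus> y \<in> constants R d M"
      using xc yc Mr(6,7) by (auto simp: constants_def deriv_mult deriv_add)
  qed
  fix k assume "k \<in> constants R d M - {\<zero>}"
  hence k: "k \<in> carrier R" "k \<in> M" "d k = \<zero>" "k \<noteq> \<zero>" using Ms(3) by (auto simp: constants_def)
  have "d (inv k) = \<zero>" using deriv_inv[OF k(1,4)] k by simp
  thus "inv k \<in> constants R d M"
    using subfield_m_inv(1)[OF M] k by (auto simp: constants_def)
qed

lemma carrier_differential_subfield: "differential_subfield R d (carrier R)"
  unfolding differential_subfield_def using carrier_is_subfield deriv_closed by blast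

lemma constant_field_subfield: "subfield constant_field R"
  by (rule constants_subfield[OF carrier_differential_subfield])

lemma deriv_combine:
  assumes "set cs \<subseteq> constant_field" "set us \<subseteq> carrier R"
  shows "d (combine cs us) = combine cs (map d us)"
  using assms
proof (induction cs us rule: combine.induct)
  case (1 c cs u us)
  have "combine cs us \<in> carrier R" "c \<in> carrier R" "d c = \<zero>" "u \<in> carrier R"
    using 1 constant_field_closed by (auto simp: subset_iff)
  thus ?case using 1 by (simp add: deriv_add deriv_mult deriv_closed)
qed auto

end

text \<open>A differential field \<open>K\<close> mapped into a field \<open>\<Omega>\<close> that carries no derivation. A list of pairs \<open>(k, b)\<close>
  stands for the tensor \<open>\<Sum> k \<otimes> b\<close>; its \<open>i\<close>-th jet differentiates the left factors \<open>i\<close> times and multiplies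
  out in \<open>\<Omega>\<close>. The vanishing of the first jets is a linear system with the Wronskian matrix of the \<open>k\<close>.\<close>

locale differential_field_into_field = K: differential_field K e + \<Omega>: field \<Omega>
  for K :: "('b, 'n) ring_scheme" and e and \<Omega> :: "('c, 'o) ring_scheme" +
  fixes \<iota> :: "'b \<Rightarrow> 'c"
  assumes hom: "\<iota> \<in> ring_hom K \<Omega>"
begin

sublocale hom: ring_hom_cring K \<Omega> \<iota>
  by unfold_locales (rule hom)

definition jet :: "nat \<Rightarrow> ('b \<times> 'c) list \<Rightarrow> 'c"
  where "jet i = \<Omega>.list_sum (\<lambda>(k, b). \<iota> ((e ^^ i) k) \<otimes>\<^bsub>\<Omega>\<^esub> b)"

abbreviation pairs :: "('b \<times> 'c) list \<Rightarrow> bool"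
  where "pairs u \<equiv> set u \<subseteq> carrier K \<times> carrier \<Omega>"

lemma pairs_map:
  assumes "pairs u" "\<And>x. x \<in> carrier K \<Longrightarrow> f x \<in> carrier K"
  shows "pairs (map (apfst f) u)"
  using assms(1) by (induction u) (auto simp: assms(2))

lemma jet_closed [intro]: "pairs u \<Longrightarrow> jet i u \<in> carrier \<Omega>"
  unfolding jet_def by (intro \<Omega>.list_sum_closed) auto

lemma jet_Nil [simp]: "jet i [] = \<zero>\<^bsub>\<Omega>\<^esub>"
  by (simp add: jet_def)

lemma jet_Cons [simp]: "jet i ((k, b) # u) = \<iota> ((e ^^ i) k) \<otimes>\<^bsub>\<Omega>\<^esub> b \<oplus>\<^bsub>\<Omega>\<^esub> jet i u"
  by (simp add: jet_def)

lemma jet_append: "pairs (u @ v) \<Longrightarrow> jet i (u @ v) = jet i u \<oplus>\<^bsub>\<Omega>\<^esub> jet i v"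
  unfolding jet_def by (intro \<Omega>.list_sum_append) auto

lemma jet_map_deriv: "jet i (map (apfst e) u) = jet (Suc i) u"
  by (induction u) (auto simp: funpow_swap1)

lemma jet_scale_Suc:
  assumes "q \<in> carrier K" "pairs u"
  shows "jet (Suc i) (map (apfst (\<lambda>k. q \<otimes>\<^bsub>K\<^esub> k)) u) =
    jet i (map (apfst (\<lambda>k. e q \<otimes>\<^bsub>K\<^esub> k)) u) \<oplus>\<^bsub>\<Omega>\<^esub> jet i (map (apfst (\<lambda>k. q \<otimes>\<^bsub>K\<^esub> k)) (map (apfst e) u))"
  using assms(2)
proof (induction u)
  case (Cons p u)
  obtain k b where p: "p = (k, b)" by fastforce
  have kb: "k \<in> carrier K" "b \<in> carrier \<Omega>" "pairs u" using Cons.prems p by auto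
  have c: "e q \<otimes>\<^bsub>K\<^esub> k \<in> carrier K" "q \<otimes>\<^bsub>K\<^esub> e k \<in> carrier K"
    using kb assms K.deriv_closed by auto
  have J: "jet i (map (apfst (\<lambda>k. e q \<otimes>\<^bsub>K\<^esub> k)) u) \<in> carrier \<Omega>"
    "jet i (map (apfst (\<lambda>k. q \<otimes>\<^bsub>K\<^esub> k)) (map (apfst e) u)) \<in> carrier \<Omega>"
    using kb(3) assms K.deriv_closed by (intro jet_closed pairs_map; simp)+
  have "(e ^^ Suc i) (q \<otimes>\<^bsub>K\<^esub> k) = (e ^^ i) (e q \<otimes>\<^bsub>K\<^esub> k) \<oplus>\<^bsub>K\<^esub> (e ^^ i) (q \<otimes>\<^bsub>K\<^esub> e k)"
    using kb assms c by (simp add: funpow_swap1 K.deriv_mult K.funpow_add)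
  moreover define x y where "x = \<iota> ((e ^^ i) (e q \<otimes>\<^bsub>K\<^esub> k))" and "y = \<iota> ((e ^^ i) (q \<otimes>\<^bsub>K\<^esub> e k))"
  moreover have xy: "x \<in> carrier \<Omega>" "y \<in> carrier \<Omega>" using c by (auto simp: x_def y_def)
  ultimately have xy': "\<iota> ((e ^^ Suc i) (q \<otimes>\<^bsub>K\<^esub> k)) = x \<oplus>\<^bsub>\<Omega>\<^esub> y" using c by simp
  define J1 where "J1 = jet i (map (apfst (\<lambda>k. e q \<otimes>\<^bsub>K\<^esub> k)) u)"
  define J2 where "J2 = jet i (map (apfst (\<lambda>k. q \<otimes>\<^bsub>K\<^esub> k)) (map (apfst e) u))"
  have J12: "J1 \<in> carrier \<Omega>" "J2 \<in> carrier \<Omega>" using J by (auto simp: J1_def J2_def)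
  have "(x \<oplus>\<^bsub>\<Omega>\<^esub> y) \<otimes>\<^bsub>\<Omega>\<^esub> b \<oplus>\<^bsub>\<Omega>\<^esub> (J1 \<oplus>\<^bsub>\<Omega>\<^esub> J2) = (x \<otimes>\<^bsub>\<Omega>\<^esub> b \<oplus>\<^bsub>\<Omega>\<^esub> J1) \<oplus>\<^bsub>\<Omega>\<^esub> (y \<otimes>\<^bsub>\<Omega>\<^esub> b \<oplus>\<^bsub>\<Omega>\<^esub> J2)"
    using xy J12 kb(2) by algebra
  thus ?case
    unfolding p list.map apfst_conv jet_Cons xy' Cons.IH[OF kb(3)] J1_def J2_def
    by (simp only: x_def y_def)
qed simp

text \<open>The Leibniz rule \<open>(q k)' = q' k + q k'\<close> reduces the order by one, at the price of changing both \<open>q\<close> and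
  the list, over which the induction therefore generalizes.\<close>

lemma jet_scale:
  assumes "q \<in> carrier K" "pairs u" "\<And>i. jet i u = \<zero>\<^bsub>\<Omega>\<^esub>"
  shows "jet i (map (apfst (\<lambda>k. q \<otimes>\<^bsub>K\<^esub> k)) u) = \<zero>\<^bsub>\<Omega>\<^esub>"
  using assms
proof (induction i arbitrary: q u)
  case 0
  have "jet 0 (map (apfst (\<lambda>k. q \<otimes>\<^bsub>K\<^esub> k)) u) = \<iota> q \<otimes>\<^bsub>\<Omega>\<^esub> jet 0 u"
    using 0(2)
  proof (induction u)
    case (Cons p u)
    obtain k b where p: "p = (k, b)" by fastforce
    have "k \<in> carrier K" "b \<in> carrier \<Omega>" "pairs u" "jet 0 u \<in> carrier \<Omega>" using Cons.prems p by auto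
    thus ?case using Cons.IH 0(1) by (simp add: p \<Omega>.r_distr \<Omega>.m_assoc)
  qed (use 0 in simp)
  thus ?case using 0 by simp
next
  case (Suc i)
  have "pairs (map (apfst e) u)" using pairs_map[OF Suc.prems(2)] K.deriv_closed by blast
  moreover have "jet i (map (apfst e) u) = \<zero>\<^bsub>\<Omega>\<^esub>" for i
    using Suc.prems(3) by (simp add: jet_map_deriv)
  ultimately show ?case
    using Suc.IH[of q "map (apfst e) u"] Suc.IH[of "e q" u] Suc.prems K.deriv_closed
      jet_scale_Suc[OF Suc.prems(1,2)] by simp
qed

text \<open>Reduction of order, in place of the Wronskian determinant. Divide all left factors by one of them,
  \<open>k\<^sub>2\<close>, which turns it into \<open>\<one>\<close>, and differentiate: its term disappears and the relation becomes shorter.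
  The head stays independent of the remaining factors because only constants have derivative zero.
  The coefficients \<open>b\<close> are never differentiated.\<close>

lemma jet_relation_head:
  assumes "k \<in> carrier K" "b \<in> carrier \<Omega>" "pairs u" "k \<notin> K.Span K.constant_field (map fst u)"
    and "\<And>i. jet i ((k, b) # u) = \<zero>\<^bsub>\<Omega>\<^esub>"
  shows "b = \<zero>\<^bsub>\<Omega>\<^esub>"
  using assms
proof (induction "length u" arbitrary: k b u)
  case 0
  hence "k \<noteq> \<zero>\<^bsub>K\<^esub>" "\<iota> k \<otimes>\<^bsub>\<Omega>\<^esub> b = \<zero>\<^bsub>\<Omega>\<^esub>" using 0(6)[of 0] by auto
  moreover have "\<iota> k \<otimes>\<^bsub>\<Omega>\<^esub> \<iota> (inv\<^bsub>K\<^esub> k) = \<one>\<^bsub>\<Omega>\<^esub>"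
    using 0 calculation(1) by (simp flip: hom.hom_mult)
  ultimately have "\<iota> k \<noteq> \<zero>\<^bsub>\<Omega>\<^esub>" using 0 by auto
  thus ?case using 0(2,3) \<open>\<iota> k \<otimes>\<^bsub>\<Omega>\<^esub> b = \<zero>\<^bsub>\<Omega>\<^esub>\<close> \<Omega>.integral[of "\<iota> k" b] by auto
next
  case (Suc n)
  then obtain k2 b2 v where u: "u = (k2, b2) # v" by (cases u) auto
  have c: "k2 \<in> carrier K" "b2 \<in> carrier \<Omega>" "pairs v" and v: "n = length v" using Suc u by auto
  have fc: "set (map fst v) \<subseteq> carrier K" using c(3) by auto
  note sp = K.Span_eq_combine_set_length_version[OF K.constant_field_subfield]
  show ?case
  proof (cases "k2 = \<zero>\<^bsub>K\<^esub>")
    case True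
    have "jet i ((k, b) # v) = \<zero>\<^bsub>\<Omega>\<^esub>" for i
      using Suc.prems(5)[of i] c True jet_closed[OF c(3)] Suc.prems(1,2) by (simp add: u)
    moreover have "k \<notin> K.Span K.constant_field (map fst v)"
      using K.mono_Span[OF K.constant_field_subfield fc c(1)] Suc.prems(4) by (auto simp: u simp del: K.Span.simps)
    ultimately show ?thesis using Suc.hyps(1)[OF v Suc.prems(1,2) c(3)] by blast
  next
    case False
    define q where "q = inv\<^bsub>K\<^esub> k2"
    have q: "q \<in> carrier K" "q \<otimes>\<^bsub>K\<^esub> k2 = \<one>\<^bsub>K\<^esub>" "k2 \<otimes>\<^bsub>K\<^esub> q = \<one>\<^bsub>K\<^esub>"
      using c(1) False by (auto simp: q_def)
    define D where "D x = e (q \<otimes>\<^bsub>K\<^esub> x)" for x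
    define w where "w = map (apfst D) v"
    have Dc: "D x \<in> carrier K" if "x \<in> carrier K" for x
      using that q K.deriv_closed by (simp add: D_def)
    have w: "pairs w" "n = length w" using pairs_map[OF c(3) Dc] v by (auto simp: w_def)
    have pu: "pairs ((k, b) # u)" using Suc.prems by auto
    have "jet i ((D k, b) # w) = \<zero>\<^bsub>\<Omega>\<^esub>" for i
    proof -
      have "jet (Suc i) (map (apfst (\<lambda>k. q \<otimes>\<^bsub>K\<^esub> k)) ((k, b) # u)) = \<zero>\<^bsub>\<Omega>\<^esub>"
        by (rule jet_scale[OF q(1) pu Suc.prems(5)])
      hence "jet i (map (apfst e) (map (apfst (\<lambda>k. q \<otimes>\<^bsub>K\<^esub> k)) ((k, b) # u))) = \<zero>\<^bsub>\<Omega>\<^esub>"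
        by (simp only: jet_map_deriv)
      moreover have "map (apfst e) (map (apfst (\<lambda>k. q \<otimes>\<^bsub>K\<^esub> k)) ((k, b) # u)) = (D k, b) # (\<zero>\<^bsub>K\<^esub>, b2) # w"
        by (simp add: u q w_def D_def comp_def apfst_compose)
      ultimately show ?thesis using c(2) jet_closed[OF w(1)] by simp
    qed
    moreover have "D k \<notin> K.Span K.constant_field (map fst w)"
    proof
      assume "D k \<in> K.Span K.constant_field (map fst w)"
      moreover have fw: "map fst w = map D (map fst v)" by (simp add: w_def)
      moreover have "set (map D (map fst v)) \<subseteq> carrier K" using fc Dc by auto
      ultimately obtain cs where cs: "set cs \<subseteq> K.constant_field" "length cs = length (map fst v)"
        "D k = K.combine cs (map D (map fst v))"
        using sp by auto
      have csc: "set cs \<subseteq> carrier K" using cs(1) K.constant_field_closed by blast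
      let ?s = "K.combine cs (map fst v)"
      have s: "?s \<in> carrier K" using csc fc by blast
      have qv: "set (map (\<lambda>x. q \<otimes>\<^bsub>K\<^esub> x) (map fst v)) \<subseteq> carrier K" using fc q by auto
      have comb: "q \<otimes>\<^bsub>K\<^esub> ?s = K.combine cs (map (\<lambda>x. q \<otimes>\<^bsub>K\<^esub> x) (map fst v))"
      proof -
        have "?s \<otimes>\<^bsub>K\<^esub> q = K.combine cs (map (\<lambda>x. x \<otimes>\<^bsub>K\<^esub> q) (map fst v))"
          by (rule K.combine_l_distr[OF csc fc q(1)])
        moreover have "map (\<lambda>x. x \<otimes>\<^bsub>K\<^esub> q) (map fst v) = map (\<lambda>x. q \<otimes>\<^bsub>K\<^esub> x) (map fst v)"
          using fc q(1) by (intro map_cong) (auto simp: K.m_comm)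
        ultimately show ?thesis using K.m_comm[OF s q(1)] by metis
      qed
      have "e (q \<otimes>\<^bsub>K\<^esub> ?s) = D k"
        unfolding comb K.deriv_combine[OF cs(1) qv] cs(3) by (simp add: D_def comp_def)
      hence "e (q \<otimes>\<^bsub>K\<^esub> k \<ominus>\<^bsub>K\<^esub> q \<otimes>\<^bsub>K\<^esub> ?s) = \<zero>\<^bsub>K\<^esub>"
        using s q Suc.prems(1) K.deriv_closed by (simp add: K.deriv_minus D_def[symmetric] Dc)
      hence "q \<otimes>\<^bsub>K\<^esub> k \<ominus>\<^bsub>K\<^esub> q \<otimes>\<^bsub>K\<^esub> ?s \<in> K.constant_field" (is "?c \<in> _")
        using s q Suc.prems(1) by (simp add: constants_def)
      hence "set (?c # cs) \<subseteq> K.constant_field" "length (?c # cs) = length (map fst u)"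
        using cs by (auto simp: u)
      moreover have "k = K.combine (?c # cs) (map fst u)"
      proof -
        have "?c \<otimes>\<^bsub>K\<^esub> k2 \<oplus>\<^bsub>K\<^esub> ?s = (q \<otimes>\<^bsub>K\<^esub> k2) \<otimes>\<^bsub>K\<^esub> k \<ominus>\<^bsub>K\<^esub> (q \<otimes>\<^bsub>K\<^esub> k2) \<otimes>\<^bsub>K\<^esub> ?s \<oplus>\<^bsub>K\<^esub> ?s"
          using s q(1) c(1) Suc.prems(1) by algebra
        also have "\<dots> = k" unfolding q(2) using s Suc.prems(1) by algebra
        finally show ?thesis by (simp add: u)
      qed
      ultimately have "k \<in> K.Span K.constant_field (map fst u)"
        using sp[of "map fst u"] fc c(1) by (force simp: u simp del: K.Span.simps K.combine.simps)
      thus False using Suc.prems(4) by blast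
    qed
    ultimately show ?thesis
      using Suc.hyps(1)[OF w(2) Dc[OF Suc.prems(1)] Suc.prems(2) w(1)] by blast
  qed
qed

lemma jet_relation_independent:
  assumes "pairs u" "K.independent K.constant_field (map fst u)" "\<And>i. jet i u = \<zero>\<^bsub>\<Omega>\<^esub>"
  shows "snd ` set u \<subseteq> {\<zero>\<^bsub>\<Omega>\<^esub>}"
  using assms
proof (induction u)
  case (Cons p u)
  obtain k b where p: "p = (k, b)" by fastforce
  have c: "k \<in> carrier K" "b \<in> carrier \<Omega>" "pairs u" using Cons.prems p by auto
  have i: "k \<notin> K.Span K.constant_field (map fst u)" "K.independent K.constant_field (map fst u)"
    using K.independent_backwards[of K.constant_field k "map fst u"] Cons.prems(2) p
    by (auto simp del: K.Span.simps)
  have b: "b = \<zero>\<^bsub>\<Omega>\<^esub>" using jet_relation_head[OF c i(1)] Cons.prems(3) p by blast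
  hence "jet i u = \<zero>\<^bsub>\<Omega>\<^esub>" for i using Cons.prems(3)[of i] p c jet_closed[OF c(3)] by simp
  thus ?case using Cons.IH c(3) i(2) b p by simp
qed simp

lemma jet_eq_finsum:
  assumes "length zs = length xs" "set zs \<subseteq> carrier K" "set xs \<subseteq> carrier \<Omega>"
  shows "jet i (zip zs xs) = (\<Oplus>\<^bsub>\<Omega>\<^esub>j\<in>{..<length zs}. \<iota> ((e ^^ i) (zs ! j)) \<otimes>\<^bsub>\<Omega>\<^esub> xs ! j)"
  using assms
proof (induction zs xs rule: rev_induct2)
  case (4 z zs x xs)
  hence l: "length zs = length xs" "set zs \<subseteq> carrier K" "set xs \<subseteq> carrier \<Omega>"
    "z \<in> carrier K" "x \<in> carrier \<Omega>" by auto
  hence p: "pairs (zip zs xs)" by (auto dest: set_zip_leftD set_zip_rightD)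
  have "jet i (zip (zs @ [z]) (xs @ [x])) = jet i (zip zs xs) \<oplus>\<^bsub>\<Omega>\<^esub> \<iota> ((e ^^ i) z) \<otimes>\<^bsub>\<Omega>\<^esub> x"
    using l p by (simp add: jet_append)
  moreover have "(\<Oplus>\<^bsub>\<Omega>\<^esub>j\<in>{..<length (zs @ [z])}. \<iota> ((e ^^ i) ((zs @ [z]) ! j)) \<otimes>\<^bsub>\<Omega>\<^esub> (xs @ [x]) ! j) =
      \<iota> ((e ^^ i) z) \<otimes>\<^bsub>\<Omega>\<^esub> x \<oplus>\<^bsub>\<Omega>\<^esub> (\<Oplus>\<^bsub>\<Omega>\<^esub>j\<in>{..<length zs}. \<iota> ((e ^^ i) ((zs @ [z]) ! j)) \<otimes>\<^bsub>\<Omega>\<^esub> (xs @ [x]) ! j)"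
  proof -
    have "{..<length (zs @ [z])} = insert (length zs) {..<length zs}" by auto
    moreover have "zs ! j \<in> carrier K" "xs ! j \<in> carrier \<Omega>" if "j < length zs" for j
      using that l by (auto dest: nth_mem)
    ultimately show ?thesis using l
      by (simp only:, subst \<Omega>.finsum_insert) (auto simp: nth_append Pi_def)
  qed
  moreover have "(\<Oplus>\<^bsub>\<Omega>\<^esub>j\<in>{..<length zs}. \<iota> ((e ^^ i) ((zs @ [z]) ! j)) \<otimes>\<^bsub>\<Omega>\<^esub> (xs @ [x]) ! j) =
      (\<Oplus>\<^bsub>\<Omega>\<^esub>j\<in>{..<length zs}. \<iota> ((e ^^ i) (zs ! j)) \<otimes>\<^bsub>\<Omega>\<^esub> xs ! j)"
  proof (rule \<Omega>.add.finprod_cong')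
    show "(\<lambda>j. \<iota> ((e ^^ i) (zs ! j)) \<otimes>\<^bsub>\<Omega>\<^esub> xs ! j) \<in> {..<length zs} \<rightarrow> carrier \<Omega>"
      using l by (auto dest!: nth_mem simp: subset_iff)
  qed (use l in \<open>auto simp: nth_append\<close>)
  ultimately show ?case
    using "4.IH"[OF l(1-3)] l(4,5) \<Omega>.a_comm[OF jet_closed[OF p, of i], of "\<iota> ((e ^^ i) z) \<otimes>\<^bsub>\<Omega>\<^esub> x"]
    by simp
qed auto

text \<open>A linear recursion for the derivatives of the left factors is inherited by the jets.\<close>

lemma jet_linear_combination:
  assumes "\<And>i. i < n \<Longrightarrow> \<alpha> i \<in> carrier K" "pairs u"
    and "\<And>z. z \<in> fst ` set u \<Longrightarrow> (e ^^ k) z = (\<Oplus>\<^bsub>K\<^esub>i\<in>{..<n}. \<alpha> i \<otimes>\<^bsub>K\<^esub> (e ^^ i) z)"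
  shows "jet k u = (\<Oplus>\<^bsub>\<Omega>\<^esub>i\<in>{..<n}. \<iota> (\<alpha> i) \<otimes>\<^bsub>\<Omega>\<^esub> jet i u)"
  using assms(2,3)
proof (induction u)
  case Nil
  have "(\<Oplus>\<^bsub>\<Omega>\<^esub>i\<in>{..<n}. \<iota> (\<alpha> i) \<otimes>\<^bsub>\<Omega>\<^esub> jet i []) = (\<Oplus>\<^bsub>\<Omega>\<^esub>i\<in>{..<n}. \<zero>\<^bsub>\<Omega>\<^esub>)"
    by (rule \<Omega>.add.finprod_cong') (use assms(1) in auto)
  thus ?case by simp
next
  case (Cons p u)
  obtain z b where p: "p = (z, b)" by fastforce
  have c: "z \<in> carrier K" "b \<in> carrier \<Omega>" "pairs u" using Cons.prems p by auto
  have "\<iota> ((e ^^ k) z) = (\<Oplus>\<^bsub>\<Omega>\<^esub>i\<in>{..<n}. \<iota> (\<alpha> i) \<otimes>\<^bsub>\<Omega>\<^esub> \<iota> ((e ^^ i) z))"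
  proof -
    have "(e ^^ k) z = (\<Oplus>\<^bsub>K\<^esub>i\<in>{..<n}. \<alpha> i \<otimes>\<^bsub>K\<^esub> (e ^^ i) z)" using Cons.prems(2) p by simp
    hence "\<iota> ((e ^^ k) z) = (\<Oplus>\<^bsub>\<Omega>\<^esub>i\<in>{..<n}. \<iota> (\<alpha> i \<otimes>\<^bsub>K\<^esub> (e ^^ i) z))"
      using assms(1) c by (simp only:, subst hom.hom_finsum) (auto simp: comp_def)
    also have "\<dots> = (\<Oplus>\<^bsub>\<Omega>\<^esub>i\<in>{..<n}. \<iota> (\<alpha> i) \<otimes>\<^bsub>\<Omega>\<^esub> \<iota> ((e ^^ i) z))"
      by (rule \<Omega>.add.finprod_cong') (use assms(1) c in auto)
    finally show ?thesis .
  qed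
  hence "\<iota> ((e ^^ k) z) \<otimes>\<^bsub>\<Omega>\<^esub> b = (\<Oplus>\<^bsub>\<Omega>\<^esub>i\<in>{..<n}. \<iota> (\<alpha> i) \<otimes>\<^bsub>\<Omega>\<^esub> \<iota> ((e ^^ i) z) \<otimes>\<^bsub>\<Omega>\<^esub> b)"
    using assms(1) c by (simp only:, subst \<Omega>.finsum_ldistr) auto
  moreover have "jet k u = (\<Oplus>\<^bsub>\<Omega>\<^esub>i\<in>{..<n}. \<iota> (\<alpha> i) \<otimes>\<^bsub>\<Omega>\<^esub> jet i u)"
    using Cons.IH[OF c(3)] Cons.prems(2) by simp
  ultimately have "jet k (p # u) = (\<Oplus>\<^bsub>\<Omega>\<^esub>i\<in>{..<n}. \<iota> (\<alpha> i) \<otimes>\<^bsub>\<Omega>\<^esub> \<iota> ((e ^^ i) z) \<otimes>\<^bsub>\<Omega>\<^esub> b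
      \<oplus>\<^bsub>\<Omega>\<^esub> \<iota> (\<alpha> i) \<otimes>\<^bsub>\<Omega>\<^esub> jet i u)"
    unfolding p jet_Cons using assms(1) c jet_closed[OF c(3)]
    by (simp only:, subst \<Omega>.finsum_addf) auto
  also have "\<dots> = (\<Oplus>\<^bsub>\<Omega>\<^esub>i\<in>{..<n}. \<iota> (\<alpha> i) \<otimes>\<^bsub>\<Omega>\<^esub> jet i (p # u))"
  proof (rule \<Omega>.add.finprod_cong')
    show "(\<lambda>i. \<iota> (\<alpha> i) \<otimes>\<^bsub>\<Omega>\<^esub> jet i (p # u)) \<in> {..<n} \<rightarrow> carrier \<Omega>"
      using assms(1) c jet_closed[OF c(3)] by (auto simp: p)
  qed (use assms(1) c jet_closed[OF c(3)] in \<open>auto simp: p \<Omega>.r_distr \<Omega>.m_assoc\<close>)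
  finally show ?case .
qed

end

context differential_field
begin

text \<open>If \<open>y\<^sup>(\<^sup>k\<^sup>)\<close> is the combination of the first derivatives of a solution with coefficients \<open>\<alpha>\<close>, these are the
  coefficients of \<open>y\<^sup>(\<^sup>k\<^sup>+\<^sup>1\<^sup>)\<close>: the last summand comes from replacing \<open>y\<^sup>(\<^sup>n\<^sup>)\<close> by means of the equation.\<close>

definition reduction_step :: "nat \<Rightarrow> (nat \<Rightarrow> 'a) \<Rightarrow> (nat \<Rightarrow> 'a) \<Rightarrow> nat \<Rightarrow> 'a"
  where "reduction_step n a \<alpha> i =
    d (\<alpha> i) \<oplus> (if i = 0 then \<zero> else \<alpha> (i - 1)) \<ominus> \<alpha> (n - 1) \<otimes> a i"

lemma derivatives_reduce_0:
  assumes "y \<in> solutions R d (carrier R) n a"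
  shows "y = (\<Oplus>i\<in>{..<n}. (if i = 0 then \<one> else \<zero>) \<otimes> (d ^^ i) y)"
proof (cases n)
  case 0
  thus ?thesis using assms by (auto simp: solutions_def lin_diff_op_def)
next
  case (Suc m)
  have y: "y \<in> carrier R" using assms by (simp add: solutions_def)
  have "(\<Oplus>i\<in>{..<n}. (if i = 0 then \<one> else \<zero>) \<otimes> (d ^^ i) y) =
      (\<Oplus>i\<in>{..<n}. (if 0 = i then (d ^^ i) y else \<zero>))"
    by (rule add.finprod_cong') (use y in auto)
  also have "\<dots> = (d ^^ 0) y" using y Suc by (intro add.finprod_singleton) auto
  finally show ?thesis by simp
qed

lemma derivatives_reduce_Suc:
  assumes a: "\<And>i. i < n \<Longrightarrow> a i \<in> carrier R" and \<alpha>: "\<And>i. i < n \<Longrightarrow> \<alpha> i \<in> carrier R"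
    and y: "y \<in> solutions R d (carrier R) n a"
    and k: "(d ^^ k) y = (\<Oplus>i\<in>{..<n}. \<alpha> i \<otimes> (d ^^ i) y)"
  shows "(d ^^ Suc k) y = (\<Oplus>i\<in>{..<n}. reduction_step n a \<alpha> i \<otimes> (d ^^ i) y)"
proof (cases n)
  case 0
  thus ?thesis using k by simp
next
  case (Suc m)
  have yc: "y \<in> carrier R" using y by (simp add: solutions_def)
  have n: "{..<n} = {..m}" "n - 1 = m" "m < n" using Suc by auto
  have c: "a i \<in> carrier R" "\<alpha> i \<in> carrier R" "d (\<alpha> i) \<in> carrier R" "(d ^^ i) y \<in> carrier R"
    "(d ^^ Suc i) y \<in> carrier R" if "i \<le> m" for i
    using that a \<alpha> Suc yc deriv_closed by auto
  have cm: "\<alpha> m \<in> carrier R" using c by simp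
  define s where "s i = (if i = 0 then \<zero> else \<alpha> (i - 1))" for i :: nat
  have sc: "s i \<in> carrier R" if "i \<le> Suc m" for i using that c(2)[of "i - 1"] by (auto simp: s_def)
  define A B D where "A = (\<Oplus>i\<in>{..m}. a i \<otimes> (d ^^ i) y)" and "B = (\<Oplus>i\<in>{..m}. s i \<otimes> (d ^^ i) y)"
    and "D = (\<Oplus>i\<in>{..m}. d (\<alpha> i) \<otimes> (d ^^ i) y)"
  have ABD: "A \<in> carrier R" "B \<in> carrier R" "D \<in> carrier R"
    unfolding A_def B_def D_def using c sc by (auto intro!: finsum_closed)
  have yn: "(d ^^ Suc m) y \<in> carrier R" using c by blast
  have eq: "(d ^^ Suc m) y \<oplus> A = \<zero>"
    using y n Suc by (simp add: solutions_def lin_diff_op_def A_def)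
  have shift: "(\<Oplus>i\<in>{..m}. \<alpha> i \<otimes> (d ^^ Suc i) y) = \<alpha> m \<otimes> (d ^^ Suc m) y \<oplus> B"
  proof -
    have F: "(\<lambda>i. s i \<otimes> (d ^^ i) y) \<in> {..Suc m} \<rightarrow> carrier R" using sc yc by auto
    have "(\<Oplus>i\<in>{..m}. s (Suc i) \<otimes> (d ^^ Suc i) y) \<oplus> s 0 \<otimes> (d ^^ 0) y = s (Suc m) \<otimes> (d ^^ Suc m) y \<oplus> B"
      unfolding B_def finsum_Suc2[OF F, symmetric] by (rule finsum_Suc[OF F])
    moreover have "(\<Oplus>i\<in>{..m}. s (Suc i) \<otimes> (d ^^ Suc i) y) = (\<Oplus>i\<in>{..m}. \<alpha> i \<otimes> (d ^^ Suc i) y)"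
      by (simp add: s_def)
    moreover have "(\<Oplus>i\<in>{..m}. \<alpha> i \<otimes> (d ^^ Suc i) y) \<in> carrier R"
      using c by (intro finsum_closed) auto
    ultimately show ?thesis using yc by (simp add: s_def)
  qed
  have "(d ^^ Suc k) y = (\<Oplus>i\<in>{..m}. d (\<alpha> i \<otimes> (d ^^ i) y))"
    using k n(1) deriv_finsum[of "{..m}" "\<lambda>i. \<alpha> i \<otimes> (d ^^ i) y"] c by simp
  also have "\<dots> = (\<Oplus>i\<in>{..m}. d (\<alpha> i) \<otimes> (d ^^ i) y \<oplus> \<alpha> i \<otimes> (d ^^ Suc i) y)"
    by (rule add.finprod_cong') (use c deriv_mult in auto)
  also have "\<dots> = D \<oplus> (\<alpha> m \<otimes> (d ^^ Suc m) y \<oplus> B)"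
    unfolding D_def shift[symmetric] using c by (intro finsum_addf) auto
  also have "\<dots> = D \<oplus> B \<ominus> \<alpha> m \<otimes> A"
  proof -
    define w where "w = (d ^^ Suc m) y"
    have "D \<oplus> (\<alpha> m \<otimes> w \<oplus> B) = D \<oplus> B \<ominus> \<alpha> m \<otimes> A \<oplus> \<alpha> m \<otimes> (w \<oplus> A)"
      using ABD cm yn[folded w_def] by algebra
    thus ?thesis using eq ABD cm by (simp add: w_def)
  qed
  also have "\<dots> = (\<Oplus>i\<in>{..m}. reduction_step n a \<alpha> i \<otimes> (d ^^ i) y)"
  proof -
    have "\<alpha> m \<otimes> A = (\<Oplus>i\<in>{..m}. \<alpha> m \<otimes> (a i \<otimes> (d ^^ i) y))"
      unfolding A_def using c cm by (intro finsum_rdistr) auto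
    hence "D \<oplus> B = (\<Oplus>i\<in>{..m}. reduction_step n a \<alpha> i \<otimes> (d ^^ i) y) \<oplus> \<alpha> m \<otimes> A"
    proof -
      have r: "reduction_step n a \<alpha> i \<in> carrier R" if "i \<le> m" for i
        using c[OF that] sc[of i] cm that n(2) by (simp add: reduction_step_def s_def[symmetric])
      have "D \<oplus> B = (\<Oplus>i\<in>{..m}. d (\<alpha> i) \<otimes> (d ^^ i) y \<oplus> s i \<otimes> (d ^^ i) y)"
        unfolding D_def B_def using c sc by (intro finsum_addf[symmetric]) auto
      also have "\<dots> = (\<Oplus>i\<in>{..m}. reduction_step n a \<alpha> i \<otimes> (d ^^ i) y \<oplus> \<alpha> m \<otimes> (a i \<otimes> (d ^^ i) y))"
      proof (rule add.finprod_cong')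
        fix i assume i: "i \<in> {..m}"
        have gen: "p \<otimes> x \<oplus> q \<otimes> x = (p \<oplus> q \<ominus> t \<otimes> b) \<otimes> x \<oplus> t \<otimes> (b \<otimes> x)"
          if "p \<in> carrier R" "q \<in> carrier R" "t \<in> carrier R" "b \<in> carrier R" "x \<in> carrier R"
          for p q t b x
          using that by algebra
        show "d (\<alpha> i) \<otimes> (d ^^ i) y \<oplus> s i \<otimes> (d ^^ i) y =
            reduction_step n a \<alpha> i \<otimes> (d ^^ i) y \<oplus> \<alpha> m \<otimes> (a i \<otimes> (d ^^ i) y)"
          unfolding reduction_step_def s_def[symmetric] n(2)
          by (rule gen) (use c[of i] sc[of i] cm i in auto)
      qed (use c cm r in auto)
      also have "\<dots> = (\<Oplus>i\<in>{..m}. reduction_step n a \<alpha> i \<otimes> (d ^^ i) y) \<oplus> \<alpha> m \<otimes> A"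
        unfolding \<open>\<alpha> m \<otimes> A = _\<close> using c cm r by (intro finsum_addf) auto
      finally show ?thesis .
    qed
    moreover have "(\<Oplus>i\<in>{..m}. reduction_step n a \<alpha> i \<otimes> (d ^^ i) y) \<in> carrier R"
      using c sc cm n(2) by (intro finsum_closed) (auto simp: reduction_step_def s_def[symmetric])
    moreover have "\<alpha> m \<otimes> A \<in> carrier R" using cm ABD by simp
    ultimately show ?thesis by (simp add: minus_eq a_assoc r_neg)
  qed
  finally show ?thesis using n(1) by simp
qed

end

locale partial_diff_hom = R: differential_field R d + S: differential_field S e + partial_hom R S \<Gamma>
  for R :: "('a, 'm) ring_scheme" and d and S :: "('b, 'n) ring_scheme" and e and \<Gamma> +
  assumes deriv: "(x, w) \<in> \<Gamma> \<Longrightarrow> (d x, e w) \<in> \<Gamma>"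
begin

lemma funpow_deriv: "(x, w) \<in> \<Gamma> \<Longrightarrow> ((d ^^ i) x, (e ^^ i) w) \<in> \<Gamma>"
  by (induction i) (auto intro: deriv)

lemma lin_diff_op:
  assumes "\<And>i. i < n \<Longrightarrow> (a i, a' i) \<in> \<Gamma>" "(y, z) \<in> \<Gamma>"
  shows "(lin_diff_op R d n a y, lin_diff_op S e n a' z) \<in> \<Gamma>"
  unfolding lin_diff_op_def using assms by (intro add funpow_deriv finsum mult) auto

text \<open>Differentiating the equation expresses every derivative of a solution by the first \<open>n\<close> ones. The
  recursion for the coefficients only uses the ring operations and the derivation, so running it
  simultaneously on both sides keeps the coefficients related by \<open>\<Gamma>\<close>.\<close>

lemma derivatives_reduce:
  assumes a: "\<And>i. i < n \<Longrightarrow> (a i, a' i) \<in> \<Gamma>"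
  shows "\<exists>\<alpha> \<alpha>'. (\<forall>i<n. (\<alpha> i, \<alpha>' i) \<in> \<Gamma>) \<and>
    (\<forall>y\<in>solutions R d (carrier R) n a. (d ^^ k) y = (\<Oplus>\<^bsub>R\<^esub>i\<in>{..<n}. \<alpha> i \<otimes>\<^bsub>R\<^esub> (d ^^ i) y)) \<and>
    (\<forall>z\<in>solutions S e (carrier S) n a'. (e ^^ k) z = (\<Oplus>\<^bsub>S\<^esub>i\<in>{..<n}. \<alpha>' i \<otimes>\<^bsub>S\<^esub> (e ^^ i) z))"
proof (induction k)
  case 0
  have "((if i = 0 then \<one>\<^bsub>R\<^esub> else \<zero>\<^bsub>R\<^esub>), (if i = 0 then \<one>\<^bsub>S\<^esub> else \<zero>\<^bsub>S\<^esub>)) \<in> \<Gamma>" for i :: nat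
    using one zero by simp
  thus ?case
    using R.derivatives_reduce_0[of _ n a] S.derivatives_reduce_0[of _ n a'] unfolding funpow_0
    by (intro exI[of _ "\<lambda>i. if i = 0 then \<one>\<^bsub>R\<^esub> else \<zero>\<^bsub>R\<^esub>"] exI[of _ "\<lambda>i. if i = 0 then \<one>\<^bsub>S\<^esub> else \<zero>\<^bsub>S\<^esub>"]
        conjI allI impI ballI) blast+
next
  case (Suc k)
  then obtain \<alpha> \<alpha>' where al: "\<forall>i<n. (\<alpha> i, \<alpha>' i) \<in> \<Gamma>"
    "\<forall>y\<in>solutions R d (carrier R) n a. (d ^^ k) y = (\<Oplus>\<^bsub>R\<^esub>i\<in>{..<n}. \<alpha> i \<otimes>\<^bsub>R\<^esub> (d ^^ i) y)"
    "\<forall>z\<in>solutions S e (carrier S) n a'. (e ^^ k) z = (\<Oplus>\<^bsub>S\<^esub>i\<in>{..<n}. \<alpha>' i \<otimes>\<^bsub>S\<^esub> (e ^^ i) z)"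
    by (elim exE conjE)
  have ac: "a i \<in> carrier R" "a' i \<in> carrier S" if "i < n" for i using closed[OF a[OF that]] by auto
  have alc: "\<alpha> i \<in> carrier R" "\<alpha>' i \<in> carrier S" if "i < n" for i using closed al(1) that by blast+
  show ?case
  proof (intro exI conjI allI impI ballI)
    fix i assume i: "i < n"
    have "((if i = 0 then \<zero>\<^bsub>R\<^esub> else \<alpha> (i - 1)), (if i = 0 then \<zero>\<^bsub>S\<^esub> else \<alpha>' (i - 1))) \<in> \<Gamma>"
      using al(1) zero i by simp
    thus "(R.reduction_step n a \<alpha> i, S.reduction_step n a' \<alpha>' i) \<in> \<Gamma>"
      unfolding R.reduction_step_def S.reduction_step_def
      using al(1) a i by (intro minus add mult deriv) auto
  next
    fix y assume y: "y \<in> solutions R d (carrier R) n a"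
    show "(d ^^ Suc k) y = (\<Oplus>\<^bsub>R\<^esub>i\<in>{..<n}. R.reduction_step n a \<alpha> i \<otimes>\<^bsub>R\<^esub> (d ^^ i) y)"
      by (rule R.derivatives_reduce_Suc[OF ac(1) alc(1) y]) (use al(2) y in auto)
  next
    fix z assume z: "z \<in> solutions S e (carrier S) n a'"
    show "(e ^^ Suc k) z = (\<Oplus>\<^bsub>S\<^esub>i\<in>{..<n}. S.reduction_step n a' \<alpha>' i \<otimes>\<^bsub>S\<^esub> (e ^^ i) z)"
      by (rule S.derivatives_reduce_Suc[OF ac(2) alc(2) z]) (use al(3) z in auto)
  qed
qed

end

lemma (in differential_field) Id_partial_diff_hom:
  "partial_diff_hom R d R d (Id_on (carrier R))"
proof -
  interpret partial_hom R R "Id_on (carrier R)"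
    by (rule Id_on_partial_hom[OF carrier_is_subring])
  show ?thesis by unfold_locales (auto simp: deriv_closed)
qed

section \<open>Solution spaces\<close>

context differential_field_into_field
begin

lemma jet_relation_extends:
  assumes "\<And>i. i < n \<Longrightarrow> a i \<in> carrier K" "pairs u" "fst ` set u \<subseteq> solutions K e (carrier K) n a"
    and "\<And>i. i < n \<Longrightarrow> jet i u = \<zero>\<^bsub>\<Omega>\<^esub>"
  shows "jet k u = \<zero>\<^bsub>\<Omega>\<^esub>"
proof -
  interpret I: partial_diff_hom K e K e "Id_on (carrier K)"
    by (rule K.Id_partial_diff_hom)
  have "\<And>i. i < n \<Longrightarrow> (a i, a i) \<in> Id_on (carrier K)" using assms(1) by auto
  hence "\<exists>\<alpha> \<alpha>'. (\<forall>i<n. (\<alpha> i, \<alpha>' i) \<in> Id_on (carrier K)) \<and>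
    (\<forall>y\<in>solutions K e (carrier K) n a. (e ^^ k) y = (\<Oplus>\<^bsub>K\<^esub>i\<in>{..<n}. \<alpha> i \<otimes>\<^bsub>K\<^esub> (e ^^ i) y)) \<and>
    (\<forall>z\<in>solutions K e (carrier K) n a. (e ^^ k) z = (\<Oplus>\<^bsub>K\<^esub>i\<in>{..<n}. \<alpha>' i \<otimes>\<^bsub>K\<^esub> (e ^^ i) z))"
    by (rule I.derivatives_reduce)
  then obtain \<alpha> \<alpha>' where "\<forall>i<n. (\<alpha> i, \<alpha>' i) \<in> Id_on (carrier K)"
    and al2: "\<forall>y\<in>solutions K e (carrier K) n a. (e ^^ k) y = (\<Oplus>\<^bsub>K\<^esub>i\<in>{..<n}. \<alpha> i \<otimes>\<^bsub>K\<^esub> (e ^^ i) y)"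
    by (elim exE conjE)
  hence al: "\<forall>i<n. \<alpha> i \<in> carrier K" by auto
  have "jet k u = (\<Oplus>\<^bsub>\<Omega>\<^esub>i\<in>{..<n}. \<iota> (\<alpha> i) \<otimes>\<^bsub>\<Omega>\<^esub> jet i u)"
    using al al2 assms(3) by (intro jet_linear_combination assms(2)) auto
  also have "\<dots> = (\<Oplus>\<^bsub>\<Omega>\<^esub>i\<in>{..<n}. \<zero>\<^bsub>\<Omega>\<^esub>)"
    by (rule \<Omega>.add.finprod_cong') (use al assms(4) in auto)
  finally show ?thesis by simp
qed

lemma jet_scale_snd:
  assumes "pairs u" "c \<in> carrier \<Omega>"
  shows "jet i (map (apsnd ((\<otimes>\<^bsub>\<Omega>\<^esub>) c)) u) = c \<otimes>\<^bsub>\<Omega>\<^esub> jet i u"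
  using assms(1)
proof (induction u)
  case (Cons p u)
  obtain k b where p: "p = (k, b)" by fastforce
  have "k \<in> carrier K" "b \<in> carrier \<Omega>" "pairs u" "jet i u \<in> carrier \<Omega>" using Cons.prems p by auto
  thus ?case using Cons.IH assms(2) by (simp add: p \<Omega>.r_distr \<Omega>.m_lcomm)
qed (use assms in simp)

text \<open>The \<open>n\<close> columns of jets of \<open>zs\<close> together with the column \<open>t\<close> are \<open>n + 1\<close> vectors in an \<open>n\<close>-dimensional space,
  hence dependent, and \<open>t\<close> takes part in the dependency because the other columns are independent.\<close>

lemma wronskian_system_solvable:
  assumes a: "\<And>i. i < n \<Longrightarrow> a i \<in> carrier K"
    and zs: "length zs = n" "set zs \<subseteq> solutions K e (carrier K) n a"
      "K.independent K.constant_field zs"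
    and t: "\<And>k. k < n \<Longrightarrow> t k \<in> carrier \<Omega>"
  shows "\<exists>xs. length xs = n \<and> set xs \<subseteq> carrier \<Omega> \<and> (\<forall>k<n. jet k (zip zs xs) = t k)"
proof -
  have zc: "set zs \<subseteq> carrier K" using zs(2) by (auto simp: solutions_def)
  hence zn: "zs ! j \<in> carrier K" if "j < n" for j using that zs(1) by auto
  define m where "m k j = (if j < n then \<iota> ((e ^^ k) (zs ! j)) else t k)" for k j
  have mc: "m k j \<in> carrier \<Omega>" if "k < n" for k j using that t zn by (auto simp: m_def)
  obtain x where x: "\<forall>j\<in>{..n}. x j \<in> carrier \<Omega>" "\<exists>j\<in>{..n}. x j \<noteq> \<zero>\<^bsub>\<Omega>\<^esub>"
    "\<forall>k<n. (\<Oplus>\<^bsub>\<Omega>\<^esub>j\<in>{..n}. m k j \<otimes>\<^bsub>\<Omega>\<^esub> x j) = \<zero>\<^bsub>\<Omega>\<^esub>"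
    using \<Omega>.underdetermined_system[of "{..n}" n m] mc by auto
  define xs where "xs = map x [0..<n]"
  have xs: "length xs = n" "set xs \<subseteq> carrier \<Omega>" using x(1) by (auto simp: xs_def)
  define c where "c = x n"
  have c: "c \<in> carrier \<Omega>" using x(1) by (simp add: c_def)
  let ?u = "zip zs xs"
  have pu: "pairs ?u" using zc xs(2) by (auto dest: set_zip_leftD set_zip_rightD)
  have eq: "jet k ?u \<oplus>\<^bsub>\<Omega>\<^esub> c \<otimes>\<^bsub>\<Omega>\<^esub> t k = \<zero>\<^bsub>\<Omega>\<^esub>" if k: "k < n" for k
  proof -
    have "jet k ?u = (\<Oplus>\<^bsub>\<Omega>\<^esub>j\<in>{..<n}. \<iota> ((e ^^ k) (zs ! j)) \<otimes>\<^bsub>\<Omega>\<^esub> xs ! j)"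
      using jet_eq_finsum[of zs xs k] zs(1) xs zc by simp
    also have "\<dots> = (\<Oplus>\<^bsub>\<Omega>\<^esub>j\<in>{..<n}. m k j \<otimes>\<^bsub>\<Omega>\<^esub> x j)"
      by (rule \<Omega>.add.finprod_cong') (use x(1) zn in \<open>auto simp: m_def xs_def\<close>)
    finally have "c \<otimes>\<^bsub>\<Omega>\<^esub> t k \<oplus>\<^bsub>\<Omega>\<^esub> jet k ?u = (\<Oplus>\<^bsub>\<Omega>\<^esub>j\<in>insert n {..<n}. m k j \<otimes>\<^bsub>\<Omega>\<^esub> x j)"
      using x(1) mc[OF k] zn t[OF k] by (subst \<Omega>.finsum_insert) (auto simp: m_def c_def \<Omega>.m_comm)
    moreover have "insert n {..<n} = {..n}" by auto
    ultimately show ?thesis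
      using x(3) k \<Omega>.a_comm[OF jet_closed[OF pu], of "c \<otimes>\<^bsub>\<Omega>\<^esub> t k"] c t by simp
  qed
  have "c \<noteq> \<zero>\<^bsub>\<Omega>\<^esub>"
  proof
    assume c0: "c = \<zero>\<^bsub>\<Omega>\<^esub>"
    have low: "jet k ?u = \<zero>\<^bsub>\<Omega>\<^esub>" if "k < n" for k
      using eq[OF that] jet_closed[OF pu] t[OF that] c0 by simp
    have fs: "map fst ?u = zs" using zs(1) xs(1) by simp
    have "fst ` set ?u = set zs" unfolding set_map[symmetric] fs ..
    hence fsol: "fst ` set ?u \<subseteq> solutions K e (carrier K) n a" using zs(2) by simp
    have "snd ` set ?u \<subseteq> {\<zero>\<^bsub>\<Omega>\<^esub>}"
    proof (rule jet_relation_independent[OF pu])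
      show "K.independent K.constant_field (map fst ?u)" unfolding fs by (rule zs(3))
      show "jet k ?u = \<zero>\<^bsub>\<Omega>\<^esub>" for k by (rule jet_relation_extends[OF a pu fsol low])
    qed
    hence "set xs \<subseteq> {\<zero>\<^bsub>\<Omega>\<^esub>}" using zs(1) xs(1) by (metis map_snd_zip set_map)
    hence "x j = \<zero>\<^bsub>\<Omega>\<^esub>" if "j < n" for j using that by (auto simp: xs_def image_subset_iff)
    thus False using x(2) c0 by (auto simp: c_def le_less)
  qed
  hence q: "inv\<^bsub>\<Omega>\<^esub> c \<in> carrier \<Omega>" "inv\<^bsub>\<Omega>\<^esub> c \<otimes>\<^bsub>\<Omega>\<^esub> c = \<one>\<^bsub>\<Omega>\<^esub>" using c by auto
  define q where "q = \<ominus>\<^bsub>\<Omega>\<^esub> (inv\<^bsub>\<Omega>\<^esub> c)"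
  have qc: "q \<in> carrier \<Omega>" using q by (simp add: q_def)
  define ys where "ys = map ((\<otimes>\<^bsub>\<Omega>\<^esub>) q) xs"
  have zip: "zip zs ys = map (apsnd ((\<otimes>\<^bsub>\<Omega>\<^esub>) q)) ?u"
    unfolding ys_def zip_map2 by (rule map_cong) auto
  have "jet k (zip zs ys) = t k" if k: "k < n" for k
  proof -
    define J where "J = jet k ?u"
    have J: "J \<in> carrier \<Omega>" "J \<oplus>\<^bsub>\<Omega>\<^esub> c \<otimes>\<^bsub>\<Omega>\<^esub> t k = \<zero>\<^bsub>\<Omega>\<^esub>" using jet_closed[OF pu] eq[OF k] by (auto simp: J_def)
    define r where "r = inv\<^bsub>\<Omega>\<^esub> c"
    have r: "r \<in> carrier \<Omega>" "r \<otimes>\<^bsub>\<Omega>\<^esub> c = \<one>\<^bsub>\<Omega>\<^esub>" using q by (auto simp: r_def)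
    have "jet k (zip zs ys) = \<ominus>\<^bsub>\<Omega>\<^esub> r \<otimes>\<^bsub>\<Omega>\<^esub> J"
      unfolding zip using jet_scale_snd[OF pu qc] by (simp add: q_def r_def J_def)
    also have "\<dots> = (r \<otimes>\<^bsub>\<Omega>\<^esub> c) \<otimes>\<^bsub>\<Omega>\<^esub> t k \<ominus>\<^bsub>\<Omega>\<^esub> r \<otimes>\<^bsub>\<Omega>\<^esub> (J \<oplus>\<^bsub>\<Omega>\<^esub> c \<otimes>\<^bsub>\<Omega>\<^esub> t k)"
      using r(1) J(1) c t[OF k] by algebra
    also have "\<dots> = t k" unfolding J(2) r(2) using r t[OF k] by (simp add: \<Omega>.minus_eq)
    finally show ?thesis .
  qed
  moreover have "length ys = n" "set ys \<subseteq> carrier \<Omega>" using xs qc by (auto simp: ys_def)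
  ultimately show ?thesis by blast
qed

end

context differential_field
begin

lemma into_itself: "differential_field_into_field R d R id"
  by unfold_locales (auto simp: ring_hom_def)

text \<open>The jet of an arbitrary solution \<open>y\<close> is a combination, with coefficients in \<open>R\<close>, of the jets of a basis
  of the solutions in \<open>N\<close>. Such a relation forces \<open>y\<close> into the span of the basis over the constants.
  Hence a full set of solutions stays full in every extension without new constants.\<close>

lemma full_solutions_complete:
  assumes a: "\<And>i. i < n \<Longrightarrow> a i \<in> carrier R" and N: "N \<subseteq> carrier R"
    and dim: "dimension n constant_field (solutions R d N n a)"
  shows "solutions R d (carrier R) n a = solutions R d N n a"
proof
  show "solutions R d N n a \<subseteq> solutions R d (carrier R) n a" using N by (auto simp: solutions_def)
  show "solutions R d (carrier R) n a \<subseteq> solutions R d N n a"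
  proof
    interpret J: differential_field_into_field R d R id by (rule into_itself)
    fix y assume y: "y \<in> solutions R d (carrier R) n a"
    hence yc: "y \<in> carrier R" by (auto simp: solutions_def)
    obtain us where us: "set us \<subseteq> carrier R" "independent constant_field us" "length us = n"
      "Span constant_field us = solutions R d N n a"
      using exists_base[OF constant_field_subfield dim] by blast
    have sol: "set us \<subseteq> solutions R d (carrier R) n a"
      using Span_base_incl[OF constant_field_subfield us(1)] us(4) N by (auto simp: solutions_def)
    obtain xs where xs: "length xs = n" "set xs \<subseteq> carrier R"
      "\<forall>k<n. J.jet k (zip us xs) = (d ^^ k) y"
      using J.wronskian_system_solvable[OF a us(3) sol us(2), of "\<lambda>k. (d ^^ k) y"] yc by auto
    let ?u = "(y, \<ominus> \<one>) # zip us xs"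
    have pz: "J.pairs (zip us xs)" using us(1) xs(2) by (auto dest: set_zip_leftD set_zip_rightD)
    have p: "J.pairs ?u" using pz yc a_inv_closed[OF one_closed] by simp
    have lo: "J.jet k ?u = \<zero>" if "k < n" for k
    proof -
      have "J.jet k (zip us xs) = (d ^^ k) y" using xs(3) that by blast
      moreover have "(d ^^ k) y \<in> carrier R" using yc by simp
      ultimately show ?thesis unfolding J.jet_Cons id_apply
        by (simp only: r_minus[OF _ one_closed] r_one l_neg)
    qed
    have fs: "fst ` set ?u \<subseteq> solutions R d (carrier R) n a"
    proof -
      have "map fst (zip us xs) = us" by (rule map_fst_zip) (simp only: us(3) xs(1))
      hence "fst ` set (zip us xs) = set us" by (metis set_map)
      hence "fst ` set ?u = insert y (set us)" by (simp only: list.set image_insert fst_conv)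
      moreover have "insert y (set us) \<subseteq> solutions R d (carrier R) n a" using y sol by simp
      ultimately show ?thesis by (simp only:)
    qed
    have jets: "J.jet k ?u = \<zero>" for k
      by (rule J.jet_relation_extends[OF a p fs lo])
    have "y \<in> Span constant_field us"
    proof (rule ccontr)
      assume "y \<notin> Span constant_field us"
      hence "y \<notin> Span constant_field (map fst (zip us xs))" using us(3) xs(1) by simp
      from J.jet_relation_head[OF yc _ pz this jets] have "\<ominus> \<one> = \<zero>" by simp
      thus False using one_not_zero by (metis minus_minus minus_zero one_closed)
    qed
    thus "y \<in> solutions R d N n a" using us(4) by simp
  qed
qed

end

lemma (in differential_field) wronskian_right_inverse:
  assumes a: "\<And>i. i < n \<Longrightarrow> a i \<in> carrier R"
    and ys: "length ys = n" "set ys \<subseteq> solutions R d (carrier R) n a" "independent constant_field ys"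
  shows "\<exists>v. \<forall>k<n. length (v k) = n \<and> set (v k) \<subseteq> carrier R \<and>
    (\<forall>l<n. (\<Oplus>j\<in>{..<n}. (d ^^ l) (ys ! j) \<otimes> v k ! j) = (if k = l then \<one> else \<zero>))"
proof -
  have "\<exists>xs. length xs = n \<and> set xs \<subseteq> carrier R \<and>
    (\<forall>l<n. (\<Oplus>j\<in>{..<n}. (d ^^ l) (ys ! j) \<otimes> xs ! j) = (if k = l then \<one> else \<zero>))" for k
  proof -
    interpret I: differential_field_into_field R d R id by (rule into_itself)
    have yc: "set ys \<subseteq> carrier R" using ys(2) by (auto simp: solutions_def)
    obtain xs where xs: "length xs = n" "set xs \<subseteq> carrier R"
      "\<forall>l<n. I.jet l (zip ys xs) = (if k = l then \<one> else \<zero>)"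
      using I.wronskian_system_solvable[OF a ys, of "\<lambda>l. if k = l then \<one> else \<zero>"] by fastforce
    show ?thesis
    proof (intro exI[of _ xs] conjI allI impI xs(1,2))
      fix l assume "l < n"
      thus "(\<Oplus>j\<in>{..<n}. (d ^^ l) (ys ! j) \<otimes> xs ! j) = (if k = l then \<one> else \<zero>)"
        using xs(3) I.jet_eq_finsum[of ys xs l] ys(1) xs(1,2) yc by (simp only: id_apply)
    qed
  qed
  thus ?thesis by metis
qed

section \<open>Specializing to the constants\<close>

text \<open>\<open>\<tau>\<close> is a homomorphism of algebras over the constants, from a subring of \<open>\<Omega>\<close> to the constants of \<open>K\<close>. A list
  of triples \<open>(k, b, c)\<close> with \<open>(b, c) \<in> \<tau>\<close> carries a tensor \<open>\<Sum> k \<otimes> b\<close>, whose jets \<open>tjet\<close> lie in \<open>\<Omega>\<close>, together with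
  its specialization \<open>tval\<close>, which is the element \<open>\<Sum> k c\<close> of \<open>K\<close>.\<close>

locale specialization = differential_field_into_field K e \<Omega> \<iota> + \<tau>: partial_hom \<Omega> K \<tau>
  for K :: "('b, 'n) ring_scheme" and e and \<Omega> :: "('c, 'o) ring_scheme" and \<iota> and \<tau> +
  assumes constant_values: "(b, c) \<in> \<tau> \<Longrightarrow> c \<in> K.constant_field"
    and fixes_constants: "c \<in> K.constant_field \<Longrightarrow> (\<iota> c, c) \<in> \<tau>"
begin

abbreviation tensors :: "('b \<times> 'c \<times> 'b) list \<Rightarrow> bool"
  where "tensors u \<equiv> set u \<subseteq> carrier K \<times> \<tau>"

definition tjet :: "nat \<Rightarrow> ('b \<times> 'c \<times> 'b) list \<Rightarrow> 'c"
  where "tjet i = \<Omega>.list_sum (\<lambda>(k, b, c). \<iota> ((e ^^ i) k) \<otimes>\<^bsub>\<Omega>\<^esub> b)"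

definition tval :: "('b \<times> 'c \<times> 'b) list \<Rightarrow> 'b"
  where "tval = K.list_sum (\<lambda>(k, b, c). k \<otimes>\<^bsub>K\<^esub> c)"

lemma tensor_closed:
  "tensors u \<Longrightarrow> (k, b, c) \<in> set u \<Longrightarrow>
    k \<in> carrier K \<and> b \<in> carrier \<Omega> \<and> c \<in> carrier K \<and> (b, c) \<in> \<tau> \<and> c \<in> K.constant_field"
  using \<tau>.closed constant_values by blast

lemma tjet_Nil [simp]: "tjet i [] = \<zero>\<^bsub>\<Omega>\<^esub>" and tval_Nil [simp]: "tval [] = \<zero>\<^bsub>K\<^esub>"
  by (simp_all add: tjet_def tval_def)

lemma tjet_Cons [simp]: "tjet i ((k, b, c) # u) = \<iota> ((e ^^ i) k) \<otimes>\<^bsub>\<Omega>\<^esub> b \<oplus>\<^bsub>\<Omega>\<^esub> tjet i u"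
  and tval_Cons [simp]: "tval ((k, b, c) # u) = k \<otimes>\<^bsub>K\<^esub> c \<oplus>\<^bsub>K\<^esub> tval u"
  by (simp_all add: tjet_def tval_def)

lemma tjet_closed [intro]: "tensors u \<Longrightarrow> tjet i u \<in> carrier \<Omega>"
  and tval_closed [intro]: "tensors u \<Longrightarrow> tval u \<in> carrier K"
  unfolding tjet_def tval_def
  using tensor_closed by (fastforce intro!: \<Omega>.list_sum_closed K.list_sum_closed)+

lemma tjet_append: "tensors (u @ v) \<Longrightarrow> tjet i (u @ v) = tjet i u \<oplus>\<^bsub>\<Omega>\<^esub> tjet i v"
  and tval_append: "tensors (u @ v) \<Longrightarrow> tval (u @ v) = tval u \<oplus>\<^bsub>K\<^esub> tval v"
  unfolding tjet_def tval_def
  using tensor_closed by (fastforce intro!: \<Omega>.list_sum_append K.list_sum_append)+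

lemma tjet_eq_jet: "tjet i u = jet i (map (apsnd fst) u)"
  by (induction u) auto

text \<open>The specialization of a tensor only depends on its jets. If the left factor of the first term is a
  combination of the others over the constants, that term can be merged into them, and \<open>\<tau>\<close> respects
  this because it is linear over the constants; otherwise \<open>jet_relation_head\<close> makes its right factor
  zero.\<close>

lemma tval_well_defined:
  assumes "tensors u" "\<And>i. tjet i u = \<zero>\<^bsub>\<Omega>\<^esub>"
  shows "tval u = \<zero>\<^bsub>K\<^esub>"
  using assms
proof (induction "length u" arbitrary: u)
  case (Suc n)
  then obtain k b c v where u: "u = (k, b, c) # v" by (cases u) auto
  have v: "tensors v" "n = length v" using Suc u by auto
  have kbc: "k \<in> carrier K" "b \<in> carrier \<Omega>" "c \<in> carrier K" "(b, c) \<in> \<tau>"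
    using tensor_closed[OF Suc.prems(1), of k b c] u by auto
  define ks where "ks = map fst v"
  have ks: "set ks \<subseteq> carrier K" using v(1) by (auto simp: ks_def)
  have pv: "pairs (map (apsnd fst) v)"
    using v(1) tensor_closed[OF v(1)] by fastforce
  have fk: "map fst (map (apsnd fst) v) = ks" by (simp add: ks_def)
  show ?case
  proof (cases "k \<in> K.Span K.constant_field ks")
    case False
    have "jet i ((k, b) # map (apsnd fst) v) = \<zero>\<^bsub>\<Omega>\<^esub>" for i
      using Suc.prems(2)[of i] by (simp add: u tjet_eq_jet)
    hence b0: "b = \<zero>\<^bsub>\<Omega>\<^esub>"
      using jet_relation_head[OF kbc(1,2) pv] False fk by simp
    hence "c = \<zero>\<^bsub>K\<^esub>" using kbc(4) \<tau>.zero_unique by blast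
    moreover have "tjet i v = \<zero>\<^bsub>\<Omega>\<^esub>" for i
      using Suc.prems(2)[of i] b0 kbc tjet_closed[OF v(1), of i] by (simp add: u)
    hence "tval v = \<zero>\<^bsub>K\<^esub>" using Suc.hyps(1)[OF v(2,1)] by blast
    ultimately show ?thesis using kbc by (simp add: u)
  next
    case True
    then obtain cs where cs: "set cs \<subseteq> K.constant_field" "length cs = length ks" "k = K.combine cs ks"
      using K.Span_eq_combine_set_length_version[OF K.constant_field_subfield ks] by auto
    define f :: "'b \<Rightarrow> 'b \<times> 'c \<times> 'b \<Rightarrow> 'b \<times> 'c \<times> 'b" where "f = (\<lambda>\<gamma> (k', b', c'). (k', b' \<oplus>\<^bsub>\<Omega>\<^esub> \<iota> \<gamma> \<otimes>\<^bsub>\<Omega>\<^esub> b, c' \<oplus>\<^bsub>K\<^esub> \<gamma> \<otimes>\<^bsub>K\<^esub> c))"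
    have len: "length cs = length v" using cs(2) by (simp add: ks_def)
    have *: "tensors (map2 f cs v) \<and> tjet i (map2 f cs v) = tjet i v \<oplus>\<^bsub>\<Omega>\<^esub> \<iota> ((e ^^ i) (K.combine cs (map fst v))) \<otimes>\<^bsub>\<Omega>\<^esub> b
        \<and> tval (map2 f cs v) = tval v \<oplus>\<^bsub>K\<^esub> K.combine cs (map fst v) \<otimes>\<^bsub>K\<^esub> c" for i
      using len cs(1) v(1)
    proof (induction cs v rule: list_induct2)
      case Nil
      thus ?case using kbc by simp
    next
      case (Cons \<gamma> cs p v)
      obtain k' b' c' where p: "p = (k', b', c')" by (cases p) auto
      have g: "\<gamma> \<in> K.constant_field" "set cs \<subseteq> K.constant_field" "tensors v" using Cons.prems by auto
      have pc: "k' \<in> carrier K" "b' \<in> carrier \<Omega>" "c' \<in> carrier K" "(b', c') \<in> \<tau>"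
        using tensor_closed[OF Cons.prems(2), of k' b' c'] p by auto
      have gc: "\<gamma> \<in> carrier K" "set cs \<subseteq> carrier K" using g K.constant_field_closed by blast+
      have "set (map fst v) \<subseteq> carrier K" using g(3) by auto
      hence s: "K.combine cs (map fst v) \<in> carrier K" using gc by blast
      define x y z where "x = \<iota> \<gamma>" and "y = \<iota> ((e ^^ i) k')" and "z = \<iota> ((e ^^ i) (K.combine cs (map fst v)))"
      have xyz: "x \<in> carrier \<Omega>" "y \<in> carrier \<Omega>" "z \<in> carrier \<Omega>"
        using gc pc s by (auto simp: x_def y_def z_def)
      have e1: "\<iota> ((e ^^ i) (K.combine (\<gamma> # cs) (map fst (p # v)))) = x \<otimes>\<^bsub>\<Omega>\<^esub> y \<oplus>\<^bsub>\<Omega>\<^esub> z"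
        using gc g pc s by (simp add: p K.funpow_add K.funpow_scale x_def y_def z_def)
      define J where "J = tjet i v"
      have J: "J \<in> carrier \<Omega>" unfolding J_def using g(3) by blast
      have "y \<otimes>\<^bsub>\<Omega>\<^esub> (b' \<oplus>\<^bsub>\<Omega>\<^esub> x \<otimes>\<^bsub>\<Omega>\<^esub> b) \<oplus>\<^bsub>\<Omega>\<^esub> (J \<oplus>\<^bsub>\<Omega>\<^esub> z \<otimes>\<^bsub>\<Omega>\<^esub> b) =
          (y \<otimes>\<^bsub>\<Omega>\<^esub> b' \<oplus>\<^bsub>\<Omega>\<^esub> J) \<oplus>\<^bsub>\<Omega>\<^esub> (x \<otimes>\<^bsub>\<Omega>\<^esub> y \<oplus>\<^bsub>\<Omega>\<^esub> z) \<otimes>\<^bsub>\<Omega>\<^esub> b"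
        using xyz pc kbc(2) J by algebra
      moreover define V s where "V = tval v" and "s = K.combine cs (map fst v)"
      moreover have "V \<in> carrier K" "s \<in> carrier K" using g(3) s by (auto simp: V_def s_def)
      then have "k' \<otimes>\<^bsub>K\<^esub> (c' \<oplus>\<^bsub>K\<^esub> \<gamma> \<otimes>\<^bsub>K\<^esub> c) \<oplus>\<^bsub>K\<^esub> (V \<oplus>\<^bsub>K\<^esub> s \<otimes>\<^bsub>K\<^esub> c) =
          (k' \<otimes>\<^bsub>K\<^esub> c' \<oplus>\<^bsub>K\<^esub> V) \<oplus>\<^bsub>K\<^esub> (\<gamma> \<otimes>\<^bsub>K\<^esub> k' \<oplus>\<^bsub>K\<^esub> s) \<otimes>\<^bsub>K\<^esub> c"
        using gc pc kbc(3) by algebra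
      moreover have "(b' \<oplus>\<^bsub>\<Omega>\<^esub> x \<otimes>\<^bsub>\<Omega>\<^esub> b, c' \<oplus>\<^bsub>K\<^esub> \<gamma> \<otimes>\<^bsub>K\<^esub> c) \<in> \<tau>"
        unfolding x_def using pc kbc g fixes_constants by (intro \<tau>.add \<tau>.mult) auto
      moreover have "map2 f (\<gamma> # cs) (p # v) = (k', b' \<oplus>\<^bsub>\<Omega>\<^esub> x \<otimes>\<^bsub>\<Omega>\<^esub> b, c' \<oplus>\<^bsub>K\<^esub> \<gamma> \<otimes>\<^bsub>K\<^esub> c) # map2 f cs v"
        by (simp add: f_def p x_def)
      ultimately show ?case
        using Cons.IH[OF g(2,3)] pc unfolding e1
        by (simp add: p J_def y_def z_def)
    qed
    have j: "tjet i (map2 f cs v) = \<zero>\<^bsub>\<Omega>\<^esub>" for i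
      using *[of i] Suc.prems(2)[of i] \<Omega>.a_comm[OF tjet_closed[OF v(1), of i]] kbc
      by (simp add: u cs(3)[unfolded ks_def, symmetric])
    have "n = length (map2 f cs v)" using len v by simp
    hence "tval (map2 f cs v) = \<zero>\<^bsub>K\<^esub>" using Suc.hyps(1)[of "map2 f cs v"] * j by blast
    thus ?thesis
      using *[of 0] K.a_comm[OF tval_closed[OF v(1)]] kbc
      by (simp add: u cs(3)[unfolded ks_def, symmetric])
  qed
qed simp

definition tmult :: "('b \<times> 'c \<times> 'b) list \<Rightarrow> ('b \<times> 'c \<times> 'b) list \<Rightarrow> ('b \<times> 'c \<times> 'b) list"
  where "tmult u v = concat (map (\<lambda>(k, b, c). map (\<lambda>(k', b', c'). (k \<otimes>\<^bsub>K\<^esub> k', b \<otimes>\<^bsub>\<Omega>\<^esub> b', c \<otimes>\<^bsub>K\<^esub> c')) v) u)"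

lemma tmult_Nil [simp]: "tmult [] v = []"
  by (simp add: tmult_def)

lemma tmult_Cons [simp]:
  "tmult ((k, b, c) # u) v = map (\<lambda>(k', b', c'). (k \<otimes>\<^bsub>K\<^esub> k', b \<otimes>\<^bsub>\<Omega>\<^esub> b', c \<otimes>\<^bsub>K\<^esub> c')) v @ tmult u v"
  by (simp add: tmult_def)

lemma tensors_scale:
  "\<lbrakk>k \<in> carrier K; (b, c) \<in> \<tau>; tensors v\<rbrakk>
    \<Longrightarrow> tensors (map (\<lambda>(k', b', c'). (k \<otimes>\<^bsub>K\<^esub> k', b \<otimes>\<^bsub>\<Omega>\<^esub> b', c \<otimes>\<^bsub>K\<^esub> c')) v)"
  by (induction v) (auto intro: \<tau>.mult)

lemma tensors_tmult: "\<lbrakk>tensors u; tensors v\<rbrakk> \<Longrightarrow> tensors (tmult u v)"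
proof (induction u)
  case (Cons p u)
  obtain k b c where p: "p = (k, b, c)" by (cases p) auto
  show ?case using Cons tensors_scale[of k b c v] by (simp add: p)
qed simp

lemma tensors_deriv: "tensors u \<Longrightarrow> tensors (map (apfst e) u)"
  by (induction u) (auto simp: K.deriv_closed)

lemma tjet_deriv: "tjet i (map (apfst e) u) = tjet (Suc i) u"
  by (induction u) (auto simp: funpow_swap1)

lemma tval_deriv: "tensors u \<Longrightarrow> tval (map (apfst e) u) = e (tval u)"
proof (induction u)
  case (Cons p u)
  obtain k b c where p: "p = (k, b, c)" by (cases p) auto
  have "k \<in> carrier K" "c \<in> carrier K" "e c = \<zero>\<^bsub>K\<^esub>" "tensors u" "tval u \<in> carrier K"
    using Cons.prems tensor_closed[OF Cons.prems, of k b c] K.constant_field_closed(2)[of c] p by auto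
  thus ?case using Cons.IH by (simp add: p K.deriv_add K.deriv_mult K.deriv_closed)
qed simp

lemma tval_tmult: "\<lbrakk>tensors u; tensors v\<rbrakk> \<Longrightarrow> tval (tmult u v) = tval u \<otimes>\<^bsub>K\<^esub> tval v"
proof (induction u)
  case (Cons p u)
  obtain k b c where p: "p = (k, b, c)" by (cases p) auto
  have c: "k \<in> carrier K" "c \<in> carrier K" "(b, c) \<in> \<tau>" "tensors u"
    using Cons.prems tensor_closed[OF Cons.prems(1), of k b c] p by auto
  note V = tval_closed[OF Cons.prems(2)] tval_closed[OF c(4)]
  have "tval (map (\<lambda>(k', b', c'). (k \<otimes>\<^bsub>K\<^esub> k', b \<otimes>\<^bsub>\<Omega>\<^esub> b', c \<otimes>\<^bsub>K\<^esub> c')) v) = k \<otimes>\<^bsub>K\<^esub> c \<otimes>\<^bsub>K\<^esub> tval v"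
    using Cons.prems(2)
  proof (induction v)
    case (Cons q v)
    obtain k' b' c' where q: "q = (k', b', c')" by (cases q) auto
    have "k' \<in> carrier K" "c' \<in> carrier K" "tval v \<in> carrier K" "tensors v"
      using Cons.prems tensor_closed[OF Cons.prems, of k' b' c'] q by auto
    thus ?case using Cons.IH c by (simp add: q K.r_distr K.m_ac)
  qed (use c in simp)
  thus ?case
    using Cons tensors_scale[OF c(1,3) Cons.prems(2)] tensors_tmult[OF c(4) Cons.prems(2)] c V
    by (simp add: p tval_append K.l_distr)
qed (simp add: tval_closed)

lemma tjet_tmult_0: "\<lbrakk>tensors u; tensors v\<rbrakk> \<Longrightarrow> tjet 0 (tmult u v) = tjet 0 u \<otimes>\<^bsub>\<Omega>\<^esub> tjet 0 v"
proof (induction u)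
  case (Cons p u)
  obtain k b c where p: "p = (k, b, c)" by (cases p) auto
  have c: "k \<in> carrier K" "b \<in> carrier \<Omega>" "(b, c) \<in> \<tau>" "tensors u"
    using Cons.prems tensor_closed[OF Cons.prems(1), of k b c] p by auto
  note V = tjet_closed[OF Cons.prems(2), of 0] tjet_closed[OF c(4), of 0]
  have "tjet 0 (map (\<lambda>(k', b', c'). (k \<otimes>\<^bsub>K\<^esub> k', b \<otimes>\<^bsub>\<Omega>\<^esub> b', c \<otimes>\<^bsub>K\<^esub> c')) v) = \<iota> k \<otimes>\<^bsub>\<Omega>\<^esub> b \<otimes>\<^bsub>\<Omega>\<^esub> tjet 0 v"
    using Cons.prems(2)
  proof (induction v)
    case (Cons q v)
    obtain k' b' c' where q: "q = (k', b', c')" by (cases q) auto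
    have "k' \<in> carrier K" "b' \<in> carrier \<Omega>" "tjet 0 v \<in> carrier \<Omega>" "tensors v"
      using Cons.prems tensor_closed[OF Cons.prems, of k' b' c'] q by auto
    thus ?case using Cons.IH c by (simp add: q \<Omega>.r_distr \<Omega>.m_ac)
  qed (use c in simp)
  thus ?case
    using Cons tensors_scale[OF c(1,3) Cons.prems(2)] tensors_tmult[OF c(4) Cons.prems(2)] c V
    by (simp add: p tjet_append \<Omega>.l_distr)
qed (simp add: tjet_closed)

text \<open>The constants on the right are not differentiated, so a product of tensors satisfies the Leibniz
  rule in its left factors alone.\<close>

lemma tjet_tmult_Suc:
  "\<lbrakk>tensors u; tensors v\<rbrakk> \<Longrightarrow> tjet (Suc i) (tmult u v) =
    tjet i (tmult (map (apfst e) u) v) \<oplus>\<^bsub>\<Omega>\<^esub> tjet i (tmult u (map (apfst e) v))"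
proof (induction u)
  case (Cons p u)
  obtain k b c where p: "p = (k, b, c)" by (cases p) auto
  have c: "k \<in> carrier K" "b \<in> carrier \<Omega>" "(b, c) \<in> \<tau>" "tensors u"
    using Cons.prems tensor_closed[OF Cons.prems(1), of k b c] p by auto
  let ?f = "\<lambda>k (k', b', c'). (k \<otimes>\<^bsub>K\<^esub> k', b \<otimes>\<^bsub>\<Omega>\<^esub> b', c \<otimes>\<^bsub>K\<^esub> c')"
  have *: "tjet (Suc i) (map (?f k) v) = tjet i (map (?f (e k)) v) \<oplus>\<^bsub>\<Omega>\<^esub> tjet i (map (?f k) (map (apfst e) v))"
    using Cons.prems(2)
  proof (induction v)
    case (Cons q v)
    obtain k' b' c' where q: "q = (k', b', c')" by (cases q) auto
    have c': "k' \<in> carrier K" "b' \<in> carrier \<Omega>" "tensors v"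
      using Cons.prems tensor_closed[OF Cons.prems, of k' b' c'] q by auto
    have kk: "e k \<otimes>\<^bsub>K\<^esub> k' \<in> carrier K" "k \<otimes>\<^bsub>K\<^esub> e k' \<in> carrier K"
      using c c' K.deriv_closed by auto
    define x y B where "x = \<iota> ((e ^^ i) (e k \<otimes>\<^bsub>K\<^esub> k'))" and "y = \<iota> ((e ^^ i) (k \<otimes>\<^bsub>K\<^esub> e k'))"
      and "B = b \<otimes>\<^bsub>\<Omega>\<^esub> b'"
    define J1 J2 where "J1 = tjet i (map (?f (e k)) v)" and "J2 = tjet i (map (?f k) (map (apfst e) v))"
    have xyB: "x \<in> carrier \<Omega>" "y \<in> carrier \<Omega>" "B \<in> carrier \<Omega>"
      using c c' kk by (auto simp: x_def y_def B_def)
    have J: "J1 \<in> carrier \<Omega>" "J2 \<in> carrier \<Omega>"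
      unfolding J1_def J2_def using c c' K.deriv_closed tensors_deriv
      by (intro tjet_closed tensors_scale; blast)+
    have "(e ^^ Suc i) (k \<otimes>\<^bsub>K\<^esub> k') = (e ^^ i) (e k \<otimes>\<^bsub>K\<^esub> k') \<oplus>\<^bsub>K\<^esub> (e ^^ i) (k \<otimes>\<^bsub>K\<^esub> e k')"
      using c c' kk by (simp add: funpow_swap1 K.deriv_mult K.funpow_add)
    hence "\<iota> ((e ^^ Suc i) (k \<otimes>\<^bsub>K\<^esub> k')) = x \<oplus>\<^bsub>\<Omega>\<^esub> y" using kk by (simp add: x_def y_def)
    moreover have "(x \<oplus>\<^bsub>\<Omega>\<^esub> y) \<otimes>\<^bsub>\<Omega>\<^esub> B \<oplus>\<^bsub>\<Omega>\<^esub> (J1 \<oplus>\<^bsub>\<Omega>\<^esub> J2) = (x \<otimes>\<^bsub>\<Omega>\<^esub> B \<oplus>\<^bsub>\<Omega>\<^esub> J1) \<oplus>\<^bsub>\<Omega>\<^esub> (y \<otimes>\<^bsub>\<Omega>\<^esub> B \<oplus>\<^bsub>\<Omega>\<^esub> J2)"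
      using xyB J by algebra
    ultimately show ?case
      unfolding q list.map apfst_conv split_conv tjet_Cons Cons.IH[OF c'(3)] J1_def J2_def B_def
      by (simp only: x_def y_def)
  qed simp
  define A1 A2 B1 B2 where "A1 = tjet i (map (?f (e k)) v)" and "A2 = tjet i (map (?f k) (map (apfst e) v))"
    and "B1 = tjet i (tmult (map (apfst e) u) v)" and "B2 = tjet i (tmult u (map (apfst e) v))"
  have t: "tensors (map (?f k) v)" "tensors (map (?f (e k)) v)" "tensors (map (?f k) (map (apfst e) v))"
    "tensors (tmult u v)" "tensors (tmult (map (apfst e) u) v)" "tensors (tmult u (map (apfst e) v))"
    using c Cons.prems(2) K.deriv_closed
    by (intro tensors_scale tensors_tmult tensors_deriv; blast)+
  have AB: "A1 \<in> carrier \<Omega>" "A2 \<in> carrier \<Omega>" "B1 \<in> carrier \<Omega>" "B2 \<in> carrier \<Omega>"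
    unfolding A1_def A2_def B1_def B2_def using t by blast+
  have "tjet (Suc i) (tmult (p # u) v) = (A1 \<oplus>\<^bsub>\<Omega>\<^esub> A2) \<oplus>\<^bsub>\<Omega>\<^esub> (B1 \<oplus>\<^bsub>\<Omega>\<^esub> B2)"
    unfolding p tmult_Cons A1_def A2_def B1_def B2_def *[symmetric] Cons.IH[OF c(4) Cons.prems(2), symmetric]
    by (rule tjet_append) (use t in simp)
  also have "\<dots> = (A1 \<oplus>\<^bsub>\<Omega>\<^esub> B1) \<oplus>\<^bsub>\<Omega>\<^esub> (A2 \<oplus>\<^bsub>\<Omega>\<^esub> B2)"
    using AB by algebra
  also have "A1 \<oplus>\<^bsub>\<Omega>\<^esub> B1 = tjet i (tmult (map (apfst e) (p # u)) v)"
    unfolding p list.map apfst_conv tmult_Cons A1_def B1_def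
    by (rule tjet_append[symmetric]) (use t in simp)
  also have "A2 \<oplus>\<^bsub>\<Omega>\<^esub> B2 = tjet i (tmult (p # u) (map (apfst e) v))"
    unfolding p tmult_Cons A2_def B2_def
    by (rule tjet_append[symmetric]) (use t in simp)
  finally show ?case .
qed simp

end

context specialization
begin

text \<open>A homomorphism \<open>\<psi>\<close> of rings from \<open>R\<close> to \<open>\<Omega>\<close> cannot respect derivations. Its descent sends \<open>x\<close> to the
  specialization of a tensor that represents \<open>\<psi>\<close> on all derivatives of \<open>x\<close>, and is a homomorphism of
  differential rings to \<open>K\<close>.\<close>

definition descend :: "('a, 'm) ring_scheme \<Rightarrow> ('a \<Rightarrow> 'a) \<Rightarrow> ('a \<times> 'c) set \<Rightarrow> ('a \<times> 'b) set"
  where "descend R d \<psi> = {(x, tval u) |x u. x \<in> carrier R \<and> tensors u \<and>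
    (\<forall>i. ((d ^^ i) x, tjet i u) \<in> \<psi>)}"

lemma descend_mem:
  "\<lbrakk>x \<in> carrier R; tensors u; \<And>i. ((d ^^ i) x, tjet i u) \<in> \<psi>\<rbrakk> \<Longrightarrow> (x, tval u) \<in> descend R d \<psi>"
  unfolding descend_def by blast

lemma descendE:
  assumes "(x, w) \<in> descend R d \<psi>"
  obtains u where "x \<in> carrier R" "tensors u" "w = tval u" "\<forall>i. ((d ^^ i) x, tjet i u) \<in> \<psi>"
  using assms unfolding descend_def by blast

lemma descend_scalar:
  assumes "partial_hom R \<Omega> \<psi>" "partial_diff_hom R d K e \<Gamma>" "(x, w) \<in> \<Gamma>"
    and "\<And>x w. (x, w) \<in> \<Gamma> \<Longrightarrow> (x, \<iota> w) \<in> \<psi>"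
  shows "(x, w) \<in> descend R d \<psi>"
proof -
  interpret G: partial_diff_hom R d K e \<Gamma> by fact
  note c = G.closed[OF assms(3)]
  let ?u = "[(w, \<one>\<^bsub>\<Omega>\<^esub>, \<one>\<^bsub>K\<^esub>)]"
  have "tensors ?u" using c \<tau>.one by auto
  moreover have "((d ^^ i) x, tjet i ?u) \<in> \<psi>" for i
    using assms(4)[OF G.funpow_deriv[OF assms(3)], of i] c by simp
  ultimately have "(x, tval ?u) \<in> descend R d \<psi>" using c by (intro descend_mem)
  thus ?thesis using c by simp
qed

lemma descend_leibniz:
  assumes "partial_hom R \<Omega> \<psi>" "differential_field R d"
    and "x \<in> carrier R" "tensors u" "\<And>i. ((d ^^ i) x, tjet i u) \<in> \<psi>"
    and "y \<in> carrier R" "tensors v" "\<And>i. ((d ^^ i) y, tjet i v) \<in> \<psi>"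
  shows "((d ^^ i) (x \<otimes>\<^bsub>R\<^esub> y), tjet i (tmult u v)) \<in> \<psi>"
  using assms(3-8)
proof (induction i arbitrary: x u y v)
  interpret R: differential_field R d by fact
  interpret \<psi>: partial_hom R \<Omega> \<psi> by fact
  {
    case 0
    show ?case using \<psi>.mult[OF 0(3)[of 0] 0(6)[of 0]] tjet_tmult_0[OF 0(2,5)] by simp
  next
    case (Suc i)
    have x': "((d ^^ j) (d x), tjet j (map (apfst e) u)) \<in> \<psi>" for j
      using Suc.prems(3)[of "Suc j"] by (simp add: tjet_deriv funpow_swap1)
    have y': "((d ^^ j) (d y), tjet j (map (apfst e) v)) \<in> \<psi>" for j
      using Suc.prems(6)[of "Suc j"] by (simp add: tjet_deriv funpow_swap1)
    have c: "d x \<in> carrier R" "d y \<in> carrier R" using Suc.prems R.deriv_closed by auto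
    have "((d ^^ i) (d x \<otimes>\<^bsub>R\<^esub> y), tjet i (tmult (map (apfst e) u) v)) \<in> \<psi>"
      by (rule Suc.IH[OF c(1) tensors_deriv[OF Suc.prems(2)] x' Suc.prems(4-6)])
    moreover have "((d ^^ i) (x \<otimes>\<^bsub>R\<^esub> d y), tjet i (tmult u (map (apfst e) v))) \<in> \<psi>"
      by (rule Suc.IH[OF Suc.prems(1-3) c(2) tensors_deriv[OF Suc.prems(5)] y'])
    moreover have "(d ^^ Suc i) (x \<otimes>\<^bsub>R\<^esub> y) = (d ^^ i) (d x \<otimes>\<^bsub>R\<^esub> y) \<oplus>\<^bsub>R\<^esub> (d ^^ i) (x \<otimes>\<^bsub>R\<^esub> d y)"
      using Suc.prems(1,4) c by (simp add: funpow_swap1 R.deriv_mult R.funpow_add)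
    ultimately show ?case
      unfolding tjet_tmult_Suc[OF Suc.prems(2,5)] using \<psi>.add by metis
  }
qed

text \<open>Single-valuedness is \<open>tval_well_defined\<close>: a tensor that represents \<open>\<psi>\<close> on the derivatives of \<open>0\<close> has
  vanishing jets. The derivation of \<open>R\<close> shifts jets by one and matches that of \<open>K\<close> since \<open>\<tau>\<close> has
  constant values.\<close>

lemma descend_partial_diff_hom:
  assumes "partial_hom R \<Omega> \<psi>" "differential_field R d" "partial_diff_hom R d K e \<Gamma>"
    and incl: "\<And>x w. (x, w) \<in> \<Gamma> \<Longrightarrow> (x, \<iota> w) \<in> \<psi>"
  shows "partial_diff_hom R d K e (descend R d \<psi>)" and "\<Gamma> \<subseteq> descend R d \<psi>"
proof -
  interpret R: differential_field R d by fact
  interpret \<psi>: partial_hom R \<Omega> \<psi> by fact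
  interpret G: partial_diff_hom R d K e \<Gamma> by fact
  let ?X = "descend R d \<psi>"
  show incl': "\<Gamma> \<subseteq> ?X" using descend_scalar[OF assms(1,3) _ incl] by auto
  have mult: "(x \<otimes>\<^bsub>R\<^esub> y, w \<otimes>\<^bsub>K\<^esub> v) \<in> ?X" if mem: "(x, w) \<in> ?X" "(y, v) \<in> ?X" for x w y v
  proof -
    obtain u1 where 1: "x \<in> carrier R" "tensors u1" "w = tval u1" "\<forall>i. ((d ^^ i) x, tjet i u1) \<in> \<psi>"
      using mem(1) by (rule descendE)
    obtain u2 where 2: "y \<in> carrier R" "tensors u2" "v = tval u2" "\<forall>i. ((d ^^ i) y, tjet i u2) \<in> \<psi>"
      using mem(2) by (rule descendE)
    have "(x \<otimes>\<^bsub>R\<^esub> y, tval (tmult u1 u2)) \<in> ?X"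
      using 1(1) 2(1) tensors_tmult[OF 1(2) 2(2)]
        descend_leibniz[OF assms(1,2) 1(1,2) spec[OF 1(4)] 2(1,2) spec[OF 2(4)]]
      by (intro descend_mem) auto
    thus ?thesis using tval_tmult[OF 1(2) 2(2)] 1(3) 2(3) by simp
  qed
  have closed: "x \<in> carrier R \<and> w \<in> carrier K" if "(x, w) \<in> ?X" for x w
    using that tval_closed unfolding descend_def by blast
  show "partial_diff_hom R d K e ?X"
  proof unfold_locales
    show "?X \<subseteq> carrier R \<times> carrier K" using closed by auto
    show "(\<one>\<^bsub>R\<^esub>, \<one>\<^bsub>K\<^esub>) \<in> ?X" using incl' G.one by blast
    show "(x \<otimes>\<^bsub>R\<^esub> y, w \<otimes>\<^bsub>K\<^esub> v) \<in> ?X" if "(x, w) \<in> ?X" "(y, v) \<in> ?X" for x w y v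
      using that by (rule mult)
    show "(\<ominus>\<^bsub>R\<^esub> x, \<ominus>\<^bsub>K\<^esub> w) \<in> ?X" if "(x, w) \<in> ?X" for x w
    proof -
      have "(\<ominus>\<^bsub>R\<^esub> \<one>\<^bsub>R\<^esub>, \<ominus>\<^bsub>K\<^esub> \<one>\<^bsub>K\<^esub>) \<in> ?X" using incl' G.uminus[OF G.one] by blast
      from mult[OF this that] show ?thesis using closed[OF that] by (simp add: R.l_minus K.l_minus)
    qed
    show "w = \<zero>\<^bsub>K\<^esub>" if mem: "(\<zero>\<^bsub>R\<^esub>, w) \<in> ?X" for w
    proof -
      obtain u where u: "tensors u" "w = tval u" "\<forall>i. ((d ^^ i) \<zero>\<^bsub>R\<^esub>, tjet i u) \<in> \<psi>"
        using mem by (rule descendE)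
      have "tjet i u = \<zero>\<^bsub>\<Omega>\<^esub>" for i
        using spec[OF u(3), of i] by (simp add: \<psi>.zero_unique)
      thus ?thesis using tval_well_defined[OF u(1)] u(2) by blast
    qed
    fix x w assume "(x, w) \<in> ?X"
    then obtain u1 where 1: "x \<in> carrier R" "tensors u1" "w = tval u1" "\<forall>i. ((d ^^ i) x, tjet i u1) \<in> \<psi>"
      by (rule descendE)
    have "(d x, tval (map (apfst e) u1)) \<in> ?X"
    proof (rule descend_mem)
      fix i show "((d ^^ i) (d x), tjet i (map (apfst e) u1)) \<in> \<psi>"
        using spec[OF 1(4), of "Suc i"] by (simp add: tjet_deriv funpow_swap1)
    qed (use 1 R.deriv_closed tensors_deriv in auto)
    thus "(d x, e w) \<in> ?X" using tval_deriv 1 by simp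
    fix y v assume "(y, v) \<in> ?X"
    then obtain u2 where 2: "y \<in> carrier R" "tensors u2" "v = tval u2" "\<forall>i. ((d ^^ i) y, tjet i u2) \<in> \<psi>"
      by (rule descendE)
    have t: "tensors (u1 @ u2)" using 1 2 by simp
    have "(x \<oplus>\<^bsub>R\<^esub> y, tval (u1 @ u2)) \<in> ?X"
    proof (rule descend_mem)
      fix i show "((d ^^ i) (x \<oplus>\<^bsub>R\<^esub> y), tjet i (u1 @ u2)) \<in> \<psi>"
        using \<psi>.add[OF spec[OF 1(4)] spec[OF 2(4)], of i i] 1 2 t by (simp add: tjet_append R.funpow_add)
    qed (use 1 2 t in auto)
    thus "(x \<oplus>\<^bsub>R\<^esub> y, w \<oplus>\<^bsub>K\<^esub> v) \<in> ?X" using tval_append[OF t] 1 2 by simp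
  qed
qed

lemma zip_tensors:
  assumes "set zs \<subseteq> carrier K" "list_all2 (\<lambda>b c. (b, c) \<in> \<tau>) bs cs" "length zs = length bs"
  shows "tensors (zip zs (zip bs cs))"
    and "tjet i (zip zs (zip bs cs)) = jet i (zip zs bs)"
proof -
  have "tensors (zip zs (zip bs cs)) \<and> tjet i (zip zs (zip bs cs)) = jet i (zip zs bs)"
    using assms(2,1,3)
  proof (induction bs cs arbitrary: zs rule: list_all2_induct)
    case (Cons b bs c cs)
    then obtain z zs' where zs: "zs = z # zs'" by (cases zs) auto
    have "z \<in> carrier K" "c \<in> carrier K" using Cons.prems zs \<tau>.closed[OF Cons.hyps(1)] by auto
    thus ?case using Cons.IH[of zs'] Cons.prems Cons.hyps(1) zs by simp
  qed simp
  thus "tensors (zip zs (zip bs cs))" "tjet i (zip zs (zip bs cs)) = jet i (zip zs bs)" by auto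
qed

lemma tensor_combination:
  assumes "list_all2 (\<lambda>b c. (b, c) \<in> \<tau>) bs cs" "length us = length bs" "\<And>u. u \<in> set us \<Longrightarrow> tensors u"
  shows "\<exists>t. tensors t \<and> fst ` set t \<subseteq> fst ` \<Union>(set ` set us) \<and> tval t = K.combine cs (map tval us) \<and>
    (\<forall>i. tjet i t = (\<Oplus>\<^bsub>\<Omega>\<^esub>j\<in>{..<length bs}. tjet i (us ! j) \<otimes>\<^bsub>\<Omega>\<^esub> bs ! j))"
  using assms
proof (induction bs cs arbitrary: us rule: list_all2_induct)
  case Nil
  show ?case by (intro exI[of _ "[]"]) (use Nil in auto)
next
  case (Cons b bs c cs)
  then obtain u us' where us: "us = u # us'" by (cases us) auto
  obtain t where t: "tensors t" "fst ` set t \<subseteq> fst ` \<Union>(set ` set us')" "tval t = K.combine cs (map tval us')"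
    "\<And>i. tjet i t = (\<Oplus>\<^bsub>\<Omega>\<^esub>j\<in>{..<length bs}. tjet i (us' ! j) \<otimes>\<^bsub>\<Omega>\<^esub> bs ! j)"
    using Cons.IH[of us'] Cons.prems us by auto
  have u: "tensors u" using Cons.prems us by auto
  note bc = \<tau>.closed[OF Cons.hyps(1)]
  let ?m = "\<lambda>(k, b', c'). (k, b' \<otimes>\<^bsub>\<Omega>\<^esub> b, c' \<otimes>\<^bsub>K\<^esub> c)"
  have m: "tensors (map ?m u) \<and> fst ` set (map ?m u) = fst ` set u \<and> tval (map ?m u) = tval u \<otimes>\<^bsub>K\<^esub> c
      \<and> tjet i (map ?m u) = tjet i u \<otimes>\<^bsub>\<Omega>\<^esub> b" for i
    using u
  proof (induction u)
    case (Cons p u)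
    obtain k b' c' where p: "p = (k, b', c')" by (cases p) auto
    have k: "k \<in> carrier K" "b' \<in> carrier \<Omega>" "c' \<in> carrier K" "(b', c') \<in> \<tau>" "tensors u"
      using Cons.prems tensor_closed[OF Cons.prems, of k b' c'] p by auto
    thus ?case using Cons.IH bc \<tau>.mult[OF k(4) \<open>(b, c) \<in> \<tau>\<close>] tval_closed[OF k(5)] tjet_closed[OF k(5), of i]
      by (simp add: p K.l_distr \<Omega>.l_distr K.m_assoc \<Omega>.m_assoc)
  qed (use bc in simp)
  have tt: "tensors (map ?m u @ t)" using m[of 0] t(1) by simp
  have bs: "set bs \<subseteq> carrier \<Omega>" using Cons.hyps(2)
    by (induction rule: list_all2_induct) (auto dest: \<tau>.closed)
  have len: "length us' = length bs" using Cons.prems us by simp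
  have tj: "tjet i (us' ! j) \<otimes>\<^bsub>\<Omega>\<^esub> bs ! j \<in> carrier \<Omega>" if "j < length bs" for i j
    using that len bs Cons.prems(2) us tjet_closed by (intro \<Omega>.m_closed) auto
  show ?case
  proof (intro exI[of _ "map ?m u @ t"] conjI allI)
    show "tensors (map ?m u @ t)" by (rule tt)
    show "fst ` set (map ?m u @ t) \<subseteq> fst ` \<Union>(set ` set us)"
      using m[of 0] t(2) unfolding us set_append image_Un list.set image_insert Union_insert by blast
    show "tval (map ?m u @ t) = K.combine (c # cs) (map tval us)"
      using tval_append[OF tt] m[of 0] t(3) us bc tval_closed[OF u] by (simp add: K.m_comm)
    fix i
    have "(\<Oplus>\<^bsub>\<Omega>\<^esub>j\<in>{..<length (b # bs)}. tjet i (us ! j) \<otimes>\<^bsub>\<Omega>\<^esub> (b # bs) ! j) =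
        (\<Oplus>\<^bsub>\<Omega>\<^esub>j\<in>insert 0 (Suc ` {..<length bs}). tjet i (us ! j) \<otimes>\<^bsub>\<Omega>\<^esub> (b # bs) ! j)"
      by (simp add: lessThan_Suc_eq_insert_0)
    also have "\<dots> = tjet i u \<otimes>\<^bsub>\<Omega>\<^esub> b \<oplus>\<^bsub>\<Omega>\<^esub> (\<Oplus>\<^bsub>\<Omega>\<^esub>j\<in>Suc ` {..<length bs}. tjet i (us ! j) \<otimes>\<^bsub>\<Omega>\<^esub> (b # bs) ! j)"
      using bc tjet_closed[OF u] tj by (subst \<Omega>.finsum_insert) (auto simp: us)
    also have "(\<Oplus>\<^bsub>\<Omega>\<^esub>j\<in>Suc ` {..<length bs}. tjet i (us ! j) \<otimes>\<^bsub>\<Omega>\<^esub> (b # bs) ! j) = tjet i t"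
      unfolding t(4) using tj by (subst \<Omega>.add.finprod_reindex) (auto simp: us)
    finally show "tjet i (map ?m u @ t) = (\<Oplus>\<^bsub>\<Omega>\<^esub>j\<in>{..<length (b # bs)}. tjet i (us ! j) \<otimes>\<^bsub>\<Omega>\<^esub> (b # bs) ! j)"
      using tjet_append[OF tt] m[of i] by simp
  qed
qed

end

section \<open>Mapping the solutions of one equation\<close>

text \<open>The starting point of a specialization: identify the copy of the constants in \<open>\<Omega>\<close> with the constants.\<close>

lemma constant_graph:
  assumes "subfield C S" "field S" "field \<Omega>" "\<iota> \<in> ring_hom S \<Omega>"
  shows "partial_hom \<Omega> (S\<lparr>carrier := C\<rparr>) {(\<iota> c, c) |c. c \<in> C}" (is ?ph)
    and "subfield (Domain {(\<iota> c, c) |c. c \<in> C}) \<Omega>" (is ?sf)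
proof -
  let ?S = "S\<lparr>carrier := C\<rparr>"
  interpret S: field S by fact
  interpret \<Omega>: field \<Omega> by fact
  interpret h: ring_hom_cring S \<Omega> \<iota> by unfold_locales (rule assms(4))
  have C: "C \<subseteq> carrier S" using subfieldE(3)[OF assms(1)] .
  interpret S': field ?S using S.subfield_iff(2)[OF assms(1)] .
  have hom: "\<iota> \<in> ring_hom ?S \<Omega>" using C h.hom_closed by (auto simp: ring_hom_def subset_iff)
  interpret I: partial_hom ?S ?S "Id_on C"
    using S'.Id_on_partial_hom[OF S'.carrier_is_subring] by simp
  have nz: "x = \<zero>\<^bsub>?S\<^esub>" if x: "(x, \<zero>\<^bsub>\<Omega>\<^esub>) \<in> {(x, \<iota> w) |x w. (x, w) \<in> Id_on C}" for x
  proof (rule ccontr)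
    assume n: "x \<noteq> \<zero>\<^bsub>?S\<^esub>"
    have xc: "x \<in> carrier S" "\<iota> x = \<zero>\<^bsub>\<Omega>\<^esub>" "x \<noteq> \<zero>\<^bsub>S\<^esub>" using x C n by auto
    have "\<iota> (x \<otimes>\<^bsub>S\<^esub> inv\<^bsub>S\<^esub> x) = \<zero>\<^bsub>\<Omega>\<^esub>" using xc S.nonzero_inverse(1)[OF xc(1,3)] by (simp del: S.nonzero_inverse)
    thus False using xc by simp
  qed
  have "partial_hom \<Omega> ?S ({(x, \<iota> w) |x w. (x, w) \<in> Id_on C}\<inverse>)"
    by (rule partial_hom_converse[OF I.compose_ring_hom[OF assms(3) hom] nz])
  moreover have "{(x, \<iota> w) |x w. (x, w) \<in> Id_on C}\<inverse> = {(\<iota> c, c) |c. c \<in> C}" by auto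
  ultimately show ?ph by simp
  have "Domain {(\<iota> c, c) |c. c \<in> C} = \<iota> ` C" by auto
  moreover have "subfield (\<iota> ` C) \<Omega>"
  proof -
    have "ring_hom_ring S \<Omega> \<iota>" by unfold_locales (rule assms(4))
    thus ?thesis
      using ring_hom_ring.img_is_subfield(2)[OF _ assms(1) \<Omega>.one_not_zero] by blast
  qed
  ultimately show ?sf by simp
qed

text \<open>Let \<open>Y\<close> and \<open>Z\<close> be the Wronskian matrices of \<open>ys\<close> and \<open>zs\<close>. Forgetting derivations, \<open>\<Gamma>\<close> extends to a
  homomorphism \<open>\<psi>\<close> from the ring generated by the entries of \<open>Y\<close> and of its inverse into the algebraic
  closure \<open>\<Omega>\<close> of \<open>S\<close>. Then \<open>\<psi>(Y) = Z c\<close> for an invertible matrix \<open>c\<close> over \<open>\<Omega>\<close>. A true differential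
  homomorphism needs constant entries: specialize the entries of \<open>c\<close> and of its inverse by some \<open>\<tau>\<close> to
  constants of \<open>S\<close>. The descent of \<open>\<psi>\<close> along \<open>\<tau>\<close> maps \<open>Y\<close> to \<open>Z \<tau>(c)\<close>, and the invertibility of \<open>\<tau>(c)\<close> is the
  assertion about spans.\<close>

lemma (in partial_diff_hom) extend_to_solutions:
  assumes E: "subfield (Domain \<Gamma>) R"
    and a: "\<And>i. i < n \<Longrightarrow> (a i, a' i) \<in> \<Gamma>"
    and ys: "length ys = n" "set ys \<subseteq> solutions R d (carrier R) n a"
      "R.independent R.constant_field ys"
    and zs: "length zs = n" "set zs \<subseteq> solutions S e (carrier S) n a'"
      "S.independent S.constant_field zs"
    and rc: "root_closed (S\<lparr>carrier := S.constant_field\<rparr>)"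
  shows "\<exists>\<chi> ws. partial_diff_hom R d S e \<chi> \<and> \<Gamma> \<subseteq> \<chi> \<and> list_all2 (\<lambda>y w. (y, w) \<in> \<chi>) ys ws \<and>
    set zs \<subseteq> S.Span S.constant_field ws"
proof -
  obtain \<Omega> :: "((('b list \<times> nat) multiset) \<Rightarrow> 'b) ring"
    where \<Omega>: "algebraic_closure \<Omega> (S.indexed_const ` carrier S)" "S.indexed_const \<in> ring_hom S \<Omega>"
    by (rule S.exists_closure)
  define \<iota> :: "'b \<Rightarrow> ('b list \<times> nat) multiset \<Rightarrow> 'b" where "\<iota> = S.indexed_const"
  interpret \<Omega>: algebraic_closure \<Omega> "S.indexed_const ` carrier S" by (rule \<Omega>(1))
  have fO: "field \<Omega>" by unfold_locales
  have "algebraically_closed \<Omega>" by unfold_locales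
  hence rcO: "root_closed \<Omega>" by (rule algebraically_closed_root_closed)
  have hom: "\<iota> \<in> ring_hom S \<Omega>" using \<Omega>(2) by (simp add: \<iota>_def)
  interpret J: differential_field_into_field S e \<Omega> \<iota> by unfold_locales (rule hom)
  have ysc: "set ys \<subseteq> carrier R" and zsc: "set zs \<subseteq> carrier S"
    using ys(2) zs(2) by (auto simp: solutions_def)
  have yc: "ys ! j \<in> carrier R" and zc: "zs ! j \<in> carrier S" if "j < n" for j
    using that ysc zsc ys(1) zs(1) by auto
  have ac: "a i \<in> carrier R" and ac': "a' i \<in> carrier S" if "i < n" for i
    using closed[OF a[OF that]] by auto
  obtain v where v: "\<And>k. k < n \<Longrightarrow> length (v k) = n" "\<And>k. k < n \<Longrightarrow> set (v k) \<subseteq> carrier R"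
    "\<And>k l. \<lbrakk>k < n; l < n\<rbrakk> \<Longrightarrow>
      (\<Oplus>\<^bsub>R\<^esub>j\<in>{..<n}. (d ^^ l) (ys ! j) \<otimes>\<^bsub>R\<^esub> v k ! j) = (if k = l then \<one>\<^bsub>R\<^esub> else \<zero>\<^bsub>R\<^esub>)"
    using R.wronskian_right_inverse[OF ac ys] by blast
  define \<Gamma>0 where "\<Gamma>0 = {(x, \<iota> w) |x w. (x, w) \<in> \<Gamma>}"
  have ph0: "partial_hom R \<Omega> \<Gamma>0" unfolding \<Gamma>0_def by (rule compose_ring_hom[OF fO hom])
  have "Domain \<Gamma>0 = Domain \<Gamma>" by (auto simp: \<Gamma>0_def)
  hence E0: "subfield (Domain \<Gamma>0) R" using E by simp
  \<comment> \<open>the entries of \<open>Y\<close> and those of its inverse, whose columns are the \<open>v k\<close>\<close>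
  define gens where "gens = concat (map (\<lambda>y. map (\<lambda>k. (d ^^ k) y) [0..<n]) ys) @ concat (map v [0..<n])"
  have gensc: "set gens \<subseteq> carrier R"
    using ysc v(2) R.funpow_closed by (fastforce simp: gens_def)
  obtain \<psi> where \<psi>: "partial_hom R \<Omega> \<psi>" "\<Gamma>0 \<subseteq> \<psi>" "set gens \<subseteq> Domain \<psi>"
    using extension_from_subfield[OF ph0 E0 gensc rcO] by (elim exE conjE)
  interpret \<psi>: partial_hom R \<Omega> \<psi> by (rule \<psi>(1))
  have "(d ^^ k) (ys ! j) \<in> set gens" if "j < n" "k < n" for j k
  proof -
    have "ys ! j \<in> set ys" using that ys(1) by simp
    thus ?thesis using that unfolding gens_def by fastforce
  qed
  hence "(d ^^ k) (ys ! j) \<in> Domain \<psi>" if "j < n" "k < n" for j k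
    using subsetD[OF \<psi>(3)] that by simp
  hence dom1: "\<exists>w. ((d ^^ k) (ys ! j), w) \<in> \<psi>" if "j < n" "k < n" for j k
    using that by (simp add: Domain_iff)
  define \<eta> where "\<eta> k j = (SOME w. ((d ^^ k) (ys ! j), w) \<in> \<psi>)" for k j
  have eta: "((d ^^ k) (ys ! j), \<eta> k j) \<in> \<psi>" if "j < n" "k < n" for j k
    unfolding \<eta>_def by (rule someI_ex[OF dom1[OF that]])
  have "v k ! j \<in> set gens" if "j < n" "k < n" for j k
  proof -
    have "v k ! j \<in> set (v k)" using that v(1)[of k] by simp
    thus ?thesis using that by (auto simp: gens_def)
  qed
  hence "v k ! j \<in> Domain \<psi>" if "j < n" "k < n" for j k
    using subsetD[OF \<psi>(3)] that by simp
  hence dom2: "\<exists>w. (v k ! j, w) \<in> \<psi>" if "j < n" "k < n" for j k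
    using that by (simp add: Domain_iff)
  define \<xi> where "\<xi> k j = (SOME w. (v k ! j, w) \<in> \<psi>)" for k j
  have xi: "(v k ! j, \<xi> k j) \<in> \<psi>" if "j < n" "k < n" for j k
    unfolding \<xi>_def by (rule someI_ex[OF dom2[OF that]])
  have etac: "\<eta> k j \<in> carrier \<Omega>" and xic: "\<xi> k j \<in> carrier \<Omega>" if "j < n" "k < n" for j k
    using \<psi>.closed(2) eta[OF that] xi[OF that] by blast+
  \<comment> \<open>\<open>c j\<close> is the \<open>j\<close>-th column of the matrix \<open>c\<close> with \<open>\<psi>(Y) = Z c\<close>\<close>
  have "\<exists>xs. length xs = n \<and> set xs \<subseteq> carrier \<Omega> \<and> (\<forall>k<n. J.jet k (zip zs xs) = \<eta> k j)" if "j < n" for j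
    by (rule J.wronskian_system_solvable[OF ac' zs etac]) (use that in auto)
  then obtain c where c: "\<And>j. j < n \<Longrightarrow> length (c j) = n" "\<And>j. j < n \<Longrightarrow> set (c j) \<subseteq> carrier \<Omega>"
    "\<And>j k. \<lbrakk>j < n; k < n\<rbrakk> \<Longrightarrow> J.jet k (zip zs (c j)) = \<eta> k j" by metis
  have pz: "J.pairs (zip zs (c j))" if "j < n" for j
    using zsc c(2)[OF that] by (auto dest: set_zip_leftD set_zip_rightD)
  \<comment> \<open>\<open>\<psi>(Y) = Z c\<close> only compares the first \<open>n\<close> derivatives; the equation extends this to all of them\<close>
  have JC: "((d ^^ k) (ys ! j), J.jet k (zip zs (c j))) \<in> \<psi>" if j: "j < n" for j k
  proof -
    obtain \<alpha> \<alpha>' where al: "\<forall>i<n. (\<alpha> i, \<alpha>' i) \<in> \<Gamma>"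
      "\<forall>y\<in>solutions R d (carrier R) n a. (d ^^ k) y = (\<Oplus>\<^bsub>R\<^esub>i\<in>{..<n}. \<alpha> i \<otimes>\<^bsub>R\<^esub> (d ^^ i) y)"
      "\<forall>z\<in>solutions S e (carrier S) n a'. (e ^^ k) z = (\<Oplus>\<^bsub>S\<^esub>i\<in>{..<n}. \<alpha>' i \<otimes>\<^bsub>S\<^esub> (e ^^ i) z)"
      by atomize_elim (rule derivatives_reduce, rule a)
    have e1: "(d ^^ k) (ys ! j) = (\<Oplus>\<^bsub>R\<^esub>i\<in>{..<n}. \<alpha> i \<otimes>\<^bsub>R\<^esub> (d ^^ i) (ys ! j))"
    proof -
      have "ys ! j \<in> set ys" using ys(1) j by simp
      thus ?thesis using al(2) ys(2) by blast
    qed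
    have e2: "J.jet k (zip zs (c j)) = (\<Oplus>\<^bsub>\<Omega>\<^esub>i\<in>{..<n}. \<iota> (\<alpha>' i) \<otimes>\<^bsub>\<Omega>\<^esub> J.jet i (zip zs (c j)))"
    proof (rule J.jet_linear_combination[OF _ pz[OF j]])
      show "\<alpha>' i \<in> carrier S" if "i < n" for i using al(1) that closed(2) by blast
      fix z assume "z \<in> fst ` set (zip zs (c j))"
      hence "z \<in> set zs" by (auto dest: set_zip_leftD)
      thus "(e ^^ k) z = (\<Oplus>\<^bsub>S\<^esub>i\<in>{..<n}. \<alpha>' i \<otimes>\<^bsub>S\<^esub> (e ^^ i) z)" using al(3) zs(2) by blast
    qed
    have m: "(\<alpha> i \<otimes>\<^bsub>R\<^esub> (d ^^ i) (ys ! j), \<iota> (\<alpha>' i) \<otimes>\<^bsub>\<Omega>\<^esub> J.jet i (zip zs (c j))) \<in> \<psi>"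
      if "i \<in> {..<n}" for i
    proof (rule \<psi>.mult)
      show "(\<alpha> i, \<iota> (\<alpha>' i)) \<in> \<psi>" using al(1) that \<psi>(2) unfolding \<Gamma>0_def by blast
      show "((d ^^ i) (ys ! j), J.jet i (zip zs (c j))) \<in> \<psi>" using c(3) eta j that by simp
    qed
    show ?thesis unfolding e1 e2 by (rule \<psi>.finsum[OF m])
  qed
  \<comment> \<open>\<open>cb l j\<close> is the entry of \<open>\<psi>(Y)\<inverse> Z = c\<inverse>\<close> in row \<open>j\<close> and column \<open>l\<close>\<close>
  define cb where "cb l j = (\<Oplus>\<^bsub>\<Omega>\<^esub>k\<in>{..<n}. \<xi> k j \<otimes>\<^bsub>\<Omega>\<^esub> \<iota> ((e ^^ k) (zs ! l)))" for l j
  have cbc: "cb l j \<in> carrier \<Omega>" if "l < n" "j < n" for l j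
    unfolding cb_def using xic zc that by (intro \<Omega>.finsum_closed) auto
  have inverse: "(\<Oplus>\<^bsub>\<Omega>\<^esub>j\<in>{..<n}. \<eta> i j \<otimes>\<^bsub>\<Omega>\<^esub> cb l j) = \<iota> ((e ^^ i) (zs ! l))" if i: "i < n" and l: "l < n" for i l
  proof -
    define \<zeta> where "\<zeta> k = \<iota> ((e ^^ k) (zs ! l))" for k
    have ze: "\<zeta> k \<in> carrier \<Omega>" for k using zc[OF l] by (simp add: \<zeta>_def)
    have "(\<Oplus>\<^bsub>\<Omega>\<^esub>j\<in>{..<n}. \<eta> i j \<otimes>\<^bsub>\<Omega>\<^esub> cb l j) =
        (\<Oplus>\<^bsub>\<Omega>\<^esub>j\<in>{..<n}. \<Oplus>\<^bsub>\<Omega>\<^esub>k\<in>{..<n}. \<eta> i j \<otimes>\<^bsub>\<Omega>\<^esub> \<xi> k j \<otimes>\<^bsub>\<Omega>\<^esub> \<zeta> k)"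
    proof (rule \<Omega>.add.finprod_cong')
      fix j assume j: "j \<in> {..<n}"
      have "\<eta> i j \<otimes>\<^bsub>\<Omega>\<^esub> cb l j = (\<Oplus>\<^bsub>\<Omega>\<^esub>k\<in>{..<n}. \<eta> i j \<otimes>\<^bsub>\<Omega>\<^esub> (\<xi> k j \<otimes>\<^bsub>\<Omega>\<^esub> \<zeta> k))"
        unfolding cb_def \<zeta>_def[symmetric] using etac xic ze i j by (intro \<Omega>.finsum_rdistr) auto
      also have "\<dots> = (\<Oplus>\<^bsub>\<Omega>\<^esub>k\<in>{..<n}. \<eta> i j \<otimes>\<^bsub>\<Omega>\<^esub> \<xi> k j \<otimes>\<^bsub>\<Omega>\<^esub> \<zeta> k)"
        by (rule \<Omega>.add.finprod_cong') (use etac xic ze i j in \<open>auto simp: \<Omega>.m_assoc\<close>)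
      finally show "\<eta> i j \<otimes>\<^bsub>\<Omega>\<^esub> cb l j = (\<Oplus>\<^bsub>\<Omega>\<^esub>k\<in>{..<n}. \<eta> i j \<otimes>\<^bsub>\<Omega>\<^esub> \<xi> k j \<otimes>\<^bsub>\<Omega>\<^esub> \<zeta> k)" .
    qed (use etac xic ze i in \<open>auto intro!: \<Omega>.finsum_closed\<close>)
    also have "\<dots> = (\<Oplus>\<^bsub>\<Omega>\<^esub>k\<in>{..<n}. \<Oplus>\<^bsub>\<Omega>\<^esub>j\<in>{..<n}. \<eta> i j \<otimes>\<^bsub>\<Omega>\<^esub> \<xi> k j \<otimes>\<^bsub>\<Omega>\<^esub> \<zeta> k)"
      by (rule \<Omega>.finsum_swap) (use etac xic ze i in auto)
    also have "\<dots> = (\<Oplus>\<^bsub>\<Omega>\<^esub>k\<in>{..<n}. if i = k then \<zeta> k else \<zero>\<^bsub>\<Omega>\<^esub>)"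
    proof (rule \<Omega>.add.finprod_cong')
      fix k assume k: "k \<in> {..<n}"
      have "(\<Oplus>\<^bsub>\<Omega>\<^esub>j\<in>{..<n}. \<eta> i j \<otimes>\<^bsub>\<Omega>\<^esub> \<xi> k j \<otimes>\<^bsub>\<Omega>\<^esub> \<zeta> k) = (\<Oplus>\<^bsub>\<Omega>\<^esub>j\<in>{..<n}. \<eta> i j \<otimes>\<^bsub>\<Omega>\<^esub> \<xi> k j) \<otimes>\<^bsub>\<Omega>\<^esub> \<zeta> k"
        using etac xic ze i k by (intro \<Omega>.finsum_ldistr[symmetric]) auto
      also have "(\<Oplus>\<^bsub>\<Omega>\<^esub>j\<in>{..<n}. \<eta> i j \<otimes>\<^bsub>\<Omega>\<^esub> \<xi> k j) = (if i = k then \<one>\<^bsub>\<Omega>\<^esub> else \<zero>\<^bsub>\<Omega>\<^esub>)"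
      proof (rule \<psi>.unique)
        have "((\<Oplus>\<^bsub>R\<^esub>j\<in>{..<n}. (d ^^ i) (ys ! j) \<otimes>\<^bsub>R\<^esub> v k ! j), (\<Oplus>\<^bsub>\<Omega>\<^esub>j\<in>{..<n}. \<eta> i j \<otimes>\<^bsub>\<Omega>\<^esub> \<xi> k j)) \<in> \<psi>"
          using eta xi i k by (intro \<psi>.finsum \<psi>.mult) auto
        thus "((if i = k then \<one>\<^bsub>R\<^esub> else \<zero>\<^bsub>R\<^esub>), (\<Oplus>\<^bsub>\<Omega>\<^esub>j\<in>{..<n}. \<eta> i j \<otimes>\<^bsub>\<Omega>\<^esub> \<xi> k j)) \<in> \<psi>"
          using v(3)[of k i] i k by (cases "i = k") auto
        show "((if i = k then \<one>\<^bsub>R\<^esub> else \<zero>\<^bsub>R\<^esub>), (if i = k then \<one>\<^bsub>\<Omega>\<^esub> else \<zero>\<^bsub>\<Omega>\<^esub>)) \<in> \<psi>"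
          using \<psi>.one \<psi>.zero by simp
      qed
      finally show "(\<Oplus>\<^bsub>\<Omega>\<^esub>j\<in>{..<n}. \<eta> i j \<otimes>\<^bsub>\<Omega>\<^esub> \<xi> k j \<otimes>\<^bsub>\<Omega>\<^esub> \<zeta> k) = (if i = k then \<zeta> k else \<zero>\<^bsub>\<Omega>\<^esub>)"
        using ze by simp
    qed (use ze in auto)
    also have "\<dots> = \<zeta> i" using ze i by (intro \<Omega>.add.finprod_singleton) auto
    finally show ?thesis by (simp add: \<zeta>_def)
  qed
  define C where "C = S.constant_field"
  have C: "subfield C S" unfolding C_def by (rule S.constant_field_subfield)
  note \<tau>0 = constant_graph[OF C _ fO hom]
  have fS: "field S" by unfold_locales
  define gens2 where "gens2 = concat (map c [0..<n]) @ concat (map (\<lambda>l. map (cb l) [0..<n]) [0..<n])"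
  have gens2c: "set gens2 \<subseteq> carrier \<Omega>" using c(2) cbc by (fastforce simp: gens2_def)
  obtain \<tau> where \<tau>: "partial_hom \<Omega> (S\<lparr>carrier := C\<rparr>) \<tau>" "{(\<iota> c, c) |c. c \<in> C} \<subseteq> \<tau>" "set gens2 \<subseteq> Domain \<tau>"
    using extension_from_subfield[OF \<tau>0[OF fS] gens2c rc[folded C_def]] by (elim exE conjE)
  interpret T: specialization S e \<Omega> \<iota> \<tau>
  proof (intro specialization.intro specialization_axioms.intro)
    show "differential_field_into_field S e \<Omega> \<iota>" by unfold_locales
    show "partial_hom \<Omega> S \<tau>" by (rule partial_hom_larger_codomain[OF \<tau>(1) fS subfieldE(3)[OF C]])
    show "c \<in> S.constant_field" if "(b, c) \<in> \<tau>" for b c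
      using partial_hom.closed(2)[OF \<tau>(1) that] by (simp add: C_def)
    show "(\<iota> c, c) \<in> \<tau>" if "c \<in> S.constant_field" for c using \<tau>(2) that by (auto simp: C_def)
  qed
  define \<chi> where "\<chi> = T.descend R d \<psi>"
  have incl: "(x, \<iota> w) \<in> \<psi>" if "(x, w) \<in> \<Gamma>" for x w using \<psi>(2) that by (auto simp: \<Gamma>0_def)
  have R: "differential_field R d" and G: "partial_diff_hom R d S e \<Gamma>" by unfold_locales
  note chi = T.descend_partial_diff_hom[OF \<psi>(1) R G incl, folded \<chi>_def]
  have "\<exists>cs. list_all2 (\<lambda>b c. (b, c) \<in> \<tau>) (c j) cs" if "j < n" for j
  proof (rule T.\<tau>.list_values)
    have "set (c j) \<subseteq> set gens2" using that by (auto simp: gens2_def)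
    thus "set (c j) \<subseteq> Domain \<tau>" using \<tau>(3) by (rule subset_trans)
  qed
  then obtain c' where c': "\<And>j. j < n \<Longrightarrow> list_all2 (\<lambda>b c. (b, c) \<in> \<tau>) (c j) (c' j)" by metis
  define u where "u j = zip zs (zip (c j) (c' j))" for j
  have u: "T.tensors (u j)" "T.tjet i (u j) = J.jet i (zip zs (c j))" if "j < n" for i j
    using T.zip_tensors(1,2)[OF zsc c'[OF that]] zs(1) c(1)[OF that] by (auto simp: u_def)
  define us where "us = map u [0..<n]"
  define ws where "ws = map T.tval us"
  have "(ys ! j, T.tval (u j)) \<in> \<chi>" if "j < n" for j
    unfolding \<chi>_def using yc[OF that] u[OF that] JC[OF that] by (intro T.descend_mem) auto
  hence la: "list_all2 (\<lambda>y w. (y, w) \<in> \<chi>) ys ws"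
    using ys(1) by (auto simp: list_all2_conv_all_nth ws_def us_def)
  have wsc: "set ws \<subseteq> carrier S" using u(1) T.tval_closed by (auto simp: ws_def us_def)
  have "zs ! l \<in> S.Span S.constant_field ws" if l: "l < n" for l
  proof -
    define bs where "bs = map (cb l) [0..<n]"
    have lb: "length bs = n" by (simp add: bs_def)
    have "set bs \<subseteq> set gens2" using l by (auto simp: gens2_def bs_def)
    hence "set bs \<subseteq> Domain \<tau>" using \<tau>(3) by (rule subset_trans)
    then obtain cs where cs: "list_all2 (\<lambda>b c. (b, c) \<in> \<tau>) bs cs" using T.\<tau>.list_values by blast
    have us: "length us = length bs" by (simp add: us_def bs_def)
    have ust: "T.tensors q" if q: "q \<in> set us" for q
    proof -
      obtain j where "j < n" "q = u j" using q by (auto simp: us_def)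
      thus ?thesis using u(1) by simp
    qed
    obtain t where t: "T.tensors t" "fst ` set t \<subseteq> fst ` \<Union>(set ` set us)" "T.tval t = S.combine cs ws"
      "\<And>i. T.tjet i t = (\<Oplus>\<^bsub>\<Omega>\<^esub>j\<in>{..<n}. T.tjet i (us ! j) \<otimes>\<^bsub>\<Omega>\<^esub> bs ! j)"
      using T.tensor_combination[OF cs us ust] unfolding ws_def lb by blast
    have "fst ` \<Union>(set ` set us) \<subseteq> set zs"
      by (auto simp: us_def u_def dest: set_zip_leftD)
    with t(2) have ft: "fst ` set t \<subseteq> set zs" by (rule subset_trans)
    \<comment> \<open>the tensor of \<open>\<psi>(Y) c\<inverse> - Z\<close>, whose jets vanish, so that its specialization vanishes too\<close>
    let ?t = "(zs ! l, \<ominus>\<^bsub>\<Omega>\<^esub> \<one>\<^bsub>\<Omega>\<^esub>, \<ominus>\<^bsub>S\<^esub> \<one>\<^bsub>S\<^esub>) # t"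
    have tt: "T.tensors ?t" using t(1) zc[OF l] T.\<tau>.uminus[OF T.\<tau>.one] by auto
    have low: "T.tjet i ?t = \<zero>\<^bsub>\<Omega>\<^esub>" if i: "i < n" for i
    proof -
      have "T.tjet i t = (\<Oplus>\<^bsub>\<Omega>\<^esub>j\<in>{..<n}. \<eta> i j \<otimes>\<^bsub>\<Omega>\<^esub> cb l j)"
        unfolding t(4)
        by (rule \<Omega>.add.finprod_cong') (use u(2) c(3) i l etac cbc in \<open>auto simp: us_def bs_def\<close>)
      hence "T.tjet i t = \<iota> ((e ^^ i) (zs ! l))" using inverse[OF i l] by simp
      thus ?thesis using zc[OF l] by (simp add: \<Omega>.r_minus \<Omega>.l_neg)
    qed
    have pt: "J.pairs (map (apsnd fst) ?t)"
      using T.tensor_closed[OF tt] by fastforce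
    have st: "fst ` set (map (apsnd fst) ?t) \<subseteq> solutions S e (carrier S) n a'"
    proof -
      have "zs ! l \<in> set zs" using l zs(1) by simp
      hence "fst ` set ?t \<subseteq> set zs" using ft by simp
      moreover have "fst ` set (map (apsnd fst) ?t) = fst ` set ?t" by force
      ultimately show ?thesis using zs(2) by blast
    qed
    have "T.tjet i ?t = \<zero>\<^bsub>\<Omega>\<^esub>" for i
      using J.jet_relation_extends[OF ac' pt st, of i] low by (simp only: T.tjet_eq_jet)
    hence "T.tval ?t = \<zero>\<^bsub>S\<^esub>" by (rule T.tval_well_defined[OF tt])
    moreover have csC: "set cs \<subseteq> S.constant_field"
      using cs T.constant_values by (induction rule: list_all2_induct) auto
    hence csc: "set cs \<subseteq> carrier S" using S.constant_field_closed by blast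
    have cw: "S.combine cs ws \<in> carrier S" using csc wsc by blast
    ultimately have "\<ominus>\<^bsub>S\<^esub> (zs ! l) \<oplus>\<^bsub>S\<^esub> S.combine cs ws = \<zero>\<^bsub>S\<^esub>"
      using zc[OF l] t(3) by (simp add: S.r_minus)
    hence "zs ! l = S.combine cs ws"
      using zc[OF l] cw by (metis S.minus_equality S.minus_minus S.a_inv_closed S.a_comm)
    moreover have "length cs = length ws"
      using list_all2_lengthD[OF cs] lb by (simp add: ws_def us_def)
    ultimately show ?thesis
      using S.Span_eq_combine_set_length_version[OF S.constant_field_subfield wsc] csC by blast
  qed
  hence "set zs \<subseteq> S.Span S.constant_field ws" using zs(1) by (auto simp: in_set_conv_nth simp del: S.Span.simps)
  thus ?thesis using chi la by blast
qed

section \<open>Transporting data along partial homomorphisms\<close>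

context partial_hom
begin

lemma combine_values:
  "\<lbrakk>list_all2 (\<lambda>k l. (k, l) \<in> \<Gamma>) ks ls; list_all2 (\<lambda>x w. (x, w) \<in> \<Gamma>) xs ws\<rbrakk>
    \<Longrightarrow> (R.combine ks xs, S.combine ls ws) \<in> \<Gamma>"
proof (induction ks ls arbitrary: xs ws rule: list_all2_induct)
  case Nil
  show ?case using zero by simp
next
  case (Cons k ks l ls)
  show ?case
  proof (cases xs)
    case Nil
    thus ?thesis using Cons.prems zero by simp
  next
    case (Cons x xs')
    then obtain w ws' where "ws = w # ws'" "(x, w) \<in> \<Gamma>" "list_all2 (\<lambda>x w. (x, w) \<in> \<Gamma>) xs' ws'"
      using Cons.prems by (auto simp: list_all2_Cons1)
    thus ?thesis using Cons Cons.IH Cons.hyps by (auto intro!: add mult)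
  qed
qed

lemma eval_values:
  "\<lbrakk>list_all2 (\<lambda>x w. (x, w) \<in> \<Gamma>) p q; (x, w) \<in> \<Gamma>\<rbrakk> \<Longrightarrow> (R.eval p x, S.eval q w) \<in> \<Gamma>"
proof (induction p q rule: list_all2_induct)
  case Nil
  show ?case using zero by simp
next
  case (Cons a p b q)
  have pw: "(x [^]\<^bsub>R\<^esub> k, w [^]\<^bsub>S\<^esub> k) \<in> \<Gamma>" for k :: nat
    by (induction k) (auto intro: one mult Cons.prems)
  have "length p = length q" using Cons.hyps(2) by (rule list_all2_lengthD)
  thus ?case using Cons pw by (auto intro!: add mult)
qed

lemma injective_on_subfield:
  assumes "subfield (Domain \<Gamma>) R" "(x, \<zero>\<^bsub>S\<^esub>) \<in> \<Gamma>"
  shows "x = \<zero>\<^bsub>R\<^esub>"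
proof (rule ccontr)
  assume x: "x \<noteq> \<zero>\<^bsub>R\<^esub>"
  hence "inv\<^bsub>R\<^esub> x \<in> Domain \<Gamma>" using R.subfield_m_inv(1)[OF assms(1)] assms(2) by auto
  then obtain w where w: "(inv\<^bsub>R\<^esub> x, w) \<in> \<Gamma>" by blast
  have "(\<one>\<^bsub>R\<^esub>, \<zero>\<^bsub>S\<^esub>) \<in> \<Gamma>"
    using mult[OF assms(2) w] closed[OF assms(2)] closed[OF w] x by simp
  thus False using unique[OF one] S.one_not_zero by blast
qed

lemma restrict_partial_hom:
  assumes "subring A R" "A \<subseteq> Domain \<Gamma>"
  shows "partial_hom R S (\<Gamma> \<inter> A \<times> UNIV)" and "Domain (\<Gamma> \<inter> A \<times> UNIV) = A"
proof -
  note A = subringE[OF assms(1)]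
  show "partial_hom R S (\<Gamma> \<inter> A \<times> UNIV)"
    by unfold_locales (use closed one add mult uminus zero_unique A in auto)
  show "Domain (\<Gamma> \<inter> A \<times> UNIV) = A" using assms(2) by auto
qed

lemma converse_Domain_subfield:
  assumes "subfield (Domain \<Gamma>) R"
  shows "partial_hom S R (\<Gamma>\<inverse>)" and "subfield (Domain (\<Gamma>\<inverse>)) S"
proof -
  have ph: "partial_hom R S \<Gamma>" by unfold_locales
  show c: "partial_hom S R (\<Gamma>\<inverse>)"
    by (rule partial_hom_converse[OF ph injective_on_subfield[OF assms]])
  show "subfield (Domain (\<Gamma>\<inverse>)) S"
  proof (rule S.subfieldI')
    show "subring (Domain (\<Gamma>\<inverse>)) S" by (rule partial_hom.Domain_subring[OF c])
    fix w assume w: "w \<in> Domain (\<Gamma>\<inverse>) - {\<zero>\<^bsub>S\<^esub>}"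
    then obtain x where x: "(x, w) \<in> \<Gamma>" by auto
    have x0: "x \<noteq> \<zero>\<^bsub>R\<^esub>" using w x zero_unique by auto
    hence "inv\<^bsub>R\<^esub> x \<in> Domain \<Gamma>" using R.subfield_m_inv(1)[OF assms] x by auto
    then obtain v where v: "(inv\<^bsub>R\<^esub> x, v) \<in> \<Gamma>" by blast
    have "(\<one>\<^bsub>R\<^esub>, w \<otimes>\<^bsub>S\<^esub> v) \<in> \<Gamma>" using mult[OF x v] closed(1)[OF x] x0 by simp
    hence "w \<otimes>\<^bsub>S\<^esub> v = \<one>\<^bsub>S\<^esub>" using unique one by blast
    hence "inv\<^bsub>S\<^esub> w = v" using closed(2)[OF x] closed(2)[OF v] by (intro S.comm_inv_char)
    thus "inv\<^bsub>S\<^esub> w \<in> Domain (\<Gamma>\<inverse>)" using v by auto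
  qed
qed

end

lemma (in differential_field) deriv_quotient:
  assumes "x \<in> carrier R" "y \<in> carrier R" "y \<noteq> \<zero>"
  shows "d (x \<otimes> inv y) = (d x \<otimes> y \<ominus> x \<otimes> d y) \<otimes> inv (y \<otimes> y)"
proof -
  define z where "z = inv y"
  have z: "z \<in> carrier R" "y \<otimes> z = \<one>" using assms by (auto simp: z_def)
  note c = assms(1,2) z(1) deriv_closed[OF assms(1)] deriv_closed[OF assms(2)]
  have i: "inv (y \<otimes> y) = z \<otimes> z"
  proof (rule comm_inv_char)
    have "y \<otimes> y \<otimes> (z \<otimes> z) = (y \<otimes> z) \<otimes> (y \<otimes> z)" using c by (simp add: m_ac)
    thus "y \<otimes> y \<otimes> (z \<otimes> z) = \<one>" using z by simp
  qed (use c in auto)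
  have "d z = \<ominus> (d y \<otimes> z \<otimes> z)" unfolding z_def by (rule deriv_inv[OF assms(2,3)])
  hence "d (x \<otimes> z) = d x \<otimes> z \<oplus> x \<otimes> \<ominus> (d y \<otimes> z \<otimes> z)" using deriv_mult[OF c(1,3)] by simp
  moreover have "(d x \<otimes> y \<ominus> x \<otimes> d y) \<otimes> (z \<otimes> z) = (y \<otimes> z) \<otimes> (d x \<otimes> z) \<ominus> x \<otimes> (d y \<otimes> z \<otimes> z)"
    using c by algebra
  ultimately have "d (x \<otimes> z) = (d x \<otimes> y \<ominus> x \<otimes> d y) \<otimes> (z \<otimes> z)"
    using c by (simp add: z(2) minus_eq r_minus)
  thus ?thesis unfolding i by (simp add: z_def)
qed

context partial_diff_hom
begin

lemma localization_partial_diff_hom: "partial_diff_hom R d S e (localization R S \<Gamma>)"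
proof -
  interpret L: partial_hom R S "localization R S \<Gamma>" by (rule localization_partial_hom)
  show ?thesis
  proof unfold_locales
    fix p q assume "(p, q) \<in> localization R S \<Gamma>"
    then obtain x w y v where 1: "p = x \<otimes>\<^bsub>R\<^esub> inv\<^bsub>R\<^esub> y" "q = w \<otimes>\<^bsub>S\<^esub> inv\<^bsub>S\<^esub> v"
      "(x, w) \<in> \<Gamma>" "(y, v) \<in> \<Gamma>" "v \<noteq> \<zero>\<^bsub>S\<^esub>"
      unfolding localization_def by blast
    note c = closed[OF 1(3)] closed[OF 1(4)] nonzero[OF 1(4,5)]
    have n: "v \<otimes>\<^bsub>S\<^esub> v \<noteq> \<zero>\<^bsub>S\<^esub>" using 1 c S.integral by blast
    show "(d p, e q) \<in> localization R S \<Gamma>"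
      unfolding 1(1,2) R.deriv_quotient[OF c(1,3,5)] S.deriv_quotient[OF c(2,4) 1(5)]
      by (rule localization_mem[OF minus[OF mult[OF deriv[OF 1(3)] 1(4)] mult[OF 1(3) deriv[OF 1(4)]]]
            mult[OF 1(4) 1(4)] n])
  qed
qed

lemma solutions_map:
  assumes "\<And>i. i < n \<Longrightarrow> (a i, a' i) \<in> \<Gamma>" "(y, w) \<in> \<Gamma>" "y \<in> solutions R d (carrier R) n a"
  shows "w \<in> solutions S e (carrier S) n a'"
proof -
  have "(lin_diff_op R d n a y, lin_diff_op S e n a' w) \<in> \<Gamma>" by (rule lin_diff_op[OF assms(1,2)])
  hence "(\<zero>\<^bsub>R\<^esub>, lin_diff_op S e n a' w) \<in> \<Gamma>" using assms(3) by (simp add: solutions_def)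
  thus ?thesis using zero_unique closed(2)[OF assms(2)] by (auto simp: solutions_def)
qed

lemma constants_map: "\<lbrakk>(x, w) \<in> \<Gamma>; x \<in> R.constant_field\<rbrakk> \<Longrightarrow> w \<in> S.constant_field"
  using deriv[of x w] zero_unique closed[of x w] by (auto simp: constants_def)

lemma constants_reflect:
  assumes "subfield (Domain \<Gamma>) R" "(x, w) \<in> \<Gamma>" "w \<in> S.constant_field"
  shows "x \<in> R.constant_field"
  using deriv[OF assms(2)] injective_on_subfield[OF assms(1), of "d x"] closed[OF assms(2)] assms(3)
  by (auto simp: constants_def)

text \<open>The constants of \<open>S\<close> are algebraically closed because \<open>\<Gamma>\<close> identifies them with those of \<open>R\<close>.\<close>

lemma root_closed_constants:
  assumes "R.constant_field \<subseteq> Domain \<Gamma>" "S.constant_field \<subseteq> Range \<Gamma>" "subfield (Domain \<Gamma>) R"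
    and rc: "root_closed (R\<lparr>carrier := R.constant_field\<rparr>)"
  shows "root_closed (S\<lparr>carrier := S.constant_field\<rparr>)"
  unfolding root_closed_def
proof (intro allI impI)
  note CR = subfieldE(1)[OF R.constant_field_subfield] and CS = subfieldE(1)[OF S.constant_field_subfield]
  fix q assume "set q \<subseteq> carrier (S\<lparr>carrier := S.constant_field\<rparr>)" and len: "2 \<le> length q"
    and hd0: "hd q \<noteq> \<zero>\<^bsub>S\<lparr>carrier := S.constant_field\<rparr>\<^esub>"
  hence q: "set q \<subseteq> S.constant_field" by simp
  have "\<exists>p. set p \<subseteq> R.constant_field \<and> list_all2 (\<lambda>x w. (x, w) \<in> \<Gamma>) p q"
    using q
  proof (induction q)
    case (Cons w q)
    then obtain p where "set p \<subseteq> R.constant_field" "list_all2 (\<lambda>x w. (x, w) \<in> \<Gamma>) p q" by auto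
    moreover obtain x where x: "(x, w) \<in> \<Gamma>" using Cons.prems assms(2) by auto
    moreover have "x \<in> R.constant_field" using constants_reflect[OF assms(3) x] Cons.prems by simp
    ultimately show ?case by (intro exI[of _ "x # p"]) auto
  qed auto
  then obtain p where p: "set p \<subseteq> R.constant_field" "list_all2 (\<lambda>x w. (x, w) \<in> \<Gamma>) p q" by blast
  have lp: "length p = length q" using p(2) by (rule list_all2_lengthD)
  have "(hd p, hd q) \<in> \<Gamma>" using p(2) len lp by (cases p; cases q) auto
  hence "hd p \<noteq> \<zero>\<^bsub>R\<^esub>" using hd0 zero_unique by auto
  hence "\<exists>\<xi>\<in>R.constant_field. R.eval p \<xi> = \<zero>\<^bsub>R\<^esub>"
    using root_closedD[OF rc, of p] p(1) len lp R.eval_consistent[OF CR] by simp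
  then obtain \<xi> where x: "\<xi> \<in> R.constant_field" "R.eval p \<xi> = \<zero>\<^bsub>R\<^esub>" by blast
  then obtain \<xi>' where x': "(\<xi>, \<xi>') \<in> \<Gamma>" using assms(1) by blast
  have "S.eval q \<xi>' = \<zero>\<^bsub>S\<^esub>" using eval_values[OF p(2) x'] x(2) zero_unique by simp
  moreover have "\<xi>' \<in> S.constant_field" by (rule constants_map[OF x' x(1)])
  ultimately show "\<exists>\<xi>\<in>carrier (S\<lparr>carrier := S.constant_field\<rparr>).
      ring.eval (S\<lparr>carrier := S.constant_field\<rparr>) q \<xi> = \<zero>\<^bsub>S\<lparr>carrier := S.constant_field\<rparr>\<^esub>"
    using S.eval_consistent[OF CS] by auto
qed

end

section \<open>Finitely generated algebras\<close>

context ring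
begin

text \<open>Generation as a module under multiplication by generators: this form gives inductions in which one
  factor is always a generator.\<close>

inductive_set algebra_gen :: "'a set \<Rightarrow> 'a list \<Rightarrow> 'a set" for E gs where
  scalar: "e \<in> E \<Longrightarrow> e \<in> algebra_gen E gs"
| add: "\<lbrakk>x \<in> algebra_gen E gs; y \<in> algebra_gen E gs\<rbrakk> \<Longrightarrow> x \<oplus> y \<in> algebra_gen E gs"
| gen: "\<lbrakk>g \<in> set gs; x \<in> algebra_gen E gs\<rbrakk> \<Longrightarrow> g \<otimes> x \<in> algebra_gen E gs"

text \<open>The factor \<open>\<one>\<close> makes the lists increase with \<open>m\<close>: \<open>products gs m\<close> contains all products of at most \<open>m\<close>
  generators, so the spans exhaust the algebra by finite-dimensional spaces.\<close>

fun products :: "'a list \<Rightarrow> nat \<Rightarrow> 'a list" where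
  "products gs 0 = [\<one>]"
| "products gs (Suc m) = concat (map (\<lambda>g. map ((\<otimes>) g) (products gs m)) (\<one> # gs))"

end

context cring
begin

context
  fixes E gs
  assumes E: "subring E R" and gs: "set gs \<subseteq> carrier R"
begin

lemma algebra_gen_closed: "x \<in> algebra_gen E gs \<Longrightarrow> x \<in> carrier R"
  by (induction rule: algebra_gen.induct) (use subringE(1)[OF E] gs in auto)

lemma algebra_gen_smult: "\<lbrakk>e \<in> E; x \<in> algebra_gen E gs\<rbrakk> \<Longrightarrow> e \<otimes> x \<in> algebra_gen E gs"
proof (rotate_tac, induction rule: algebra_gen.induct)
  case (scalar e')
  thus ?case using subringE(6)[OF E] by (auto intro: algebra_gen.scalar)
next
  case (add x y)
  have "e \<in> carrier R" using add.prems subringE(1)[OF E] by auto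
  thus ?case using add algebra_gen_closed by (simp add: r_distr algebra_gen.add)
next
  case (gen g x)
  have c: "e \<in> carrier R" "g \<in> carrier R" "x \<in> carrier R"
    using gen.prems gen.hyps subringE(1)[OF E] gs algebra_gen_closed by auto
  have "e \<otimes> x \<in> algebra_gen E gs" using gen by blast
  with gen.hyps(1) have "g \<otimes> (e \<otimes> x) \<in> algebra_gen E gs" by (rule algebra_gen.gen)
  thus ?case using c by (simp add: m_lcomm)
qed

lemma algebra_gen_mult:
  "\<lbrakk>x \<in> algebra_gen E gs; y \<in> algebra_gen E gs\<rbrakk> \<Longrightarrow> x \<otimes> y \<in> algebra_gen E gs"
proof (induction rule: algebra_gen.induct)
  case (scalar e)
  thus ?case by (rule algebra_gen_smult)
next
  case (add x x')
  thus ?case using algebra_gen_closed by (simp add: l_distr algebra_gen.add)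
next
  case (gen g x)
  have "g \<in> carrier R" using gen.hyps gs by auto
  thus ?case using gen algebra_gen_closed by (simp add: m_assoc algebra_gen.gen)
qed

lemma algebra_gen_subring: "subring (algebra_gen E gs) R"
proof (rule subringI)
  show "algebra_gen E gs \<subseteq> carrier R" using algebra_gen_closed by blast
  show "\<one> \<in> algebra_gen E gs" using subringE(3)[OF E] by (rule algebra_gen.scalar)
  show "\<ominus> x \<in> algebra_gen E gs" if "x \<in> algebra_gen E gs" for x
  proof -
    have "\<ominus> \<one> \<in> E" using subringE(3,5)[OF E] by blast
    hence "\<ominus> \<one> \<otimes> x \<in> algebra_gen E gs" using that by (rule algebra_gen_smult)
    thus ?thesis using algebra_gen_closed[OF that] by (simp add: l_minus)
  qed
qed (auto intro: algebra_gen.add algebra_gen_mult)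

lemma algebra_gen_incl: "E \<subseteq> algebra_gen E gs" "set gs \<subseteq> algebra_gen E gs"
proof -
  show "E \<subseteq> algebra_gen E gs" by (auto intro: algebra_gen.scalar)
  show "set gs \<subseteq> algebra_gen E gs"
  proof
    fix g assume g: "g \<in> set gs"
    have "g \<otimes> \<one> \<in> algebra_gen E gs"
      using g subringE(3)[OF E] by (intro algebra_gen.gen algebra_gen.scalar)
    thus "g \<in> algebra_gen E gs" using g gs by (simp add: subset_iff)
  qed
qed

lemma products_closed: "set (products gs m) \<subseteq> carrier R"
  using gs by (induction m) auto

end

lemma products_Span_step:
  assumes E: "subfield E R" and gs: "set gs \<subseteq> carrier R"
    and g: "g \<in> set (\<one> # gs)" and x: "x \<in> Span E (products gs m)"
  shows "g \<otimes> x \<in> Span E (products gs (Suc m))"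
proof -
  note pc = products_closed[OF subfieldE(1)[OF E] gs]
  obtain ks where ks: "set ks \<subseteq> E" "x = combine ks (products gs m)"
    using x Span_eq_combine_set[OF E pc] by auto
  have gc: "g \<in> carrier R" using g gs by auto
  have kc: "set ks \<subseteq> carrier R" using ks(1) subfieldE(3)[OF E] by auto
  let ?p = "map (\<lambda>u. u \<otimes> g) (products gs m)"
  have pe: "?p = map ((\<otimes>) g) (products gs m)"
    using pc[of m] gc by (intro map_cong) (auto simp: m_comm subset_iff)
  have ps: "set ?p \<subseteq> set (products gs (Suc m))" unfolding pe using g by auto
  have pcc: "set ?p \<subseteq> carrier R" using pc[of m] gc by auto
  have xc: "x \<in> carrier R" using ks(2) kc pc by auto
  have "g \<otimes> x = x \<otimes> g" using m_comm[OF gc xc] .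
  also have "\<dots> = combine ks ?p"
    unfolding ks(2) by (rule combine_l_distr[OF kc pc gc])
  also have "\<dots> \<in> Span E ?p" using Span_eq_combine_set[OF E pcc] ks(1) by auto
  finally show ?thesis
    using mono_Span_subset[OF E _ pc, of ?p "Suc m"] ps Span_base_incl[OF E pc, of "Suc m"] by blast
qed

lemma algebra_gen_products:
  assumes E: "subfield E R" and gs: "set gs \<subseteq> carrier R" and x: "x \<in> algebra_gen E gs"
  shows "\<exists>m. x \<in> Span E (products gs m)"
proof -
  note Es = subfieldE(1)[OF E]
  note pc = products_closed[OF Es gs]
  have Suc: "Span E (products gs m) \<subseteq> Span E (products gs (Suc m))" for m
  proof (rule mono_Span_subset[OF E _ pc])
    have "set (products gs m) \<subseteq> set (products gs (Suc m))"
      using pc[of m] by (auto simp: image_iff subset_iff)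
    thus "set (products gs m) \<subseteq> Span E (products gs (Suc m))"
      using Span_base_incl[OF E pc] by blast
  qed
  have mono: "Span E (products gs m) \<subseteq> Span E (products gs k)" if "m \<le> k" for m k
    by (rule lift_Suc_mono_le[of "\<lambda>m. Span E (products gs m)", OF Suc that])
  show ?thesis using x
  proof (induction rule: algebra_gen.induct)
    case (scalar e)
    have e: "e \<in> carrier R" using scalar subfieldE(3)[OF E] by auto
    have "e \<otimes> \<one> \<in> Span E [\<one>]"
      using scalar Span_base_incl[OF E, of "[\<one>]"] by (intro Span_smult_closed[OF E]) auto
    thus ?case using e by (intro exI[of _ 0]) (simp del: Span.simps)
  next
    case (add x y)
    then obtain m k where "x \<in> Span E (products gs m)" "y \<in> Span E (products gs k)" by blast
    hence "x \<in> Span E (products gs (max m k))" "y \<in> Span E (products gs (max m k))"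
      using mono by (meson max.cobounded1 max.cobounded2 subsetD)+
    thus ?case using Span_subgroup_props(3)[OF E pc] by blast
  next
    case (gen g x)
    then obtain m where m: "x \<in> Span E (products gs m)" by blast
    hence "g \<otimes> x \<in> Span E (products gs (Suc m))"
      using gen.hyps(1) by (intro products_Span_step[OF E gs]) auto
    thus ?case by blast
  qed
qed

end

context differential_field
begin

definition derivatives_below :: "nat \<Rightarrow> 'a list \<Rightarrow> 'a list"
  where "derivatives_below n ys = concat (map (\<lambda>y. map (\<lambda>k. (d ^^ k) y) [0..<n]) ys)"

lemma set_derivatives_below:
  "set (derivatives_below n ys) = {(d ^^ k) y |k y. k < n \<and> y \<in> set ys}"
proof (intro equalityI subsetI)
  fix g assume "g \<in> set (derivatives_below n ys)"
  then obtain y k where "y \<in> set ys" "k < n" "g = (d ^^ k) y"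
    by (auto simp: derivatives_below_def)
  thus "g \<in> {(d ^^ k) y |k y. k < n \<and> y \<in> set ys}" by blast
next
  fix g assume "g \<in> {(d ^^ k) y |k y. k < n \<and> y \<in> set ys}"
  then obtain y k where *: "y \<in> set ys" "k \<in> set [0..<n]" "g = (d ^^ k) y" by auto
  have "g \<in> set (map (\<lambda>k. (d ^^ k) y) [0..<n])"
    unfolding set_map by (rule image_eqI[where f = "\<lambda>k. (d ^^ k) y", OF *(3,2)])
  thus "g \<in> set (derivatives_below n ys)"
    unfolding derivatives_below_def set_concat set_map[of "\<lambda>y. map (\<lambda>k. (d ^^ k) y) [0..<n]"]
    by (intro UN_I[OF *(1)] UnionI[OF imageI[OF imageI[OF *(1)]]])
qed

lemma derivatives_below_closed: "set ys \<subseteq> carrier R \<Longrightarrow> set (derivatives_below n ys) \<subseteq> carrier R"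
  by (auto simp: set_derivatives_below)

text \<open>The highest derivative of a generator that leaves the list is brought back by the equation.\<close>

lemma algebra_gen_deriv:
  assumes E: "differential_subfield R d E" and a: "\<And>i. i < n \<Longrightarrow> a i \<in> E"
    and ys: "set ys \<subseteq> solutions R d (carrier R) n a"
    and x: "x \<in> algebra_gen E (derivatives_below n ys)"
  shows "d x \<in> algebra_gen E (derivatives_below n ys)"
proof -
  let ?gs = "derivatives_below n ys"
  let ?A = "algebra_gen E ?gs"
  have Es: "subring E R" "E \<subseteq> carrier R" and Ed: "\<And>x. x \<in> E \<Longrightarrow> d x \<in> E"
    using E subfieldE(1,3) unfolding differential_subfield_def by auto
  have ysc: "set ys \<subseteq> carrier R" using ys by (auto simp: solutions_def)
  note gsc = derivatives_below_closed[OF ysc, of n]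
  note A = algebra_gen_subring[OF Es(1) gsc]
  note Ae = subringE[OF A]
  have sums: "finsum R f I \<in> ?A" if "\<And>i. i \<in> I \<Longrightarrow> f i \<in> ?A" for f and I :: "nat set"
  proof (cases "finite I")
    case True
    thus ?thesis using that
    proof (induction I)
      case (insert i I)
      have "f \<in> I \<rightarrow> carrier R" "f i \<in> carrier R" using insert.prems Ae(1) by auto
      thus ?case using insert Ae(7) by auto
    qed (simp add: Ae(2))
  qed (simp add: Ae(2))
  have "(d ^^ n) y \<in> ?A" if y: "y \<in> set ys" for y
  proof -
    have yc: "y \<in> carrier R" using y ysc by auto
    define s where "s = (\<Oplus>i\<in>{..<n}. a i \<otimes> (d ^^ i) y)"
    have "(d ^^ i) y \<in> ?A" if "i < n" for i
      using algebra_gen_incl(2)[OF Es(1) gsc] y that by (auto simp: set_derivatives_below)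
    moreover have "a i \<in> ?A" if "i < n" for i using algebra_gen_incl(1)[OF Es(1) gsc] a that by blast
    ultimately have s: "s \<in> ?A" unfolding s_def using Ae(6) by (intro sums) auto
    have "(d ^^ n) y \<oplus> s = \<zero>"
      using y ys by (auto simp: solutions_def lin_diff_op_def s_def)
    hence "(d ^^ n) y = \<ominus> s" using yc s Ae(1) by (intro minus_equality[symmetric]) (auto simp: a_comm)
    thus ?thesis using Ae(5)[OF s] by simp
  qed
  hence dg: "d g \<in> ?A" if mem: "g \<in> set ?gs" for g
  proof -
    obtain k y where g: "g = (d ^^ k) y" "k < n" "y \<in> set ys" using mem by (auto simp: set_derivatives_below)
    show ?thesis
    proof (cases "Suc k = n")
      case True
      thus ?thesis using \<open>\<And>y. y \<in> set ys \<Longrightarrow> (d ^^ n) y \<in> ?A\<close>[OF g(3)] g(1) by auto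
    next
      case False
      hence "(d ^^ Suc k) y \<in> set ?gs" using g(2,3)
        unfolding set_derivatives_below by (intro CollectI exI[of _ "Suc k"] exI[of _ y]) auto
      thus ?thesis using algebra_gen_incl(2)[OF Es(1) gsc] g(1) by auto
    qed
  qed
  from x show ?thesis
  proof (induction rule: algebra_gen.induct)
    case (scalar e)
    thus ?case using Ed by (intro algebra_gen.scalar)
  next
    case (add x y)
    thus ?case using Ae(1,7) by (simp add: deriv_add subset_iff)
  next
    case (gen g x)
    have c: "g \<in> carrier R" "x \<in> carrier R" using gen.hyps gsc Ae(1) by auto
    have "g \<in> ?A" using gen.hyps algebra_gen_incl(2)[OF Es(1) gsc] by auto
    thus ?case using deriv_mult[OF c] dg[OF gen.hyps(1)] gen.hyps(2) gen.IH Ae(6,7) by auto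
  qed
qed

lemma funpow_combine:
  assumes "set cs \<subseteq> constant_field" "set us \<subseteq> carrier R"
  shows "(d ^^ k) (combine cs us) = combine cs (map (d ^^ k) us)"
proof (induction k)
  case (Suc k)
  have "set (map (d ^^ k) us) \<subseteq> carrier R" using assms(2) by auto
  from deriv_combine[OF assms(1) this] show ?case using Suc by (simp add: comp_def)
qed simp

text \<open>A differential endomorphism of \<open>E[ys]\<close> over \<open>E\<close> that maps the solutions onto themselves maps the space of
  polynomials of degree at most \<open>m\<close> in the generators onto itself, for every \<open>m\<close>. This space has finite
  dimension, so the endomorphism is injective on it.\<close>

lemma endomorphism_injective:
  assumes \<theta>: "partial_diff_hom R d R d \<theta>" and E: "subfield E R"
    and C: "constant_field \<subseteq> E" and Id: "Id_on E \<subseteq> \<theta>"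
    and ys: "set ys \<subseteq> carrier R" and la: "list_all2 (\<lambda>y w. (y, w) \<in> \<theta>) ys ws"
    and span: "set ys \<subseteq> Span constant_field ws"
    and x: "x \<in> algebra_gen E (derivatives_below n ys)" "(x, \<zero>) \<in> \<theta>"
  shows "x = \<zero>"
proof (rule ccontr)
  assume x0: "x \<noteq> \<zero>"
  interpret \<theta>: partial_diff_hom R d R d \<theta> by fact
  let ?gs = "derivatives_below n ys"
  note Es = subfieldE(1)[OF E]
  note gsc = derivatives_below_closed[OF ys, of n]
  note pc = products_closed[OF Es gsc]
  have wsc: "set ws \<subseteq> carrier R"
    using la by (induction rule: list_all2_induct) (auto dest: \<theta>.closed)
  have ids: "list_all2 (\<lambda>k l. (k, l) \<in> \<theta>) ks ks" if "set ks \<subseteq> E" for ks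
    using that Id by (auto simp: list_all2_same)
  have lin: "\<exists>u\<in>Span E vs. (u, w) \<in> \<theta>"
    if vsc: "set vs \<subseteq> carrier R" and w: "w \<in> Span E us" and usc: "set us \<subseteq> carrier R"
      and im: "\<And>z. z \<in> set us \<Longrightarrow> \<exists>u\<in>Span E vs. (u, z) \<in> \<theta>" for us vs w
  proof -
    obtain ks where ks: "set ks \<subseteq> E" "w = combine ks us"
      using w Span_eq_combine_set[OF E usc] by auto
    have "\<exists>us'. set us' \<subseteq> Span E vs \<and> list_all2 (\<lambda>u z. (u, z) \<in> \<theta>) us' us"
      using im
    proof (induction us)
      case (Cons z us)
      then obtain us' where "set us' \<subseteq> Span E vs" "list_all2 (\<lambda>u z. (u, z) \<in> \<theta>) us' us"
        by (auto simp del: Span.simps)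
      moreover obtain u where "u \<in> Span E vs" "(u, z) \<in> \<theta>" using Cons.prems[of z] by auto
      ultimately show ?case by (intro exI[of _ "u # us'"]) (auto simp del: Span.simps)
    qed auto
    then obtain us' where us': "set us' \<subseteq> Span E vs" "list_all2 (\<lambda>u z. (u, z) \<in> \<theta>) us' us" by blast
    have uc: "set us' \<subseteq> carrier R" using us'(1) Span_subgroup_props(1)[OF E vsc] by blast
    have "combine ks us' \<in> Span E us'" using Span_eq_combine_set[OF E uc] ks(1) by auto
    hence "combine ks us' \<in> Span E vs" using mono_Span_subset[OF E us'(1) vsc] by blast
    moreover have "(combine ks us', w) \<in> \<theta>"
      unfolding ks(2) by (rule \<theta>.combine_values[OF ids[OF ks(1)] us'(2)])
    ultimately show ?thesis by blast
  qed
  have onto: "\<exists>u\<in>Span E (products ?gs m). (u, w) \<in> \<theta>" if "w \<in> set (products ?gs m)" for w m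
    using that
  proof (induction m arbitrary: w)
    case 0
    have "\<one> \<in> Span E [\<one>]" using Span_base_incl[OF E, of "[\<one>]"] by auto
    thus ?case using 0 \<theta>.one by (auto simp del: Span.simps)
  next
    case (Suc m)
    then obtain g w' where w: "w = g \<otimes> w'" "g \<in> set (\<one> # ?gs)" "w' \<in> set (products ?gs m)" by auto
    obtain u' where u': "u' \<in> Span E (products ?gs m)" "(u', w') \<in> \<theta>" using Suc.IH[OF w(3)] by blast
    have "\<exists>g'. (g', g) \<in> \<theta> \<and> g' \<otimes> u' \<in> Span E (products ?gs (Suc m))"
    proof (cases "g = \<one>")
      case True
      thus ?thesis using products_Span_step[OF E gsc _ u'(1), of \<one>] \<theta>.one by auto
    next
      case False
      then obtain k y where g: "g = (d ^^ k) y" "k < n" "y \<in> set ys"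
        using w(2) by (auto simp: set_derivatives_below)
      obtain cs where cs: "set cs \<subseteq> constant_field" "y = combine cs ws"
        using g(3) span Span_eq_combine_set[OF constant_field_subfield wsc] by auto
      have csE: "set cs \<subseteq> E" and csc: "set cs \<subseteq> carrier R" using cs(1) C constant_field_closed by blast+
      have "(combine cs ys, y) \<in> \<theta>" unfolding cs(2) by (rule \<theta>.combine_values[OF ids[OF csE] la])
      hence mem: "((d ^^ k) (combine cs ys), g) \<in> \<theta>" unfolding g(1) by (rule \<theta>.funpow_deriv)
      define us where "us = map (d ^^ k) ys"
      have us: "set us \<subseteq> set ?gs" "set us \<subseteq> carrier R"
        using g(2) ys by (auto simp: us_def set_derivatives_below)
      have u'c: "u' \<in> carrier R" using u'(1) Span_subgroup_props(1)[OF E pc] by blast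
      have "(d ^^ k) (combine cs ys) \<otimes> u' = combine cs (map (\<lambda>u. u \<otimes> u') us)"
        unfolding funpow_combine[OF cs(1) ys] us_def[symmetric] by (rule combine_l_distr[OF csc us(2) u'c])
      moreover have "set (map (\<lambda>u. u \<otimes> u') us) \<subseteq> Span E (products ?gs (Suc m))"
        using products_Span_step[OF E gsc _ u'(1)] us(1) by auto
      hence "Span E (map (\<lambda>u. u \<otimes> u') us) \<subseteq> Span E (products ?gs (Suc m))"
        by (rule mono_Span_subset[OF E _ pc])
      moreover have "combine cs (map (\<lambda>u. u \<otimes> u') us) \<in> Span E (map (\<lambda>u. u \<otimes> u') us)"
      proof -
        have "set (map (\<lambda>u. u \<otimes> u') us) \<subseteq> carrier R" using us(2) u'c by auto
        thus ?thesis using Span_eq_combine_set[OF E] csE by auto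
      qed
      ultimately show ?thesis using mem by (intro exI[of _ "(d ^^ k) (combine cs ys)"]) auto
    qed
    then obtain g' where "(g', g) \<in> \<theta>" "g' \<otimes> u' \<in> Span E (products ?gs (Suc m))" by blast
    thus ?case using \<theta>.mult[OF _ u'(2), of g' g] w(1) by blast
  qed
  obtain m where m: "x \<in> Span E (products ?gs m)" using algebra_gen_products[OF E gsc x(1)] by blast
  let ?V = "Span E (products ?gs m)"
  \<comment> \<open>with \<open>x\<close> in a basis, the image of the space is spanned by one element less than its dimension\<close>
  obtain bs where bs: "set bs \<subseteq> carrier R" "independent E bs" "Span E bs = ?V"
    using filter_base[OF E pc] by blast
  have dim: "dimension (length bs) E ?V" using dimensionI[OF E bs(2,3)] .
  have xc: "x \<in> carrier R" using \<theta>.closed(1)[OF x(2)] .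
  have "independent E [x]" using x0 xc li_Cons[of x E "[]"] by simp
  then obtain vs where vs: "independent E (vs @ [x])" "Span E (vs @ [x]) = ?V"
    using complete_base[OF E dim, of "[x]"] m by auto
  have vsc: "set (vs @ [x]) \<subseteq> carrier R" using independent_in_carrier[OF vs(1)] .
  have vsV: "set (vs @ [x]) \<subseteq> ?V" using Span_base_incl[OF E vsc] vs(2) by simp
  have "?V \<subseteq> Domain \<theta>"
  proof
    fix v assume "v \<in> ?V"
    then obtain ks where ks: "set ks \<subseteq> E" "v = combine ks (products ?gs m)"
      using Span_eq_combine_set[OF E pc] by auto
    have ysD: "set ys \<subseteq> Domain \<theta>" using la by (induction rule: list_all2_induct) auto
    have "set ?gs \<subseteq> Domain \<theta>"
      using ysD \<theta>.funpow_deriv unfolding set_derivatives_below by blast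
    hence "set (products ?gs k) \<subseteq> Domain \<theta>" for k
    proof (induction k)
      case 0
      show ?case using \<theta>.one by auto
    next
      case (Suc k)
      have o: "\<one> \<in> Domain \<theta>" using \<theta>.one by blast
      have "g \<otimes> w \<in> Domain \<theta>" if "g \<in> set (\<one> # ?gs)" "w \<in> set (products ?gs k)" for g w
      proof (rule subringE(6)[OF \<theta>.Domain_subring])
        show "g \<in> Domain \<theta>" using that(1) Suc.prems o unfolding list.set by blast
        show "w \<in> Domain \<theta>" using that(2) Suc.IH[OF Suc.prems] by blast
      qed
      thus ?case by auto
    qed
    then obtain ws' where "list_all2 (\<lambda>x w. (x, w) \<in> \<theta>) (products ?gs m) ws'"
      using \<theta>.list_values by blast
    from \<theta>.combine_values[OF ids[OF ks(1)] this] show "v \<in> Domain \<theta>" unfolding ks(2) by blast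
  qed
  then obtain vs' where vs': "list_all2 (\<lambda>x w. (x, w) \<in> \<theta>) vs vs'"
    using \<theta>.list_values[of vs] vsV by (auto simp del: Span.simps)
  have vs'c: "set vs' \<subseteq> carrier R"
    using vs' by (induction rule: list_all2_induct) (auto dest: \<theta>.closed)
  have "?V \<subseteq> Span E vs'"
  proof
    fix v assume v: "v \<in> ?V"
    obtain u where u: "u \<in> ?V" "(u, v) \<in> \<theta>"
      using lin[OF pc v pc onto] by blast
    obtain ks where ks: "set ks \<subseteq> E" "length ks = length (vs @ [x])" "u = combine ks (vs @ [x])"
      using u(1) vs(2) Span_eq_combine_set_length_version[OF E vsc] by auto
    obtain ks' k where k: "ks = ks' @ [k]" "length ks' = length vs"
      using ks(2) by (cases ks rule: rev_cases) auto
    have "list_all2 (\<lambda>x w. (x, w) \<in> \<theta>) (vs @ [x]) (vs' @ [\<zero>])"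
      using vs' x(2) by (simp add: list_all2_appendI)
    from \<theta>.combine_values[OF ids[OF ks(1)] this] have "(u, combine ks (vs' @ [\<zero>])) \<in> \<theta>"
      unfolding ks(3) .
    hence veq: "v = combine ks (vs' @ [\<zero>])" using \<theta>.unique u(2) by blast
    have kc: "set ks' \<subseteq> carrier R" "k \<in> carrier R" "set ks' \<subseteq> E"
      using ks(1) k(1) subfieldE(3)[OF E] by auto
    have l: "length ks' = length vs'" using k(2) list_all2_lengthD[OF vs'] by simp
    have "combine ks' vs' \<oplus> combine [k] [\<zero>] = combine (ks' @ [k]) (vs' @ [\<zero>])"
      by (rule combine_append[OF l kc(1) vs'c]) (use kc in auto)
    hence "v = combine ks' vs'" unfolding veq k(1) using kc vs'c by simp
    thus "v \<in> Span E vs'" using Span_eq_combine_set[OF E vs'c] kc(3) by auto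
  qed
  hence "length (vs @ [x]) \<le> length vs'"
    using independent_in_Span_length[OF E vs(1) vs'c] vsV by blast
  thus False using list_all2_lengthD[OF vs'] by simp
qed

end

section \<open>Extending embeddings of differential fields\<close>

lemma partial_diff_hom_comp:
  assumes "partial_diff_hom R d S e \<Gamma>" "partial_diff_hom S e T f \<Delta>"
  shows "partial_diff_hom R d T f (\<Gamma> O \<Delta>)"
proof -
  interpret A: partial_diff_hom R d S e \<Gamma> by fact
  interpret B: partial_diff_hom S e T f \<Delta> by fact
  interpret C: partial_hom R T "\<Gamma> O \<Delta>"
    by (rule partial_hom_comp[where S = S]) unfold_locales
  show ?thesis by unfold_locales (auto intro: A.deriv B.deriv)
qed

lemma partial_diff_hom_converse:
  assumes "partial_diff_hom R d S e \<Gamma>" "subfield (Domain \<Gamma>) R"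
  shows "partial_diff_hom S e R d (\<Gamma>\<inverse>)"
proof -
  interpret A: partial_diff_hom R d S e \<Gamma> by fact
  interpret C: partial_hom S R "\<Gamma>\<inverse>" by (rule A.converse_Domain_subfield(1)[OF assms(2)])
  show ?thesis by unfold_locales (auto intro: A.deriv)
qed

text \<open>The extension to the solutions has to be injective before it passes to fractions. Extending the
  inverse of \<open>\<Gamma>\<close> to the solutions in \<open>S\<close> in the same way gives a map back, and the composite is an
  endomorphism as in \<open>endomorphism_injective\<close>.\<close>

lemma (in partial_diff_hom) adjoin_solutions:
  assumes E: "subfield (Domain \<Gamma>) R"
    and C: "R.constant_field \<subseteq> Domain \<Gamma>" "S.constant_field \<subseteq> Range \<Gamma>"
    and rc: "root_closed (R\<lparr>carrier := R.constant_field\<rparr>)"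
    and a: "\<And>i. i < n \<Longrightarrow> (a i, a' i) \<in> \<Gamma>"
    and ys: "length ys = n" "R.independent R.constant_field ys"
      "set ys \<subseteq> solutions R d (carrier R) n a"
    and zs: "length zs = n" "S.independent S.constant_field zs"
      "S.Span S.constant_field zs = solutions S e (carrier S) n a'"
  shows "\<exists>\<Gamma>'. partial_diff_hom R d S e \<Gamma>' \<and> \<Gamma> \<subseteq> \<Gamma>' \<and> subfield (Domain \<Gamma>') R \<and> set ys \<subseteq> Domain \<Gamma>'"
proof -
  have \<Gamma>: "partial_diff_hom R d S e \<Gamma>" by unfold_locales
  let ?E = "Domain \<Gamma>"
  have zsc: "set zs \<subseteq> carrier S" using S.independent_in_carrier[OF zs(2)] .
  have zsol: "set zs \<subseteq> solutions S e (carrier S) n a'"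
    using S.Span_base_incl[OF S.constant_field_subfield zsc] zs(3) by simp
  have ysc: "set ys \<subseteq> carrier R" using ys(3) by (auto simp: solutions_def)
  obtain \<chi> ws where \<chi>: "partial_diff_hom R d S e \<chi>" "\<Gamma> \<subseteq> \<chi>" "list_all2 (\<lambda>y w. (y, w) \<in> \<chi>) ys ws"
    "set zs \<subseteq> S.Span S.constant_field ws"
    using extend_to_solutions[OF E a ys(1,3,2) zs(1) zsol zs(2) root_closed_constants[OF C E rc]] by blast
  interpret chi: partial_diff_hom R d S e \<chi> by (rule \<chi>(1))
  have wsol: "set ws \<subseteq> solutions S e (carrier S) n a'"
    using \<chi>(3) ys(3)
  proof (induction rule: list_all2_induct)
    case (Cons y ys w ws)
    have "w \<in> solutions S e (carrier S) n a'"
      by (rule chi.solutions_map[of n a a' y]) (use a \<chi>(2) Cons in auto)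
    thus ?case using Cons by simp
  qed simp
  interpret conv: partial_diff_hom S e R d "\<Gamma>\<inverse>" by (rule partial_diff_hom_converse[OF \<Gamma> E])
  have a_conv: "(a' i, a i) \<in> \<Gamma>\<inverse>" if "i < n" for i using a[OF that] by simp
  obtain \<omega> vs where \<omega>: "partial_diff_hom S e R d \<omega>" "\<Gamma>\<inverse> \<subseteq> \<omega>" "list_all2 (\<lambda>z v. (z, v) \<in> \<omega>) zs vs"
    "set ys \<subseteq> R.Span R.constant_field vs"
    using conv.extend_to_solutions[OF converse_Domain_subfield(2)[OF E] a_conv zs(1) zsol zs(2) ys(1,3,2) rc]
    by blast
  interpret om: partial_diff_hom S e R d \<omega> by (rule \<omega>(1))
  define \<theta> where "\<theta> = \<chi> O \<omega>"
  have th: "partial_diff_hom R d R d \<theta>" unfolding \<theta>_def by (rule partial_diff_hom_comp[OF \<chi>(1) \<omega>(1)])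
  have Id: "Id_on ?E \<subseteq> \<theta>" using \<chi>(2) \<omega>(2) by (auto simp: \<theta>_def)
  have CS: "\<exists>c'\<in>R.constant_field. (c, c') \<in> \<omega>" if c: "c \<in> S.constant_field" for c
  proof -
    obtain c' where c': "(c', c) \<in> \<Gamma>" using C(2) c by blast
    thus ?thesis using constants_reflect[OF E c' c] \<omega>(2) by blast
  qed
  have CSl: "\<exists>cs'. set cs' \<subseteq> R.constant_field \<and> list_all2 (\<lambda>k l. (k, l) \<in> \<omega>) cs cs'"
    if "set cs \<subseteq> S.constant_field" for cs
    using that
  proof (induction cs)
    case (Cons c cs)
    then obtain cs' where "set cs' \<subseteq> R.constant_field" "list_all2 (\<lambda>k l. (k, l) \<in> \<omega>) cs cs'" by auto
    moreover obtain c' where "c' \<in> R.constant_field" "(c, c') \<in> \<omega>" using CS[of c] Cons.prems by auto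
    ultimately show ?case by (intro exI[of _ "c' # cs'"]) auto
  qed simp
  have "set ws \<subseteq> Domain \<omega>"
  proof
    fix w assume "w \<in> set ws"
    hence "w \<in> S.Span S.constant_field zs" using wsol zs(3) by blast
    then obtain cs where cs: "set cs \<subseteq> S.constant_field" "w = S.combine cs zs"
      using S.Span_eq_combine_set[OF S.constant_field_subfield zsc] by auto
    obtain cs' where "list_all2 (\<lambda>k l. (k, l) \<in> \<omega>) cs cs'" using CSl[OF cs(1)] by blast
    from om.combine_values[OF this \<omega>(3)] show "w \<in> Domain \<omega>" unfolding cs(2) by blast
  qed
  then obtain us where us: "list_all2 (\<lambda>w u. (w, u) \<in> \<omega>) ws us" using om.list_values by blast
  have la: "list_all2 (\<lambda>y u. (y, u) \<in> \<theta>) ys us"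
    by (rule list_all2_trans[OF _ \<chi>(3) us]) (auto simp: \<theta>_def)
  have usc: "set us \<subseteq> carrier R" using us by (induction rule: list_all2_induct) (auto dest: om.closed)
  have vsc: "set vs \<subseteq> carrier R" using \<omega>(3) by (induction rule: list_all2_induct) (auto dest: om.closed)
  have wsc: "set ws \<subseteq> carrier S" using wsol by (auto simp: solutions_def)
  have "set vs \<subseteq> R.Span R.constant_field us"
    using \<omega>(3) \<chi>(4)
  proof (induction rule: list_all2_induct)
    case (Cons z zs v vs)
    then obtain cs where cs: "set cs \<subseteq> S.constant_field" "z = S.combine cs ws"
      using S.Span_eq_combine_set[OF S.constant_field_subfield wsc] by auto
    obtain cs' where cs': "set cs' \<subseteq> R.constant_field" "list_all2 (\<lambda>k l. (k, l) \<in> \<omega>) cs cs'"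
      using CSl[OF cs(1)] by blast
    have "(z, R.combine cs' us) \<in> \<omega>" unfolding cs(2) by (rule om.combine_values[OF cs'(2) us])
    hence "v = R.combine cs' us" using om.unique Cons.hyps(1) by blast
    hence "v \<in> R.Span R.constant_field us"
      using R.Span_eq_combine_set[OF R.constant_field_subfield usc] cs'(1) by auto
    thus ?case using Cons.IH Cons.prems by simp
  qed simp
  hence "R.Span R.constant_field vs \<subseteq> R.Span R.constant_field us"
    by (rule R.mono_Span_subset[OF R.constant_field_subfield _ usc])
  hence span: "set ys \<subseteq> R.Span R.constant_field us" using \<omega>(4) by blast
  define A where "A = R.algebra_gen ?E (R.derivatives_below n ys)"
  have inj: "x = \<zero>\<^bsub>R\<^esub>" if "x \<in> A" "(x, \<zero>\<^bsub>S\<^esub>) \<in> \<chi>" for x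
  proof (rule R.endomorphism_injective[OF th E C(1) Id ysc la span])
    show "x \<in> R.algebra_gen ?E (R.derivatives_below n ys)" using that(1) by (simp add: A_def)
    show "(x, \<zero>\<^bsub>R\<^esub>) \<in> \<theta>" using that(2) om.zero by (auto simp: \<theta>_def)
  qed
  note Es = subfieldE(1)[OF E]
  note gsc = R.derivatives_below_closed[OF ysc, of n]
  have Asub: "subring A R" unfolding A_def by (rule R.algebra_gen_subring[OF Es gsc])
  have ysA: "set ys \<subseteq> Domain \<chi>" using \<chi>(3) by (induction rule: list_all2_induct) auto
  have AD: "A \<subseteq> Domain \<chi>"
  proof
    fix x assume "x \<in> A"
    thus "x \<in> Domain \<chi>" unfolding A_def
    proof (induction rule: R.algebra_gen.induct)
      case (scalar e)
      thus ?case using \<chi>(2) by blast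
    next
      case (add x y)
      thus ?case by (blast intro: chi.add)
    next
      case (gen g x)
      have "g \<in> Domain \<chi>"
        using gen.hyps(1) ysA chi.funpow_deriv unfolding R.set_derivatives_below by blast
      thus ?case using gen.IH by (blast intro: chi.mult)
    qed
  qed
  let ?X = "\<chi> \<inter> A \<times> UNIV"
  interpret X: partial_hom R S ?X by (rule chi.restrict_partial_hom(1)[OF Asub AD])
  have Ed: "differential_subfield R d ?E"
    unfolding differential_subfield_def using E deriv by blast
  have "partial_diff_hom R d S e ?X"
  proof unfold_locales
    fix x w assume xw: "(x, w) \<in> ?X"
    have "d x \<in> A" unfolding A_def
      by (rule R.algebra_gen_deriv[OF Ed _ ys(3)]) (use a xw in \<open>auto simp: A_def\<close>)
    thus "(d x, e w) \<in> ?X" using chi.deriv xw by auto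
  qed
  then interpret X: partial_diff_hom R d S e ?X .
  let ?L = "localization R S ?X"
  have "partial_diff_hom R d S e ?L" by (rule X.localization_partial_diff_hom)
  moreover have "subfield (Domain ?L) R"
    by (rule X.localization_Domain_subfield) (use inj in auto)
  moreover have "?X \<subseteq> ?L" by (rule X.localization_incl)
  moreover have "\<Gamma> \<subseteq> ?X"
  proof (rule subrelI)
    fix x w assume xw: "(x, w) \<in> \<Gamma>"
    hence "x \<in> ?E" by (rule DomainI)
    hence "x \<in> A" using R.algebra_gen_incl(1)[OF Es gsc] unfolding A_def by (rule subsetD[rotated])
    thus "(x, w) \<in> ?X" using xw \<chi>(2) by auto
  qed
  moreover have "set ys \<subseteq> Domain ?X"
  proof
    fix y assume y: "y \<in> set ys"
    have "y \<in> A"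
    proof (cases n)
      case 0
      thus ?thesis using y ys(1) by simp
    next
      case (Suc m)
      hence "(d ^^ 0) y \<in> set (R.derivatives_below n ys)"
        unfolding R.set_derivatives_below using y by (intro CollectI exI[of _ 0] exI[of _ y]) auto
      thus ?thesis using R.algebra_gen_incl(2)[OF Es gsc] unfolding A_def by auto
    qed
    thus "y \<in> Domain ?X" using chi.restrict_partial_hom(2)[OF Asub AD] by simp
  qed
  ultimately show ?thesis by (intro exI[of _ ?L]) blast
qed

lemma partial_diff_hom_chain_Union:
  assumes ne: "\<C> \<noteq> {}" and chain: "\<And>\<Gamma> \<Delta>. \<lbrakk>\<Gamma> \<in> \<C>; \<Delta> \<in> \<C>\<rbrakk> \<Longrightarrow> \<Gamma> \<subseteq> \<Delta> \<or> \<Delta> \<subseteq> \<Gamma>"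
    and hom: "\<And>\<Gamma>. \<Gamma> \<in> \<C> \<Longrightarrow> partial_diff_hom R d S e \<Gamma>"
    and sub: "\<And>\<Gamma>. \<Gamma> \<in> \<C> \<Longrightarrow> subfield (Domain \<Gamma>) R"
  shows "partial_diff_hom R d S e (\<Union>\<C>)" and "subfield (Domain (\<Union>\<C>)) R"
proof -
  obtain \<Gamma>0 where \<Gamma>0: "\<Gamma>0 \<in> \<C>" using ne by blast
  interpret G: partial_diff_hom R d S e \<Gamma>0 by (rule hom[OF \<Gamma>0])
  have joint: "\<exists>\<Gamma>\<in>\<C>. p \<in> \<Gamma> \<and> q \<in> \<Gamma>" if "p \<in> \<Union>\<C>" "q \<in> \<Union>\<C>" for p q
    using that chain by blast
  note ph = partial_diff_hom.axioms(3)[OF hom]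
  show u: "partial_diff_hom R d S e (\<Union>\<C>)"
  proof unfold_locales
    show "\<Union>\<C> \<subseteq> carrier R \<times> carrier S" using partial_hom.subset[OF ph] by blast
    show "(\<one>\<^bsub>R\<^esub>, \<one>\<^bsub>S\<^esub>) \<in> \<Union>\<C>" using G.one \<Gamma>0 by blast
    show "(x \<oplus>\<^bsub>R\<^esub> y, w \<oplus>\<^bsub>S\<^esub> v) \<in> \<Union>\<C>" "(x \<otimes>\<^bsub>R\<^esub> y, w \<otimes>\<^bsub>S\<^esub> v) \<in> \<Union>\<C>"
      if "(x, w) \<in> \<Union>\<C>" "(y, v) \<in> \<Union>\<C>" for x w y v
      using joint[OF that] partial_hom.add[OF ph] partial_hom.mult[OF ph] by blast+
    show "(\<ominus>\<^bsub>R\<^esub> x, \<ominus>\<^bsub>S\<^esub> w) \<in> \<Union>\<C>" "(d x, e w) \<in> \<Union>\<C>" if "(x, w) \<in> \<Union>\<C>" for x w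
      using that partial_hom.uminus[OF ph] partial_diff_hom.deriv[OF hom] by blast+
    show "w = \<zero>\<^bsub>S\<^esub>" if "(\<zero>\<^bsub>R\<^esub>, w) \<in> \<Union>\<C>" for w
      using that partial_hom.zero_unique[OF ph] by blast
  qed
  show "subfield (Domain (\<Union>\<C>)) R"
  proof (rule G.R.subfieldI')
    show "subring (Domain (\<Union>\<C>)) R"
      by (rule partial_hom.Domain_subring[OF partial_diff_hom.axioms(3)[OF u]])
    fix k assume "k \<in> Domain (\<Union>\<C>) - {\<zero>\<^bsub>R\<^esub>}"
    then obtain \<Gamma> where "\<Gamma> \<in> \<C>" "k \<in> Domain \<Gamma> - {\<zero>\<^bsub>R\<^esub>}" by blast
    thus "inv\<^bsub>R\<^esub> k \<in> Domain (\<Union>\<C>)"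
      using G.R.subfield_m_inv(1)[OF sub] by blast
  qed
qed

section \<open>Complete Picard--Vessiot closures\<close>

locale picard_vessiot_tower = differential_field R d for R (structure) and d +
  fixes T :: "nat \<Rightarrow> 'a set"
  assumes pv: "picard_vessiot_closure R d (T i) (T (Suc i))"
    and union: "carrier R = (\<Union>i. T i)"
begin

lemma stage_differential_subfield: "differential_subfield R d (T i)"
  using pv unfolding picard_vessiot_closure_def by blast

lemma stage_mono: "i \<le> k \<Longrightarrow> T i \<subseteq> T k"
  by (rule lift_Suc_mono_le[of T]) (use pv in \<open>auto simp: picard_vessiot_closure_def\<close>)

lemma stage_closed: "T i \<subseteq> carrier R"
  using union by auto

lemma stage_constants: "constants R d (T i) = constants R d (T 0)"
  by (induction i) (use pv in \<open>auto simp: picard_vessiot_closure_def\<close>)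

lemma constant_field_eq: "constant_field = constants R d (T 0)"
proof
  show "constant_field \<subseteq> constants R d (T 0)"
  proof
    fix x assume x: "x \<in> constant_field"
    then obtain i where "x \<in> T i" using union by (auto simp: constants_def)
    hence "x \<in> constants R d (T i)" using x by (simp add: constants_def)
    thus "x \<in> constants R d (T 0)" using stage_constants by blast
  qed
  show "constants R d (T 0) \<subseteq> constant_field" using stage_closed by (auto simp: constants_def)
qed

lemma finite_coefficients_in_stage:
  fixes n :: nat
  assumes "\<And>i. i < n \<Longrightarrow> a i \<in> carrier R"
  shows "\<exists>N. \<forall>i<n. a i \<in> T N"
proof -
  have "\<forall>i. \<exists>N. i < n \<longrightarrow> a i \<in> T N" using assms union by blast
  then obtain f where f: "\<And>i. i < n \<Longrightarrow> a i \<in> T (f i)" by metis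
  have "a i \<in> T (Max (f ` {..<n}))" if "i < n" for i
  proof -
    have "f i \<le> Max (f ` {..<n})" using that by (intro Max_ge) auto
    thus ?thesis using f[OF that] stage_mono by blast
  qed
  thus ?thesis by blast
qed

lemma full: "full_solution_sets R d (carrier R) (carrier R)"
  unfolding full_solution_sets_def
proof (intro allI impI)
  fix n and a :: "nat \<Rightarrow> 'a" assume a: "\<forall>i<n. a i \<in> carrier R"
  then obtain N where N: "\<forall>i<n. a i \<in> T N" using finite_coefficients_in_stage[of n a] by blast
  have "dimension n (constants R d (T N)) (solutions R d (T (Suc N)) n a)"
    using pv[of N] N unfolding picard_vessiot_closure_def full_solution_sets_def by blast
  hence dim: "dimension n constant_field (solutions R d (T (Suc N)) n a)"
    unfolding stage_constants[of N] constant_field_eq .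
  have "solutions R d (carrier R) n a = solutions R d (T (Suc N)) n a"
    by (rule full_solutions_complete[OF _ stage_closed dim]) (use a in auto)
  thus "dimension n constant_field (solutions R d (carrier R) n a)" using dim by simp
qed

text \<open>Every stage is generated by solutions of equations over the previous one.\<close>

lemma contains_everything:
  assumes D: "differential_subfield R d D" and "T 0 \<subseteq> D"
    and sol: "\<And>i n a. \<lbrakk>T i \<subseteq> D; \<forall>k<n. a k \<in> T i\<rbrakk> \<Longrightarrow> solutions R d (carrier R) n a \<subseteq> D"
  shows "D = carrier R"
proof -
  have "T i \<subseteq> D" for i
  proof (induction i)
    case (Suc i)
    have "solutions R d (T (Suc i)) n a \<subseteq> D" if "\<forall>k<n. a k \<in> T i" for n a
      using sol[OF Suc that] stage_closed by (auto simp: solutions_def)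
    hence sub: "T i \<union> \<Union>{solutions R d (T (Suc i)) n a |n a. \<forall>k<n. a k \<in> T i} \<subseteq> D"
      using Suc by blast
    have hull: "T (Suc i) = differential_subfield R d hull
        (T i \<union> \<Union>{solutions R d (T (Suc i)) n a |n a. \<forall>k<n. a k \<in> T i})"
      using pv[of i] unfolding picard_vessiot_closure_def differential_closure_def by blast
    show ?case by (subst hull) (rule hull_minimal[of _ D "differential_subfield R d", OF sub D])
  qed (rule assms(2))
  moreover have "D \<subseteq> carrier R"
    using D subfieldE(3) unfolding differential_subfield_def by blast
  ultimately show ?thesis using union by blast
qed

lemma minimal:
  assumes E: "differential_subfield R d E" "T 0 \<subseteq> E" "full_solution_sets R d E E"
  shows "E = carrier R"
proof (rule contains_everything[OF E(1,2)])
  fix i n and a :: "nat \<Rightarrow> 'a" assume "T i \<subseteq> E" "\<forall>k<n. a k \<in> T i"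
  hence a: "\<forall>k<n. a k \<in> E" by blast
  have Ec: "E \<subseteq> carrier R" using E(1) subfieldE(3) unfolding differential_subfield_def by blast
  have "constants R d E = constant_field"
    using Ec E(2) constant_field_eq by (auto simp: constants_def)
  hence dim: "dimension n constant_field (solutions R d E n a)"
    using E(3) a unfolding full_solution_sets_def by metis
  have "solutions R d (carrier R) n a = solutions R d E n a"
    by (rule full_solutions_complete[OF _ Ec dim]) (use a Ec in auto)
  thus "solutions R d (carrier R) n a \<subseteq> E" by (auto simp: solutions_def)
qed

text \<open>A maximal extension of \<open>\<Phi>\<close> exists by Zorn's lemma. Since \<open>K\<close> contains full sets of solutions, no
  solution of an equation over its domain can be missing from this domain.\<close>

lemma embeds_into_full:
  assumes K: "differential_field K e" and rc: "root_closed (R\<lparr>carrier := constant_field\<rparr>)"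
    and \<Phi>: "partial_diff_hom R d K e \<Phi>" "Domain \<Phi> = T 0"
    and constK: "constants K e (carrier K) \<subseteq> Range \<Phi>"
    and fullK: "full_solution_sets K e (carrier K) (carrier K)"
  shows "\<exists>\<Psi>. partial_diff_hom R d K e \<Psi> \<and> \<Phi> \<subseteq> \<Psi> \<and> Domain \<Psi> = carrier R"
proof -
  interpret K: differential_field K e by (rule K)
  let ?P = "{\<Psi>. partial_diff_hom R d K e \<Psi> \<and> \<Phi> \<subseteq> \<Psi> \<and> subfield (Domain \<Psi>) R}"
  have T0: "subfield (T 0) R" using stage_differential_subfield unfolding differential_subfield_def by blast
  have "\<exists>M\<in>?P. \<forall>N\<in>?P. M \<subseteq> N \<longrightarrow> N = M"
  proof (rule subset_Zorn_nonempty)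
    show "?P \<noteq> {}" using \<Phi> T0 by auto
    fix \<C> assume ne: "\<C> \<noteq> {}" and ch: "subset.chain ?P \<C>"
    have el: "\<Psi> \<in> ?P" if "\<Psi> \<in> \<C>" for \<Psi> using ch that unfolding subset.chain_def by blast
    have cmp: "\<Gamma> \<subseteq> \<Delta> \<or> \<Delta> \<subseteq> \<Gamma>" if "\<Gamma> \<in> \<C>" "\<Delta> \<in> \<C>" for \<Gamma> \<Delta>
      using ch that unfolding subset_chain_def by blast
    have "partial_diff_hom R d K e (\<Union>\<C>)" "subfield (Domain (\<Union>\<C>)) R"
      by (rule partial_diff_hom_chain_Union[OF ne cmp]; use el in blast)+
    moreover have "\<Phi> \<subseteq> \<Union>\<C>" using ne el by blast
    ultimately show "\<Union>\<C> \<in> ?P" by blast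
  qed
  then obtain \<Psi> where \<Psi>: "partial_diff_hom R d K e \<Psi>" "\<Phi> \<subseteq> \<Psi>" "subfield (Domain \<Psi>) R"
    and max: "\<And>N. \<lbrakk>partial_diff_hom R d K e N; \<Phi> \<subseteq> N; subfield (Domain N) R; \<Psi> \<subseteq> N\<rbrakk> \<Longrightarrow> N = \<Psi>"
    by auto
  interpret psi: partial_diff_hom R d K e \<Psi> by (rule \<Psi>(1))
  have D0: "T 0 \<subseteq> Domain \<Psi>" using \<Phi>(2) \<Psi>(2) by blast
  have C: "constant_field \<subseteq> Domain \<Psi>" "K.constant_field \<subseteq> Range \<Psi>"
  proof -
    show "constant_field \<subseteq> Domain \<Psi>" using constant_field_eq D0 by (auto simp: constants_def)
    show "K.constant_field \<subseteq> Range \<Psi>" using constK \<Psi>(2) by blast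
  qed
  have "Domain \<Psi> = carrier R"
  proof (rule contains_everything[OF _ D0])
    show "differential_subfield R d (Domain \<Psi>)"
      unfolding differential_subfield_def using \<Psi>(3) psi.deriv by blast
    fix i n and a :: "nat \<Rightarrow> 'a" assume "T i \<subseteq> Domain \<Psi>" "\<forall>k<n. a k \<in> T i"
    hence aD: "\<forall>k. \<exists>w. k < n \<longrightarrow> (a k, w) \<in> \<Psi>" by blast
    then obtain a' where a': "\<And>k. k < n \<Longrightarrow> (a k, a' k) \<in> \<Psi>" by metis
    have "dimension n constant_field (solutions R d (carrier R) n a)"
      using full psi.closed(1)[OF a'] unfolding full_solution_sets_def by blast
    then obtain ys where ys: "independent constant_field ys" "length ys = n"
      "Span constant_field ys = solutions R d (carrier R) n a"
      using exists_base[OF constant_field_subfield] by blast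
    have ysc: "set ys \<subseteq> carrier R" using independent_in_carrier[OF ys(1)] .
    have ysol: "set ys \<subseteq> solutions R d (carrier R) n a"
      using Span_base_incl[OF constant_field_subfield ysc] ys(3) by simp
    have "K.dimension n K.constant_field (solutions K e (carrier K) n a')"
      using fullK psi.closed(2)[OF a'] unfolding full_solution_sets_def by blast
    then obtain zs where zs: "K.independent K.constant_field zs" "length zs = n"
      "K.Span K.constant_field zs = solutions K e (carrier K) n a'"
      using K.exists_base[OF K.constant_field_subfield] by blast
    obtain \<Psi>' where \<Psi>': "partial_diff_hom R d K e \<Psi>'" "\<Psi> \<subseteq> \<Psi>'" "subfield (Domain \<Psi>') R"
      "set ys \<subseteq> Domain \<Psi>'"
      using psi.adjoin_solutions[OF \<Psi>(3) C rc a' ys(2,1) ysol zs(2,1,3)] by blast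
    have "\<Psi>' = \<Psi>" using max[OF \<Psi>'(1) _ \<Psi>'(3,2)] \<Psi>(2) \<Psi>'(2) by blast
    hence yD: "set ys \<subseteq> Domain \<Psi>" using \<Psi>'(4) by simp
    have "Span constant_field ys \<subseteq> Domain \<Psi>"
    proof
      fix y assume "y \<in> Span constant_field ys"
      then obtain cs where cs: "set cs \<subseteq> constant_field" "y = combine cs ys"
        using Span_eq_combine_set[OF constant_field_subfield ysc] by auto
      obtain ls where "list_all2 (\<lambda>x w. (x, w) \<in> \<Psi>) cs ls" using psi.list_values cs(1) C(1) by blast
      moreover obtain ws where "list_all2 (\<lambda>x w. (x, w) \<in> \<Psi>) ys ws" using psi.list_values yD by blast
      ultimately show "y \<in> Domain \<Psi>" unfolding cs(2) using psi.combine_values by blast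
    qed
    thus "solutions R d (carrier R) n a \<subseteq> Domain \<Psi>" using ys(3) by simp
  qed
  thus ?thesis using \<Psi> by blast
qed

text \<open>Independent solutions in \<open>R\<close> have independent images, and in the right number. So the image contains
  all solutions in \<open>K\<close> of every equation over it.\<close>

lemma embedding_full_image:
  assumes \<Psi>: "partial_diff_hom R d K e \<Psi>" "Domain \<Psi> = carrier R"
    and constK: "constants K e (carrier K) \<subseteq> \<Psi> `` constant_field"
    and fullK: "full_solution_sets K e (carrier K) (carrier K)"
  shows "differential_subfield K e (Range \<Psi>)" and "full_solution_sets K e (Range \<Psi>) (Range \<Psi>)"
proof -
  interpret psi: partial_diff_hom R d K e \<Psi> by (rule \<Psi>(1))
  have Dsub: "subfield (Domain \<Psi>) R" using \<Psi>(2) carrier_is_subfield by simp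
  have Rsub: "subfield (Range \<Psi>) K" using psi.converse_Domain_subfield(2)[OF Dsub] by simp
  thus "differential_subfield K e (Range \<Psi>)"
    unfolding differential_subfield_def using psi.deriv by blast
  have Rc: "Range \<Psi> \<subseteq> carrier K" using psi.closed by blast
  define h where "h x = (THE w. (x, w) \<in> \<Psi>)" for x
  have h: "(x, w) \<in> \<Psi> \<longleftrightarrow> x \<in> carrier R \<and> h x = w" for x w
  proof
    assume xw: "(x, w) \<in> \<Psi>"
    have "h x = w" unfolding h_def using xw psi.unique by blast
    thus "x \<in> carrier R \<and> h x = w" using psi.closed(1)[OF xw] by blast
  next
    assume xw: "x \<in> carrier R \<and> h x = w"
    then obtain v where v: "(x, v) \<in> \<Psi>" using \<Psi>(2) by blast
    moreover have "h x = v" unfolding h_def using v psi.unique by blast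
    ultimately show "(x, w) \<in> \<Psi>" using xw by blast
  qed
  have hom: "h \<in> ring_hom R K"
    using psi.one psi.add psi.mult psi.closed(2) unfolding ring_hom_def h by auto
  interpret hh: ring_hom_ring R K h by unfold_locales (rule hom)
  have inj: "inj_on h A" if A: "A \<subseteq> carrier R" for A
  proof (rule inj_onI)
    fix x y assume xy: "x \<in> A" "y \<in> A" "h x = h y"
    hence c: "x \<in> carrier R" "y \<in> carrier R" using A by auto
    have "(x, h x) \<in> \<Psi>" "(y, h x) \<in> \<Psi>" using c xy(3) h by auto
    from psi.minus[OF this] have "(x \<ominus> y, \<zero>\<^bsub>K\<^esub>) \<in> \<Psi>"
      using hh.hom_closed[OF c(1)] by (simp add: psi.S.minus_eq psi.S.r_neg)
    from psi.injective_on_subfield[OF Dsub this] show "x = y" using c r_right_minus_eq by blast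
  qed
  have hC: "h ` constant_field = psi.S.constant_field"
  proof
    show "h ` constant_field \<subseteq> psi.S.constant_field"
      using psi.constants_map h constant_field_closed(1) by blast
    show "psi.S.constant_field \<subseteq> h ` constant_field" using constK h by auto
  qed
  have constR: "constants K e (Range \<Psi>) = psi.S.constant_field"
  proof -
    have "psi.S.constant_field \<subseteq> Range \<Psi>" using constK by blast
    thus ?thesis using Rc by (auto simp: constants_def)
  qed
  show "full_solution_sets K e (Range \<Psi>) (Range \<Psi>)"
    unfolding full_solution_sets_def constR
  proof (intro allI impI)
    fix n :: nat and b assume b: "\<forall>i<n. b i \<in> Range \<Psi>"
    hence "\<forall>i. \<exists>x. i < n \<longrightarrow> (x, b i) \<in> \<Psi>" by blast
    then obtain a where a: "\<And>i. i < n \<Longrightarrow> (a i, b i) \<in> \<Psi>" by metis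
    have "dimension n constant_field (solutions R d (carrier R) n a)"
      using full psi.closed(1)[OF a] unfolding full_solution_sets_def by blast
    then obtain ys where ys: "independent constant_field ys" "length ys = n"
      "Span constant_field ys = solutions R d (carrier R) n a"
      using exists_base[OF constant_field_subfield] by blast
    have ysc: "set ys \<subseteq> carrier R" using independent_in_carrier[OF ys(1)] .
    have ysol: "set ys \<subseteq> solutions R d (carrier R) n a"
      using Span_base_incl[OF constant_field_subfield ysc] ys(3) by simp
    have dimK: "psi.S.dimension n psi.S.constant_field (solutions K e (carrier K) n b)"
      using fullK b Rc unfolding full_solution_sets_def by blast
    have "psi.S.independent (h ` constant_field) (map h ys)"
      by (rule hh.inj_hom_preserves_independent[OF constant_field_subfield psi.S.one_not_zero inj ys(1)])
        (rule Span_subgroup_props(1)[OF constant_field_subfield ysc])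
    hence ind: "psi.S.independent psi.S.constant_field (map h ys)" unfolding hC .
    have sol: "set (map h ys) \<subseteq> solutions K e (carrier K) n b"
    proof
      fix w assume "w \<in> set (map h ys)"
      then obtain y where y: "y \<in> set ys" "w = h y" by auto
      hence yw: "(y, w) \<in> \<Psi>" using h ysc by auto
      have "y \<in> solutions R d (carrier R) n a" using y(1) ysol by blast
      with a yw show "w \<in> solutions K e (carrier K) n b" by (rule psi.solutions_map)
    qed
    have span: "psi.S.Span psi.S.constant_field (map h ys) = solutions K e (carrier K) n b"
      using psi.S.independent_length_eq_dimension[OF psi.S.constant_field_subfield dimK ind sol] ys(2) by simp
    have "set (map h ys) \<subseteq> Range \<Psi>" using h ysc by auto
    have mc: "set (map h ys) \<subseteq> carrier K" using psi.S.independent_in_carrier[OF ind] .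
    have "solutions K e (carrier K) n b \<subseteq> Range \<Psi>"
    proof
      fix w assume "w \<in> solutions K e (carrier K) n b"
      then obtain cs where cs: "set cs \<subseteq> psi.S.constant_field" "w = psi.S.combine cs (map h ys)"
        unfolding span[symmetric] using psi.S.Span_eq_combine_set[OF psi.S.constant_field_subfield mc] by auto
      have "set cs \<subseteq> h ` constant_field" using cs(1) hC by simp
      hence "cs \<in> lists (h ` constant_field)" by auto
      then obtain ks where ks: "set ks \<subseteq> constant_field" "cs = map h ks"
        unfolding lists_image by auto
      have ksc: "set ks \<subseteq> carrier R" using ks(1) constant_field_closed(1) by blast
      have "w = h (combine ks ys)" unfolding cs(2) ks(2) by (rule hh.combine_hom[OF ksc ysc])
      moreover have "combine ks ys \<in> carrier R" using ksc ysc by blast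
      ultimately have "(combine ks ys, w) \<in> \<Psi>" using h by simp
      thus "w \<in> Range \<Psi>" by blast
    qed
    hence "solutions K e (Range \<Psi>) n b = solutions K e (carrier K) n b"
      using Rc by (auto simp: solutions_def)
    thus "psi.S.dimension n psi.S.constant_field (solutions K e (Range \<Psi>) n b)" using dimK by simp
  qed
qed

end

lemma differential_hom_graph:
  assumes L: "differential_field L d" and K: "differential_field K e" and F: "differential_subfield L d F"
    and j: "differential_hom (L\<lparr>carrier := F\<rparr>) d K e j"
  shows "partial_diff_hom L d K e {(x, j x) |x. x \<in> F}"
proof -
  interpret L: differential_field L d by (rule L)
  interpret K: differential_field K e by (rule K)
  have Fs: "subfield F L" and Fd: "\<And>x. x \<in> F \<Longrightarrow> d x \<in> F"
    using F unfolding differential_subfield_def by auto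
  note Fr = subringE[OF subfieldE(1)[OF Fs]]
  have jh: "j \<in> ring_hom (L\<lparr>carrier := F\<rparr>) K" and jd: "\<And>x. x \<in> F \<Longrightarrow> j (d x) = e (j x)"
    using j unfolding differential_hom_def by auto
  have jc: "j x \<in> carrier K" if "x \<in> F" for x using ring_hom_closed[OF jh] that by simp
  have ja: "j (x \<oplus>\<^bsub>L\<^esub> y) = j x \<oplus>\<^bsub>K\<^esub> j y" and jm: "j (x \<otimes>\<^bsub>L\<^esub> y) = j x \<otimes>\<^bsub>K\<^esub> j y"
    if "x \<in> F" "y \<in> F" for x y
    using ring_hom_add[OF jh, of x y] ring_hom_mult[OF jh, of x y] that by auto
  have j1: "j \<one>\<^bsub>L\<^esub> = \<one>\<^bsub>K\<^esub>" using ring_hom_one[OF jh] by simp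
  have j0: "j \<zero>\<^bsub>L\<^esub> = \<zero>\<^bsub>K\<^esub>"
    using ja[of "\<zero>\<^bsub>L\<^esub>" "\<zero>\<^bsub>L\<^esub>"] Fr(2) jc[of "\<zero>\<^bsub>L\<^esub>"] by (simp add: K.add.l_cancel_one)
  have jn: "j (\<ominus>\<^bsub>L\<^esub> x) = \<ominus>\<^bsub>K\<^esub> j x" if x: "x \<in> F" for x
  proof -
    have "x \<in> carrier L" using x Fr(1) by auto
    hence "j (\<ominus>\<^bsub>L\<^esub> x) \<oplus>\<^bsub>K\<^esub> j x = \<zero>\<^bsub>K\<^esub>"
      using ja[of "\<ominus>\<^bsub>L\<^esub> x" x] x Fr(5) j0 by (simp add: L.l_neg)
    thus ?thesis using K.minus_equality jc x Fr(5) by metis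
  qed
  show ?thesis
  proof unfold_locales
    show "{(x, j x) |x. x \<in> F} \<subseteq> carrier L \<times> carrier K" using Fr(1) jc by auto
    show "(\<one>\<^bsub>L\<^esub>, \<one>\<^bsub>K\<^esub>) \<in> {(x, j x) |x. x \<in> F}" using Fr(3) j1 by auto
  qed (use Fr ja jm jn j0 jd Fd in auto)
qed

theorem theorem1:
  fixes L :: "('a, 'm) ring_scheme" and d :: "'a \<Rightarrow> 'a" and F :: "'a set"
  assumes "differential_field L d"
    and "differential_subfield L d F"
    and "algebraically_closed (L\<lparr>carrier := constants L d F\<rparr>)"
    and "complete_picard_vessiot_closure L d F"
  shows "constants L d (carrier L) = constants L d F \<and>
    full_solution_sets L d (carrier L) (carrier L) \<and>
    (\<forall>E. differential_subfield L d E \<and> F \<subseteq> E \<and> full_solution_sets L d E E \<longrightarrow>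
      E = carrier L) \<and>
    (\<forall>(K :: ('b, 'n) ring_scheme) e j.
      differential_field K e \<and>
      differential_hom (L\<lparr>carrier := F\<rparr>) d K e j \<and>
      constants K e (carrier K) = constants K e (j ` F) \<and>
      full_solution_sets K e (carrier K) (carrier K) \<and>
      (\<forall>E. differential_subfield K e E \<and> j ` F \<subseteq> E \<and> full_solution_sets K e E E \<longrightarrow>
        E = carrier K) \<longrightarrow>
      (\<exists>h. differential_iso L d K e h \<and> (\<forall>x\<in>F. h x = j x)))"
proof -
  interpret L: differential_field L d by fact
  obtain T where T0: "T 0 = F" "\<forall>i. picard_vessiot_closure L d (T i) (T (Suc i))"
    "carrier L = (\<Union>i. T i)"
    using assms(4) unfolding complete_picard_vessiot_closure_def by (elim exE conjE)
  note T = T0(1) spec[OF T0(2)] T0(3)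
  interpret tower: picard_vessiot_tower L d T by unfold_locales (rule T(2), rule T(3))
  have const: "L.constant_field = constants L d F" using tower.constant_field_eq T(1) by simp
  have rc: "root_closed (L\<lparr>carrier := L.constant_field\<rparr>)"
    unfolding const by (rule algebraically_closed_root_closed[OF assms(3)])
  have iso: "\<exists>h. differential_iso L d K e h \<and> (\<forall>x\<in>F. h x = j x)"
    if K: "differential_field K e" and j: "differential_hom (L\<lparr>carrier := F\<rparr>) d K e j"
      and constK: "constants K e (carrier K) = constants K e (j ` F)"
      and fullK: "full_solution_sets K e (carrier K) (carrier K)"
      and minK: "\<And>E. \<lbrakk>differential_subfield K e E; j ` F \<subseteq> E; full_solution_sets K e E E\<rbrakk> \<Longrightarrow> E = carrier K"
    for K :: "('b, 'n) ring_scheme" and e j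
  proof -
    define \<Phi> where "\<Phi> = {(x, j x) |x. x \<in> F}"
    have \<Phi>: "partial_diff_hom L d K e \<Phi>" "Domain \<Phi> = T 0"
      unfolding \<Phi>_def using differential_hom_graph[OF assms(1) K assms(2) j] T(1) by auto
    interpret phi: partial_diff_hom L d K e \<Phi> by (rule \<Phi>(1))
    have F: "subfield (Domain \<Phi>) L" using assms(2) \<Phi>(2) T(1) unfolding differential_subfield_def by simp
    have cK: "constants K e (carrier K) \<subseteq> Range \<Phi>"
      unfolding constK by (auto simp: constants_def \<Phi>_def)
    obtain \<Psi> where \<Psi>: "partial_diff_hom L d K e \<Psi>" "\<Phi> \<subseteq> \<Psi>" "Domain \<Psi> = carrier L"
      using tower.embeds_into_full[OF K rc \<Phi> cK fullK] by blast
    interpret psi: partial_diff_hom L d K e \<Psi> by (rule \<Psi>(1))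
    have cK': "constants K e (carrier K) \<subseteq> \<Psi> `` L.constant_field"
    proof
      fix c assume c: "c \<in> constants K e (carrier K)"
      then obtain x where x: "(x, c) \<in> \<Phi>" using cK by blast
      hence "x \<in> L.constant_field" using phi.constants_reflect[OF F x] c by blast
      thus "c \<in> \<Psi> `` L.constant_field" using x \<Psi>(2) by blast
    qed
    note im = tower.embedding_full_image[OF \<Psi>(1,3) cK' fullK]
    have "j ` F \<subseteq> Range \<Psi>" using \<Psi>(2) unfolding \<Phi>_def by blast
    hence range: "Range \<Psi> = carrier K" using minK im by blast
    define h where "h x = (THE w. (x, w) \<in> \<Psi>)" for x
    have hx: "(x, h x) \<in> \<Psi>" if xL: "x \<in> carrier L" for x
    proof -
      obtain w where w: "(x, w) \<in> \<Psi>" using xL \<Psi>(3) by blast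
      show ?thesis unfolding h_def by (rule theI[of "\<lambda>w. (x, w) \<in> \<Psi>", OF w]) (rule psi.unique[OF _ w])
    qed
    have hu: "h x = w" if "(x, w) \<in> \<Psi>" for x w
      using hx psi.unique that psi.closed(1) by blast
    have Dsub: "subfield (Domain \<Psi>) L" using \<Psi>(3) L.carrier_is_subfield by simp
    interpret conv: partial_hom K L "\<Psi>\<inverse>" by (rule psi.converse_Domain_subfield(1)[OF Dsub])
    have "h \<in> ring_hom L K"
    proof (rule ring_hom_memI)
      show "h x \<in> carrier K" if "x \<in> carrier L" for x using psi.closed(2)[OF hx[OF that]] .
      show "h (x \<otimes>\<^bsub>L\<^esub> y) = h x \<otimes>\<^bsub>K\<^esub> h y" "h (x \<oplus>\<^bsub>L\<^esub> y) = h x \<oplus>\<^bsub>K\<^esub> h y"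
        if "x \<in> carrier L" "y \<in> carrier L" for x y
        using psi.mult[OF hx[OF that(1)] hx[OF that(2)]] psi.add[OF hx[OF that(1)] hx[OF that(2)]]
        by (auto intro: hu)
      show "h \<one>\<^bsub>L\<^esub> = \<one>\<^bsub>K\<^esub>" by (rule hu[OF psi.one])
    qed
    moreover have "bij_betw h (carrier L) (carrier K)"
    proof (rule bij_betw_imageI)
      show "inj_on h (carrier L)"
        using hx conv.unique by (intro inj_onI) (metis converseI)
      show "h ` carrier L = carrier K"
      proof
        show "h ` carrier L \<subseteq> carrier K" using psi.closed(2) hx by blast
        show "carrier K \<subseteq> h ` carrier L"
        proof
          fix w assume "w \<in> carrier K"
          then obtain x where x: "(x, w) \<in> \<Psi>" using range by blast
          show "w \<in> h ` carrier L" using hu[OF x] psi.closed(1)[OF x] by blast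
        qed
      qed
    qed
    moreover have "h (d x) = e (h x)" if "x \<in> carrier L" for x
      using hu[OF psi.deriv[OF hx[OF that]]] .
    moreover have "h x = j x" if "x \<in> F" for x
      using that \<Psi>(2) unfolding \<Phi>_def by (intro hu) blast
    ultimately show ?thesis
      unfolding differential_iso_def ring_iso_def by blast
  qed
  show ?thesis
  proof (intro conjI allI impI)
    show "constants L d (carrier L) = constants L d F" by (rule const)
    show "full_solution_sets L d (carrier L) (carrier L)" by (rule tower.full)
    show "E = carrier L" if "differential_subfield L d E \<and> F \<subseteq> E \<and> full_solution_sets L d E E" for E
      using tower.minimal[of E] that T(1) by blast
  qed (elim conjE, rule iso, simp_all)
qed

end
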